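(* Let $F:\mathbb{X}\to\mathbb{Y}$, $\mathbb{X}:=L^2(0,T;L^2(\Omega)^3)$, $\mathbb{Y}:=L^2(0,T;\mathbb{R}^J)$, be the dynamic load monitoring forward operator $$F[f](t)=\Big(\int_{\partial\Omega}\langle u(t,x),\chi_j(x)\rangle\,\mathrm{d}s_x\Big)_{j=1,\ldots,J},\qquad u:=L[f],$$ where $L[f]$ is the unique weak solution of the elastic wave initial boundary value problem with right-hand side $f$ described in the context. Then the inverse problem of dynamic load monitoring, i.e. $F(f)=y$ with $F:\mathbb{X}\to\mathbb{Y}$, is uniformly ill-posed (at every $f^+\in\mathbb{X}$).
   Context: Let $T>0$ and let $\Omega\subset\mathbb{R}^3$ be a bounded domain with Lipschitz continuous boundary and outer unit normal field $\nu$. Put $V:=H^1(\Omega)^3$, $H:=L^2(\Omega)^3$, and $W^{1,2,2}(0,T;V,H):=\{u\in L^2(0,T;V):\dot u\in L^2(0,T;H)\}$. Let $\mathbb{C}\in H^1(\Omega,\mathbb{R}^{3\times3\times3\times3})$ be the elasticity tensor and $\rho\in L^\infty(\Omega)$ the mass density, satisfying $0<\rho_{\min}<\rho(x)<\rho_{\max}<\infty$ and $\inf_{x\in\overline{\Omega}}(X,\mathbb{C}(x):X)_F\ge\alpha\|X\|_F^2$ for all $X\in\mathbb{R}^{3\times3}$ with some $\alpha>0$ (Frobenius inner product and norm). Let $\varepsilon(u)=(\nabla u+\nabla u^\top)/2$. For fixed $u_0\in H^1(\Omega)^3$, $u_1\in L^2(\Omega)^3$ consider $$\rho(x)\ddot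 u(t,x)-\nabla\cdot(\mathbb{C}(x):\varepsilon(u))(t,x)=f(t,x)\quad\text{in }[0,T]\times\Omega,$$ $$[\mathbb{C}(x):\varepsilon(u)]\cdot\nu=0\ \text{on }[0,T]\times\partial\Omega,\qquad u(0,x)=u_0(x),\ \dot u(0,x)=u_1(x)\ \text{in }\Omega.$$ It is known that for every $f\in L^2(0,T;H)$ this problem has a unique weak solution $u\in L^2(0,T;V)$ with $\dot u\in L^2(0,T;H)$, and that $L:L^2(0,T;H)\to W^{1,2,2}(0,T;V,H)$, $L[f]:=u$, is continuous (and linear if $u_0=u_1=0$). The sensor functions $\chi_j\in H^{1/2}(\partial\Omega)^3$, $j=1,\ldots,J$, with small supports on $\partial\Omega$, are given. The boundary values of $u(t,\cdot)$ in the formula for $F$ are taken in the sense of traces, and the boundary integral is understood as the dual pairing between $H^{-1/2}(\partial\Omega)^3$ and $H^{1/2}(\partial\Omega)^3$. An inverse problem $F(\vartheta)=y$, $F:\mathcal{D}(F)\subseteq\mathbb{X}\to\mathbb{Y}$, is called uniformly (locally) ill-posed in $\vartheta^+$ if for each $\rho>0$ there is a sequence $\{\vartheta_k^{(\rho)}\}_{k\in\mathbb{N}}\subseteq B_\rho(\vartheta^+)\cap\mathcal{D}(F)$ (ball in $\mathbb{X}$) with $\vartheta_k^{(\rho)}\not\to\vartheta^+$ in $\mathbb{X}$ but $F(\vartheta_k^{(\rho)})\to F(\vartheta^+)$ in $\mathbb{Y}$ as $k\to\infty$. *)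

theory Defs
  imports "HOL-Analysis.Analysis"
begin

text \<open>
  Elements of Lebesgue, Sobolev and Bochner spaces are represented by functions; only their
  classes modulo null sets matter, and the norms below are seminorms on representatives.
\<close>

section \<open>Smooth functions and Lebesgue spaces\<close>

primrec Ck :: "nat \<Rightarrow> ('a::euclidean_space \<Rightarrow> 'b::real_normed_vector) \<Rightarrow> bool" where
  "Ck 0 f \<longleftrightarrow> continuous_on UNIV f"
| "Ck (Suc k) f \<longleftrightarrow> (\<forall>x. f differentiable (at x)) \<and>
     (\<forall>i\<in>Basis. Ck k (\<lambda>x. frechet_derivative f (at x) i))"

definition smooth :: "('a::euclidean_space \<Rightarrow> 'b::real_normed_vector) \<Rightarrow> bool" where
  "smooth f \<longleftrightarrow> (\<forall>k. Ck k f)"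

definition test_functions :: "'a::euclidean_space set \<Rightarrow> ('a \<Rightarrow> real) set" where
  "test_functions A = {\<phi>. smooth \<phi> \<and> compact (closure {x. \<phi> x \<noteq> 0}) \<and> closure {x. \<phi> x \<noteq> 0} \<subseteq> A}"

definition L2 :: "'a measure \<Rightarrow> ('a \<Rightarrow> 'b::euclidean_space) set" where
  "L2 M = {f \<in> borel_measurable M. integrable M (\<lambda>x. (norm (f x))\<^sup>2)}"

definition L2_norm :: "'a measure \<Rightarrow> ('a \<Rightarrow> 'b::euclidean_space) \<Rightarrow> real" where
  "L2_norm M f = sqrt (\<integral>x. (norm (f x))\<^sup>2 \<partial>M)"

definition L2_inner :: "'a measure \<Rightarrow> ('a \<Rightarrow> 'b::euclidean_space) \<Rightarrow> ('a \<Rightarrow> 'b) \<Rightarrow> real" where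
  "L2_inner M f g = (\<integral>x. f x \<bullet> g x \<partial>M)"

section \<open>The Sobolev space \<open>H\<^sup>1\<close>\<close>

definition has_weak_deriv ::
  "'a::euclidean_space set \<Rightarrow> 'a \<Rightarrow> ('a \<Rightarrow> 'b::euclidean_space) \<Rightarrow> ('a \<Rightarrow> 'b) \<Rightarrow> bool" where
  "has_weak_deriv \<Omega> i u g \<longleftrightarrow>
     (\<forall>\<phi>\<in>test_functions \<Omega>.
        (\<integral>x. frechet_derivative \<phi> (at x) i *\<^sub>R u x \<partial>lebesgue_on \<Omega>) =
        - (\<integral>x. \<phi> x *\<^sub>R g x \<partial>lebesgue_on \<Omega>))"

definition H1 :: "'a::euclidean_space set \<Rightarrow> ('a \<Rightarrow> 'b::euclidean_space) set" where
  "H1 \<Omega> = {u \<in> L2 (lebesgue_on \<Omega>). \<forall>i\<in>Basis. \<exists>g\<in>L2 (lebesgue_on \<Omega>). has_weak_deriv \<Omega> i u g}"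

definition weak_deriv ::
  "'a::euclidean_space set \<Rightarrow> 'a \<Rightarrow> ('a \<Rightarrow> 'b::euclidean_space) \<Rightarrow> 'a \<Rightarrow> 'b" where
  "weak_deriv \<Omega> i u = (SOME g. g \<in> L2 (lebesgue_on \<Omega>) \<and> has_weak_deriv \<Omega> i u g)"

definition H1_norm :: "'a::euclidean_space set \<Rightarrow> ('a \<Rightarrow> 'b::euclidean_space) \<Rightarrow> real" where
  "H1_norm \<Omega> u = sqrt ((L2_norm (lebesgue_on \<Omega>) u)\<^sup>2 +
     (\<Sum>i\<in>Basis. (L2_norm (lebesgue_on \<Omega>) (weak_deriv \<Omega> i u))\<^sup>2))"

section \<open>Bochner spaces \<open>L\<^sup>2(0,T;S)\<close>\<close>

text \<open>
  The space \<open>S\<close> consists of functions of the space variable and carries the seminorm \<open>N\<close>.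
\<close>

definition simple_into ::
  "real \<Rightarrow> ('a \<Rightarrow> 'b::euclidean_space) set \<Rightarrow> (real \<Rightarrow> 'a \<Rightarrow> 'b) \<Rightarrow> bool" where
  "simple_into T S s \<longleftrightarrow>
     (\<exists>(n::nat) A v. (\<forall>k<n. A k \<in> sets (lebesgue_on {0<..<T}) \<and> v k \<in> S) \<and>
        s = (\<lambda>t x. \<Sum>k<n. indicat_real (A k) t *\<^sub>R v k x))"

definition strongly_measurable ::
  "real \<Rightarrow> ('a \<Rightarrow> 'b::euclidean_space) set \<Rightarrow> (('a \<Rightarrow> 'b) \<Rightarrow> real) \<Rightarrow>
   (real \<Rightarrow> 'a \<Rightarrow> 'b) \<Rightarrow> bool" where
  "strongly_measurable T S N f \<longleftrightarrow>
     (\<exists>s. (\<forall>n. simple_into T S (s n)) \<and>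
        (AE t in lebesgue_on {0<..<T}. (\<lambda>n. N (s n t - f t)) \<longlonglongrightarrow> 0))"

definition Bochner_L2 ::
  "real \<Rightarrow> ('a \<Rightarrow> 'b::euclidean_space) set \<Rightarrow> (('a \<Rightarrow> 'b) \<Rightarrow> real) \<Rightarrow>
   (real \<Rightarrow> 'a \<Rightarrow> 'b) set" where
  "Bochner_L2 T S N = {f. (AE t in lebesgue_on {0<..<T}. f t \<in> S) \<and> strongly_measurable T S N f \<and>
     integrable (lebesgue_on {0<..<T}) (\<lambda>t. (N (f t))\<^sup>2)}"

definition Bochner_L2_norm ::
  "real \<Rightarrow> (('a \<Rightarrow> 'b::euclidean_space) \<Rightarrow> real) \<Rightarrow> (real \<Rightarrow> 'a \<Rightarrow> 'b) \<Rightarrow> real" where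
  "Bochner_L2_norm T N f = sqrt (\<integral>t. (N (f t))\<^sup>2 \<partial>lebesgue_on {0<..<T})"

text \<open>
  \<open>u'\<close> is the distributional derivative of \<open>u\<close> in \<open>L\<^sup>2(0,T;L\<^sup>2(\<Omega>))\<close>. The identity between
  \<open>L\<^sup>2(\<Omega>)\<close>-valued Bochner integrals that defines it is tested against all \<open>h \<in> L\<^sup>2(\<Omega>)\<close>.
\<close>

definition has_time_deriv ::
  "real \<Rightarrow> 'a::euclidean_space set \<Rightarrow> (real \<Rightarrow> 'a \<Rightarrow> 'b::euclidean_space) \<Rightarrow>
   (real \<Rightarrow> 'a \<Rightarrow> 'b) \<Rightarrow> bool" where
  "has_time_deriv T \<Omega> u u' \<longleftrightarrow>
     (\<forall>\<phi>\<in>test_functions {0<..<T}. \<forall>h\<in>L2 (lebesgue_on \<Omega>).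
        (\<integral>t. deriv \<phi> t * L2_inner (lebesgue_on \<Omega>) (u t) h \<partial>lebesgue_on {0<..<T}) =
        - (\<integral>t. \<phi> t * L2_inner (lebesgue_on \<Omega>) (u' t) h \<partial>lebesgue_on {0<..<T}))"

text \<open>\<open>u(0) = u\<^sub>0\<close> for the representative of \<open>u\<close> in \<open>C([0,T];L\<^sup>2(\<Omega>))\<close>.\<close>

definition has_initial_value ::
  "real \<Rightarrow> 'a::euclidean_space set \<Rightarrow> (real \<Rightarrow> 'a \<Rightarrow> 'b::euclidean_space) \<Rightarrow>
   ('a \<Rightarrow> 'b) \<Rightarrow> bool" where
  "has_initial_value T \<Omega> u u0 \<longleftrightarrow>
     (\<exists>w. (\<forall>t\<in>{0..T}. w t \<in> L2 (lebesgue_on \<Omega>)) \<and>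
        (\<forall>s\<in>{0..T}. ((\<lambda>t. L2_norm (lebesgue_on \<Omega>) (w t - w s)) \<longlongrightarrow> 0) (at s within {0..T})) \<and>
        (AE t in lebesgue_on {0<..<T}. AE x in lebesgue_on \<Omega>. w t x = u t x) \<and>
        (AE x in lebesgue_on \<Omega>. w 0 x = u0 x))"

section \<open>Lipschitz domains, surface measure and traces\<close>

text \<open>
  In the direction \<open>e\<close> the domain is locally the strict epigraph of \<open>\<gamma>\<close>, which is evaluated only on
  the hyperplane orthogonal to \<open>e\<close>.
\<close>

definition Lipschitz_boundary :: "'a::euclidean_space set \<Rightarrow> bool" where
  "Lipschitz_boundary \<Omega> \<longleftrightarrow>
     (\<forall>z\<in>frontier \<Omega>. \<exists>r>0. \<exists>e (\<gamma>::'a \<Rightarrow> real) K. norm e = 1 \<and> K-lipschitz_on UNIV \<gamma> \<and>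
        \<Omega> \<inter> ball z r = {x \<in> ball z r. x \<bullet> e > \<gamma> (x - (x \<bullet> e) *\<^sub>R e)})"

definition bounded_Lipschitz_domain :: "'a::euclidean_space set \<Rightarrow> bool" where
  "bounded_Lipschitz_domain \<Omega> \<longleftrightarrow>
     open \<Omega> \<and> connected \<Omega> \<and> \<Omega> \<noteq> {} \<and> bounded \<Omega> \<and> Lipschitz_boundary \<Omega>"

text \<open>
  The surface measure is the two-dimensional Hausdorff measure; the factor \<open>\<pi>/4\<close> (the area of a
  planar disc of diameter 1) makes it agree with the surface area.
\<close>

definition Hausdorff2 :: "(real^3) set \<Rightarrow> ennreal" where
  "Hausdorff2 A =
     (SUP \<delta>\<in>{0::real<..}.
        INF U\<in>{U::nat \<Rightarrow> (real^3) set. A \<subseteq> (\<Union>i. U i) \<and> (\<forall>i. bounded (U i) \<and> diameter (U i) \<le> \<delta>)}.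
          \<Sum>i. ennreal (pi / 4 * (diameter (U i))\<^sup>2))"

definition surface_measure :: "(real^3) set \<Rightarrow> (real^3) measure" where
  "surface_measure \<Omega> = restrict_space (measure_of UNIV (sets borel) Hausdorff2) (frontier \<Omega>)"

text \<open>The trace on a Lipschitz boundary is the continuous extension of \<open>u \<mapsto> u|\<partial>\<Omega>\<close> from
  functions smooth up to the boundary, which are dense in \<open>H\<^sup>1(\<Omega>)\<close>.\<close>

definition has_trace ::
  "(real^3) set \<Rightarrow> (real^3 \<Rightarrow> 'b::euclidean_space) \<Rightarrow> (real^3 \<Rightarrow> 'b) \<Rightarrow> bool" where
  "has_trace \<Omega> u g \<longleftrightarrow> u \<in> H1 \<Omega> \<and> g \<in> L2 (surface_measure \<Omega>) \<and>
     (\<exists>v. (\<forall>n::nat. smooth (v n)) \<and>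
        (\<lambda>n. H1_norm \<Omega> (v n - u)) \<longlonglongrightarrow> 0 \<and>
        (\<lambda>n. L2_norm (surface_measure \<Omega>) (v n - g)) \<longlonglongrightarrow> 0)"

definition trace_on :: "(real^3) set \<Rightarrow> (real^3 \<Rightarrow> 'b::euclidean_space) \<Rightarrow> real^3 \<Rightarrow> 'b" where
  "trace_on \<Omega> u = (SOME g. has_trace \<Omega> u g)"

text \<open>The Sobolev--Slobodeckij space \<open>H\<^sup>1\<^sup>/\<^sup>2(\<partial>\<Omega>)\<close>; the exponent 3 is the boundary dimension 2
  plus \<open>2 \<cdot> 1/2\<close>.\<close>

definition H_half_boundary :: "(real^3) set \<Rightarrow> (real^3 \<Rightarrow> 'b::euclidean_space) set" where
  "H_half_boundary \<Omega> = {g \<in> L2 (surface_measure \<Omega>).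
     (\<integral>\<^sup>+x. \<integral>\<^sup>+y. ennreal ((norm (g x - g y))\<^sup>2 / norm (x - y) ^ 3)
        \<partial>surface_measure \<Omega> \<partial>surface_measure \<Omega>) < \<infinity>}"

section \<open>The elastic wave equation\<close>

definition weak_grad :: "(real^3) set \<Rightarrow> (real^3 \<Rightarrow> real^3) \<Rightarrow> real^3 \<Rightarrow> real^3^3" where
  "weak_grad \<Omega> u x = (\<chi> i j. weak_deriv \<Omega> (axis j 1) u x $ i)"

definition strain :: "(real^3) set \<Rightarrow> (real^3 \<Rightarrow> real^3) \<Rightarrow> real^3 \<Rightarrow> real^3^3" where
  "strain \<Omega> u x = (1/2) *\<^sub>R (weak_grad \<Omega> u x + transpose (weak_grad \<Omega> u x))"

definition ddot :: "real^3^3^3^3 \<Rightarrow> real^3^3 \<Rightarrow> real^3^3" where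
  "ddot C X = (\<chi> i j. \<Sum>k\<in>UNIV. \<Sum>l\<in>UNIV. C $ i $ j $ k $ l * X $ k $ l)"

text \<open>
  Integration by parts of \<open>- \<nabla>\<cdot>(C:\<epsilon>(u))\<close> against \<open>v\<close> under the traction-free boundary condition
  yields this integrand. For \<open>C\<close> with the usual symmetries \<open>\<nabla>v\<close> can be replaced by \<open>\<epsilon>(v)\<close>;
  the inner product on \<open>real^3^3\<close> is the Frobenius one.
\<close>

definition elastic_density ::
  "(real^3) set \<Rightarrow> (real^3 \<Rightarrow> real^3^3^3^3) \<Rightarrow> (real^3 \<Rightarrow> real^3) \<Rightarrow> (real^3 \<Rightarrow> real^3) \<Rightarrow>
   real^3 \<Rightarrow> real" where
  "elastic_density \<Omega> C u v x = ddot (C x) (strain \<Omega> u x) \<bullet> weak_grad \<Omega> v x"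

definition elastic_form ::
  "(real^3) set \<Rightarrow> (real^3 \<Rightarrow> real^3^3^3^3) \<Rightarrow> (real^3 \<Rightarrow> real^3) \<Rightarrow> (real^3 \<Rightarrow> real^3) \<Rightarrow> real" where
  "elastic_form \<Omega> C u v = (\<integral>x. elastic_density \<Omega> C u v x \<partial>lebesgue_on \<Omega>)"

text \<open>
  Weak form of \<open>\<rho> \<partial>\<^sub>t\<^sup>2 u - \<nabla>\<cdot>(C:\<epsilon>(u)) = f\<close> with the natural boundary condition. The time test
  functions \<open>\<phi> \<in> C\<^sub>c\<^sup>\<infinity>([0,T))\<close> need not vanish at 0, which encodes \<open>\<partial>\<^sub>t u(0) = u\<^sub>1\<close>. The
  integrability conditions are automatic if \<open>C\<close> is bounded, but \<open>C \<in> H\<^sup>1(\<Omega>)\<close> does not imply this;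
  without them the convention that a nonexistent integral is 0 would intervene.
\<close>

definition weak_solution ::
  "real \<Rightarrow> (real^3) set \<Rightarrow> (real^3 \<Rightarrow> real^3^3^3^3) \<Rightarrow> (real^3 \<Rightarrow> real) \<Rightarrow>
   (real^3 \<Rightarrow> real^3) \<Rightarrow> (real^3 \<Rightarrow> real^3) \<Rightarrow> (real \<Rightarrow> real^3 \<Rightarrow> real^3) \<Rightarrow>
   (real \<Rightarrow> real^3 \<Rightarrow> real^3) \<Rightarrow> bool" where
  "weak_solution T \<Omega> C \<rho> u0 u1 f u \<longleftrightarrow>
     u \<in> Bochner_L2 T (H1 \<Omega>) (H1_norm \<Omega>) \<and>
     has_initial_value T \<Omega> u u0 \<and>
     (\<exists>u'\<in>Bochner_L2 T (L2 (lebesgue_on \<Omega>)) (L2_norm (lebesgue_on \<Omega>)).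
        has_time_deriv T \<Omega> u u' \<and>
        (\<forall>v\<in>H1 \<Omega>.
           (AE t in lebesgue_on {0<..<T}. integrable (lebesgue_on \<Omega>) (elastic_density \<Omega> C (u t) v)) \<and>
           integrable (lebesgue_on {0<..<T}) (\<lambda>t. elastic_form \<Omega> C (u t) v) \<and>
           (\<forall>\<phi>\<in>test_functions {..<T}.
              - (\<integral>t. deriv \<phi> t * L2_inner (lebesgue_on \<Omega>) (\<lambda>x. \<rho> x *\<^sub>R u' t x) v
                    \<partial>lebesgue_on {0<..<T})
              + (\<integral>t. \<phi> t * elastic_form \<Omega> C (u t) v \<partial>lebesgue_on {0<..<T})
              = (\<integral>t. \<phi> t * L2_inner (lebesgue_on \<Omega>) (f t) v \<partial>lebesgue_on {0<..<T})
              + \<phi> 0 * L2_inner (lebesgue_on \<Omega>) (\<lambda>x. \<rho> x *\<^sub>R u1 x) v)))"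

definition solution_operator ::
  "real \<Rightarrow> (real^3) set \<Rightarrow> (real^3 \<Rightarrow> real^3^3^3^3) \<Rightarrow> (real^3 \<Rightarrow> real) \<Rightarrow>
   (real^3 \<Rightarrow> real^3) \<Rightarrow> (real^3 \<Rightarrow> real^3) \<Rightarrow> (real \<Rightarrow> real^3 \<Rightarrow> real^3) \<Rightarrow>
   real \<Rightarrow> real^3 \<Rightarrow> real^3" where
  "solution_operator T \<Omega> C \<rho> u0 u1 f = (SOME u. weak_solution T \<Omega> C \<rho> u0 u1 f u)"

text \<open>
  Traces lie in \<open>L\<^sup>2(\<partial>\<Omega>)\<close>, so the \<open>H\<^sup>-\<^sup>1\<^sup>/\<^sup>2\<close>--\<open>H\<^sup>1\<^sup>/\<^sup>2\<close> pairing with a sensor function is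
  the boundary integral.
\<close>

definition load_monitoring ::
  "real \<Rightarrow> (real^3) set \<Rightarrow> (real^3 \<Rightarrow> real^3^3^3^3) \<Rightarrow> (real^3 \<Rightarrow> real) \<Rightarrow>
   (real^3 \<Rightarrow> real^3) \<Rightarrow> (real^3 \<Rightarrow> real^3) \<Rightarrow> ('J::finite \<Rightarrow> real^3 \<Rightarrow> real^3) \<Rightarrow>
   (real \<Rightarrow> real^3 \<Rightarrow> real^3) \<Rightarrow> real \<Rightarrow> real^'J" where
  "load_monitoring T \<Omega> C \<rho> u0 u1 sensor f t =
     (\<chi> j. \<integral>x. trace_on \<Omega> (solution_operator T \<Omega> C \<rho> u0 u1 f t) x \<bullet> sensor j x
           \<partial>surface_measure \<Omega>)"

section \<open>Ill-posedness\<close>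

text \<open>
  \<open>X\<close> and \<open>Y\<close> are spaces of representatives with seminorms \<open>NX\<close> and \<open>NY\<close>, and \<open>D \<subseteq> X\<close> is the
  domain of \<open>F\<close>. Requiring the differences of images to lie in \<open>Y\<close> prevents \<open>NY\<close> from being
  evaluated outside the space on which it is meaningful.
\<close>

definition uniformly_ill_posed_at ::
  "('a::minus) set \<Rightarrow> ('a \<Rightarrow> real) \<Rightarrow> ('b::minus) set \<Rightarrow> ('b \<Rightarrow> real) \<Rightarrow> 'a set \<Rightarrow> ('a \<Rightarrow> 'b) \<Rightarrow>
   'a \<Rightarrow> bool" where
  "uniformly_ill_posed_at X NX Y NY D F \<theta> \<longleftrightarrow>
     (\<forall>r>0. \<exists>\<theta>s::nat \<Rightarrow> 'a.
        (\<forall>k. \<theta>s k \<in> X \<inter> D \<and> NX (\<theta>s k - \<theta>) < r) \<and>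
        \<not> (\<lambda>k. NX (\<theta>s k - \<theta>)) \<longlonglongrightarrow> 0 \<and>
        (\<forall>k. F (\<theta>s k) - F \<theta> \<in> Y) \<and>
        (\<lambda>k. NY (F (\<theta>s k) - F \<theta>)) \<longlonglongrightarrow> 0)"

end

theory Submission
  imports Defs
begin

text \<open>
  The sensors see the displacement only on the boundary, so a load whose response stays in the
  interior of the domain is invisible to them: the forward operator is constant, up to null sets of
  times, along a line through every load \<open>f\<close>, and a constant sequence on this line witnesses the
  ill-posedness.

  Such a load comes from prescribing the motion instead of the force. With bump functions \<open>\<phi>\<close> on
  \<open>(0,T)\<close> and \<open>\<psi>\<close> on \<open>\<Omega>\<close> and a fixed vector \<open>e\<close>, the motion \<open>w(t,x) = \<phi>(t) \<psi>(x) e\<close> has zero initial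
  data and is driven by \<open>g = \<phi>'' \<rho> \<psi> e + \<phi> Q\<close> with \<open>Q = - \<nabla>\<cdot>(C:\<epsilon>(\<psi> e))\<close>. Since \<open>\<epsilon>(\<psi> e)\<close> is smooth
  with compact support and \<open>C\<close> has weak derivatives in \<open>L\<^sup>2\<close>, \<open>Q\<close> is in \<open>L\<^sup>2\<close>, so \<open>g\<close> is an admissible
  load (\<open>elastic_force_exists\<close>, \<open>weak_solution_separated\<close>). By superposition and uniqueness
  the solution for \<open>f + c g\<close> is the one for \<open>f\<close> plus \<open>c w\<close>, and it has the same traces
  (\<open>trace_on_add_interior\<close>), whereas \<open>c\<close> scales the distance of \<open>f + c g\<close> from \<open>f\<close> to any prescribed
  positive value. The load \<open>g\<close> does not vanish: otherwise the load \<open>f\<close> would have two solutions that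
  differ by \<open>w\<close>.

  The analytic core is the integration by parts \<open>\<integral> \<sigma> : \<nabla>v = - \<integral> (\<nabla>\<cdot>\<sigma>) \<bullet> v\<close> for \<open>\<sigma> = C:\<epsilon>(\<psi> e)\<close> and all
  \<open>v \<in> H\<^sup>1(\<Omega>)\<close>, where neither \<open>C\<close> nor \<open>v\<close> is smooth while weak derivatives are tested against smooth
  functions only (\<open>weak_deriv_integration_by_parts\<close>). It is obtained by mollifying in a weak sense: for a
  bump \<open>k\<close> around 0 and a cutoff \<open>\<eta>\<close>, the function \<open>y \<mapsto> k (x - y)\<close> is a test function for \<open>v\<close> and
  \<open>x \<mapsto> \<eta> x * k (x - y)\<close> is one for \<open>C\<close>, and Fubini's theorem combines the two identities into one
  between double integrals with kernel \<open>k (x - y)\<close>. Concentrating \<open>k\<close> at 0 removes the kernel, because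
  correlations of \<open>L\<^sup>2\<close> functions are continuous at 0 (\<open>inner_products_from_kernels\<close>). The same device yields
  the uniqueness of weak derivatives, hence the linearity of \<open>weak_deriv\<close> up to null sets and the
  triangle inequality for \<open>H1_norm\<close>.
\<close>

section \<open>Smooth functions, bumps and test functions\<close>

abbreviation partial :: "'a::euclidean_space \<Rightarrow> ('a \<Rightarrow> 'b::real_normed_vector) \<Rightarrow> 'a \<Rightarrow> 'b" where
  "partial i f x \<equiv> frechet_derivative f (at x) i"

lemma partial_eqI: "(f has_derivative f') (at x) \<Longrightarrow> partial i f x = f' i"
  by (metis frechet_derivative_at)

lemma Ck_SucI:
  assumes "\<And>x. (f has_derivative f' x) (at x)" and "\<And>i. i \<in> Basis \<Longrightarrow> Ck k (\<lambda>x. f' x i)"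
  shows "Ck (Suc k) f"
proof -
  have "partial i f = (\<lambda>x. f' x i)" for i
    using assms(1) by (auto intro!: ext partial_eqI)
  then show ?thesis
    using assms by (auto simp: differentiable_def)
qed

lemma Ck_has_derivative: "Ck (Suc k) f \<Longrightarrow> (f has_derivative (\<lambda>i. partial i f x)) (at x)"
  using frechet_derivative_works by auto

lemma Ck_partial: "Ck (Suc k) f \<Longrightarrow> i \<in> Basis \<Longrightarrow> Ck k (partial i f)"
  by simp

lemma Ck_lower: "Ck (Suc k) f \<Longrightarrow> Ck k f"
proof (induction k arbitrary: f)
  case 0
  then show ?case
    by (auto simp: continuous_on_eq_continuous_at intro!: differentiable_imp_continuous_within)
next
  case (Suc k)
  then show ?case by simp
qed

lemma Ck_const: "Ck k (\<lambda>x. c)"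
proof (induction k arbitrary: c)
  case (Suc k)
  show ?case by (rule Ck_SucI[where f'="\<lambda>_ _. 0"]) (use Suc in auto)
qed auto

lemma Ck_bounded_linear: "bounded_linear h \<Longrightarrow> Ck k h"
proof (cases k)
  case (Suc m)
  assume h: "bounded_linear h"
  show ?thesis unfolding Suc
    by (rule Ck_SucI[where f'="\<lambda>_. h"]) (use h Ck_const in \<open>auto intro: bounded_linear_imp_has_derivative\<close>)
qed (auto intro: linear_continuous_on)

lemma Ck_add: "Ck k f \<Longrightarrow> Ck k g \<Longrightarrow> Ck k (\<lambda>x. f x + g x)"
proof (induction k arbitrary: f g)
  case (Suc k)
  show ?case
    by (rule Ck_SucI[where f'="\<lambda>x i. partial i f x + partial i g x"])
      (use Suc Ck_has_derivative[OF Suc.prems(1)] Ck_has_derivative[OF Suc.prems(2)] in \<open>auto intro!: has_derivative_add\<close>)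
qed (auto intro: continuous_on_add)

lemma Ck_bilinear:
  assumes "bounded_bilinear pr"
  shows "Ck k f \<Longrightarrow> Ck k g \<Longrightarrow> Ck k (\<lambda>x. pr (f x) (g x))"
proof (induction k arbitrary: f g)
  case 0
  then show ?case using bounded_bilinear.continuous_on[OF assms] by auto
next
  case (Suc k)
  show ?case
  proof (rule Ck_SucI)
    show "((\<lambda>x. pr (f x) (g x)) has_derivative
       (\<lambda>i. pr (f x) (partial i g x) + pr (partial i f x) (g x))) (at x)" for x
      by (intro bounded_bilinear.FDERIV[OF assms] Ck_has_derivative[OF Suc.prems(1)] Ck_has_derivative[OF Suc.prems(2)])
    show "Ck k (\<lambda>x. pr (f x) (partial i g x) + pr (partial i f x) (g x))" if "i \<in> Basis" for i
      using Ck_partial[OF Suc.prems(1) that] Ck_partial[OF Suc.prems(2) that]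
        Ck_lower[OF Suc.prems(1)] Ck_lower[OF Suc.prems(2)]
      by (intro Ck_add Suc.IH)
  qed
qed

lemma Ck_affine: "Ck k f \<Longrightarrow> Ck k (\<lambda>y. f (a + s *\<^sub>R y))"
proof (induction k arbitrary: f)
  case 0
  then show ?case by (auto intro!: continuous_intros continuous_on_compose2[of UNIV f])
next
  case (Suc k)
  show ?case
  proof (rule Ck_SucI)
    show "((\<lambda>y. f (a + s *\<^sub>R y)) has_derivative (\<lambda>i. s *\<^sub>R partial i f (a + s *\<^sub>R x))) (at x)" for x
    proof -
      have "((\<lambda>y. a + s *\<^sub>R y) has_derivative (\<lambda>i. s *\<^sub>R i)) (at x)"
        by (auto intro!: derivative_eq_intros)
      from has_derivative_compose[OF this Ck_has_derivative[OF Suc.prems]]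
      have "((\<lambda>y. f (a + s *\<^sub>R y)) has_derivative (\<lambda>i. partial (s *\<^sub>R i) f (a + s *\<^sub>R x))) (at x)" .
      moreover have "partial (s *\<^sub>R i) f y = s *\<^sub>R partial i f y" for i y
        using has_derivative_linear[OF Ck_has_derivative[OF Suc.prems], of y] by (rule linear_scale)
      ultimately show ?thesis by simp
    qed
    show "Ck k (\<lambda>x. s *\<^sub>R partial i f (a + s *\<^sub>R x))" if "i \<in> Basis" for i
      by (intro Ck_bilinear[OF bounded_bilinear_scaleR] Ck_const Suc.IH Ck_partial[OF Suc.prems that])
  qed
qed

lemma smooth_const: "smooth (\<lambda>x. c)"
  by (simp add: smooth_def Ck_const)

lemma smooth_bounded_linear: "bounded_linear h \<Longrightarrow> smooth h"
  by (simp add: smooth_def Ck_bounded_linear)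

lemma smooth_add: "smooth f \<Longrightarrow> smooth g \<Longrightarrow> smooth (\<lambda>x. f x + g x)"
  by (simp add: smooth_def Ck_add)

lemma smooth_bilinear: "bounded_bilinear pr \<Longrightarrow> smooth f \<Longrightarrow> smooth g \<Longrightarrow> smooth (\<lambda>x. pr (f x) (g x))"
  by (simp add: smooth_def Ck_bilinear)

lemmas smooth_scaleR = smooth_bilinear[OF bounded_bilinear_scaleR]
lemmas smooth_mult = smooth_bilinear[OF bounded_bilinear_mult]
lemmas smooth_inner = smooth_bilinear[OF bounded_bilinear_inner]

lemma smooth_affine: "smooth f \<Longrightarrow> smooth (\<lambda>y. f (a + s *\<^sub>R y))"
  by (simp add: smooth_def Ck_affine)

lemma smooth_partial: "smooth f \<Longrightarrow> i \<in> Basis \<Longrightarrow> smooth (partial i f)"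
  unfolding smooth_def using Ck_partial by blast

lemma smooth_has_derivative: "smooth f \<Longrightarrow> (f has_derivative (\<lambda>i. partial i f x)) (at x)"
  unfolding smooth_def using Ck_has_derivative by blast

lemma smooth_continuous: "smooth f \<Longrightarrow> continuous_on A f"
  unfolding smooth_def by (metis Ck.simps(1) continuous_on_subset top_greatest)

lemma smooth_measurable: "smooth f \<Longrightarrow> f \<in> borel_measurable borel"
  by (intro borel_measurable_continuous_onI smooth_continuous)

lemma partial_mult:
  fixes f g :: "'a::euclidean_space \<Rightarrow> real"
  assumes "smooth f" "smooth g"
  shows "partial i (\<lambda>x. f x * g x) x = partial i f x * g x + f x * partial i g x"
  by (rule partial_eqI)
    (auto intro!: derivative_eq_intros smooth_has_derivative assms)

lemma partial_affine:
  assumes "smooth f"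
  shows "partial i (\<lambda>y. f (a + s *\<^sub>R y)) x = s *\<^sub>R partial i f (a + s *\<^sub>R x)"
proof (rule trans[OF partial_eqI])
  have "((\<lambda>y. a + s *\<^sub>R y) has_derivative (\<lambda>i. s *\<^sub>R i)) (at x)"
    by (auto intro!: derivative_eq_intros)
  from has_derivative_compose[OF this smooth_has_derivative[OF assms]]
  show "((\<lambda>y. f (a + s *\<^sub>R y)) has_derivative (\<lambda>i. partial (s *\<^sub>R i) f (a + s *\<^sub>R x))) (at x)" .
  show "partial (s *\<^sub>R i) f (a + s *\<^sub>R x) = s *\<^sub>R partial i f (a + s *\<^sub>R x)"
    using has_derivative_linear[OF smooth_has_derivative[OF assms]] by (rule linear_scale)
qed

lemma deriv_eq_partial:
  fixes f :: "real \<Rightarrow> real"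
  assumes "smooth f"
  shows "deriv f t = partial 1 f t"
proof -
  have "(f has_field_derivative partial 1 f t) (at t)"
  proof -
    have "partial x f t = partial 1 f t * x" for x
      using linear_scale[OF has_derivative_linear[OF smooth_has_derivative[OF assms, of t]], of x 1] by simp
    then have eq: "(\<lambda>x. partial x f t) = (*) (partial 1 f t)" by (rule ext)
    show ?thesis
      unfolding has_field_derivative_def eq[symmetric] by (rule smooth_has_derivative[OF assms])
  qed
  then show ?thesis by (rule DERIV_imp_deriv)
qed

text \<open>
  The function \<open>exp (-1/x)\<close>, extended by 0 to \<open>x \<le> 0\<close>, together with its multiples by powers of
  \<open>1/x\<close>: derivatives of members of the family are linear combinations of members, so that one induction
  over the order of differentiation covers the whole family.
\<close>

definition flat :: "nat \<Rightarrow> real \<Rightarrow> real" where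
  "flat m x = (if x > 0 then inverse x ^ m * exp (- inverse x) else 0)"

text \<open>
  At 0 the difference quotient of \<open>flat m\<close> is \<open>flat (m + 1)\<close>, which tends to 0 because
  \<open>exp\<close> beats powers.
\<close>

lemma flat_has_derivative: "(flat m has_real_derivative flat (m + 2) x - m * flat (m + 1) x) (at x)"
proof -
  have quot0: "((\<lambda>y. flat m y) \<longlongrightarrow> 0) (at 0)" for m
  proof -
    have "((\<lambda>y::real. inverse y ^ m * exp (- inverse y)) \<longlongrightarrow> 0) (at_right 0)"
    proof -
      have "((\<lambda>y::real. y ^ m / exp y) \<longlongrightarrow> 0) at_top" by (rule tendsto_power_div_exp_0)
      from filterlim_compose[OF this filterlim_inverse_at_top_right]
      show ?thesis by (simp add: exp_minus field_simps)
    qed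
    then have "((\<lambda>y. flat m y) \<longlongrightarrow> 0) (at_right 0)"
      by (rule Lim_transform_eventually) (auto simp: flat_def eventually_at_filter)
    moreover have "((\<lambda>y. flat m y) \<longlongrightarrow> 0) (at_left 0)"
      by (rule tendsto_eventually) (auto simp: flat_def eventually_at_filter)
    ultimately show ?thesis by (simp add: filterlim_at_split)
  qed
  consider "x > 0" | "x = 0" | "x < 0" by linarith
  then show ?thesis
  proof cases
    case 1
    have i: "(inverse has_real_derivative - (inverse x ^ 2)) (at x)"
      using DERIV_inverse[of x UNIV] 1 by (simp add: numeral_2_eq_2)
    have "((\<lambda>y. inverse y ^ m * exp (- inverse y)) has_real_derivative flat (m + 2) x - m * flat (m + 1) x) (at x)"
      by (rule DERIV_cong[OF DERIV_mult[OF DERIV_power[OF i, of m] DERIV_fun_exp[OF DERIV_minus[OF i]]]])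
        (use 1 in \<open>cases m; simp add: flat_def algebra_simps power2_eq_square\<close>)
    then show ?thesis
      by (rule has_field_derivative_transform_within_open[where S="{0<..}"])
        (use 1 in \<open>auto simp: flat_def\<close>)
  next
    case 2
    have "((\<lambda>h. flat (m + 1) h) \<longlongrightarrow> 0) (at 0)" by (rule quot0)
    moreover have "flat (m + 1) h = (flat m (0 + h) - flat m 0) / h" for h
      by (auto simp: flat_def field_simps)
    ultimately show ?thesis using 2 by (simp add: DERIV_def flat_def)
  next
    case 3
    have "((\<lambda>y::real. 0::real) has_real_derivative flat (m + 2) x - m * flat (m + 1) x) (at x)"
      using 3 by (simp add: flat_def)
    then show ?thesis
      by (rule has_field_derivative_transform_within_open[where S="{..<0}"])
        (use 3 in \<open>auto simp: flat_def\<close>)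
  qed
qed

lemma Ck_flat_comp:
  fixes f :: "'a::euclidean_space \<Rightarrow> real"
  assumes "smooth f"
  shows "Ck k (\<lambda>x. flat m (f x))"
proof (induction k arbitrary: m)
  case 0
  have "continuous_on UNIV (flat m)"
    by (meson DERIV_continuous_on flat_has_derivative has_field_derivative_at_within)
  then show ?case using smooth_continuous[OF assms] by (auto intro: continuous_on_compose2)
next
  case (Suc k)
  show ?case
  proof (rule Ck_SucI)
    show "((\<lambda>x. flat m (f x)) has_derivative
       (\<lambda>i. partial i f x * (flat (m + 2) (f x) + (- real m) * flat (m + 1) (f x)))) (at x)" for x
      using has_derivative_compose[OF smooth_has_derivative[OF assms] flat_has_derivative[unfolded has_field_derivative_def]]
      by (simp add: mult.commute)
    show "Ck k (\<lambda>x. partial i f x * (flat (m + 2) (f x) + (- real m) * flat (m + 1) (f x)))" if "i \<in> Basis" for i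
      using smooth_partial[OF assms that] unfolding smooth_def
      by (intro Ck_bilinear[OF bounded_bilinear_mult] Ck_add Ck_const Suc.IH) auto
  qed
qed

definition bump :: "'a::euclidean_space \<Rightarrow> real \<Rightarrow> 'a \<Rightarrow> real" where
  "bump c r x = flat 0 (r\<^sup>2 - (norm (x - c))\<^sup>2)"

lemma smooth_bump: "smooth (bump c r)"
proof -
  have s: "smooth (\<lambda>x. r\<^sup>2 + (-1) * ((x + (- c)) \<bullet> (x + (- c))))"
    by (intro smooth_add smooth_mult smooth_inner smooth_const smooth_bounded_linear bounded_linear_ident)
  show ?thesis unfolding smooth_def bump_def[abs_def] power2_norm_eq_inner
    using Ck_flat_comp[OF s] by auto
qed

lemma bump_nonneg: "bump c r x \<ge> 0"
  by (simp add: bump_def flat_def)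

lemma bump_pos_iff:
  assumes "r > 0"
  shows "bump c r x > 0 \<longleftrightarrow> x \<in> ball c r"
proof -
  have "bump c r x > 0 \<longleftrightarrow> \<not> r\<^sup>2 \<le> (norm (x - c))\<^sup>2"
    by (simp add: bump_def flat_def)
  also have "\<dots> \<longleftrightarrow> norm (x - c) < r"
    using assms power_mono_iff[of r "norm (x - c)" 2] by (simp add: not_le)
  finally show ?thesis by (simp add: dist_norm norm_minus_commute)
qed

lemma bump_eq_0_iff: "r > 0 \<Longrightarrow> bump c r x = 0 \<longleftrightarrow> x \<notin> ball c r"
  using bump_pos_iff[of r c x] bump_nonneg[of c r x] by linarith

text \<open>
  Any compact set outside which the function vanishes can serve in place of the closure in the
  definition.
\<close>

lemma test_functionsI:
  assumes "smooth \<phi>" "compact K" "K \<subseteq> A" "\<And>x. x \<notin> K \<Longrightarrow> \<phi> x = 0"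
  shows "\<phi> \<in> test_functions A"
proof -
  have "closure {x. \<phi> x \<noteq> 0} \<subseteq> K"
    using assms by (intro closure_minimal compact_imp_closed) auto
  then show ?thesis
    using assms(1,3) compact_Int_closed[OF assms(2) closed_closure, of "{x. \<phi> x \<noteq> 0}"]
    unfolding test_functions_def by (simp add: Int_absorb1 order_trans[of _ K])
qed

lemma test_functionsE:
  assumes "\<phi> \<in> test_functions A"
  obtains K where "smooth \<phi>" "compact K" "K \<subseteq> A" "\<And>x. x \<notin> K \<Longrightarrow> \<phi> x = 0"
  using assms closure_subset[of "{x. \<phi> x \<noteq> 0}"]
  by (intro that[of "closure {x. \<phi> x \<noteq> 0}"]) (auto simp: test_functions_def)

lemma test_functions_smooth: "\<phi> \<in> test_functions A \<Longrightarrow> smooth \<phi>"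
  by (simp add: test_functions_def)

lemma test_functions_outside: "\<phi> \<in> test_functions A \<Longrightarrow> x \<notin> A \<Longrightarrow> \<phi> x = 0"
  by (elim test_functionsE) blast

lemma test_functions_mult:
  assumes "\<phi> \<in> test_functions A" "smooth f"
  shows "(\<lambda>x. \<phi> x * f x) \<in> test_functions A"
  using assms(1) by (elim test_functionsE) (rule test_functionsI, auto intro: smooth_mult assms(2))

lemma test_functions_add:
  assumes "\<phi> \<in> test_functions A" "\<psi> \<in> test_functions A"
  shows "(\<lambda>x. \<phi> x + \<psi> x) \<in> test_functions A"
  using assms(1)
proof (elim test_functionsE)
  fix K assume K: "smooth \<phi>" "compact K" "K \<subseteq> A" "\<And>x. x \<notin> K \<Longrightarrow> \<phi> x = 0"
  from assms(2) show ?thesis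
  proof (elim test_functionsE)
    fix L assume L: "smooth \<psi>" "compact L" "L \<subseteq> A" "\<And>x. x \<notin> L \<Longrightarrow> \<psi> x = 0"
    show ?thesis by (rule test_functionsI[of _ "K \<union> L"]) (use K L in \<open>auto intro: smooth_add\<close>)
  qed
qed

lemma partial_eq_0:
  assumes "closed K" "\<And>x. x \<notin> K \<Longrightarrow> f x = 0" "x \<notin> K"
  shows "partial i f x = 0"
proof -
  have "(f has_derivative (\<lambda>_. 0)) (at x)"
    by (rule has_derivative_transform_within_open[where f="\<lambda>_. 0" and s="- K"]) (use assms in auto)
  then show ?thesis by (rule partial_eqI)
qed

lemma test_functions_partial:
  assumes "\<phi> \<in> test_functions A" "i \<in> Basis"
  shows "partial i \<phi> \<in> test_functions A"
  using assms(1) by (elim test_functionsE)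
    (rule test_functionsI, auto intro: smooth_partial assms(2) partial_eq_0 compact_imp_closed)

lemma test_functions_bounded:
  assumes "\<phi> \<in> test_functions A"
  obtains B where "B > 0" "\<And>x. \<bar>\<phi> x\<bar> \<le> B"
  using assms
proof (elim test_functionsE)
  fix K assume K: "smooth \<phi>" "compact K" "K \<subseteq> A" "\<And>x. x \<notin> K \<Longrightarrow> \<phi> x = 0"
  have "bounded (\<phi> ` K)" using K by (intro compact_imp_bounded compact_continuous_image smooth_continuous)
  then obtain B where "B > 0" "\<forall>x\<in>K. \<bar>\<phi> x\<bar> \<le> B" by (auto simp: bounded_pos)
  with K(4) have "\<bar>\<phi> x\<bar> \<le> B" for x by (cases "x \<in> K") auto
  with \<open>B > 0\<close> that show thesis by blast
qed

lemma bump_test_function: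
  assumes "r > 0" "cball c r \<subseteq> A"
  shows "bump c r \<in> test_functions A"
  by (rule test_functionsI[of _ "cball c r"]) (use assms bump_eq_0_iff[of r c] in \<open>auto simp: smooth_bump\<close>)

section \<open>Square-integrable functions\<close>

lemma L2_measurable: "f \<in> L2 M \<Longrightarrow> f \<in> borel_measurable M"
  and L2_integrable_power2: "f \<in> L2 M \<Longrightarrow> integrable M (\<lambda>x. (norm (f x))\<^sup>2)"
  by (auto simp: L2_def)

lemma L2_I_bound:
  assumes "f \<in> borel_measurable M" "integrable M g" "AE x in M. (norm (f x))\<^sup>2 \<le> g x"
  shows "f \<in> L2 M"
proof -
  have "integrable M (\<lambda>x. (norm (f x))\<^sup>2)"
    using assms(1,3) by (intro Bochner_Integration.integrable_bound[OF assms(2)]) auto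
  with assms(1) show ?thesis by (simp add: L2_def)
qed

lemma L2_zero: "(\<lambda>x. 0) \<in> L2 M"
  by (simp add: L2_def)

lemma L2_add:
  assumes "f \<in> L2 M" "g \<in> L2 M"
  shows "(\<lambda>x. f x + g x) \<in> L2 M"
proof (rule L2_I_bound)
  show "(\<lambda>x. f x + g x) \<in> borel_measurable M"
    using L2_measurable[OF assms(1)] L2_measurable[OF assms(2)] by measurable
  show "integrable M (\<lambda>x. 2 * (norm (f x))\<^sup>2 + 2 * (norm (g x))\<^sup>2)"
    using assms by (simp add: L2_def)
  have "(norm (f x + g x))\<^sup>2 \<le> 2 * (norm (f x))\<^sup>2 + 2 * (norm (g x))\<^sup>2" for x
  proof -
    have "(norm (f x + g x))\<^sup>2 \<le> (norm (f x) + norm (g x))\<^sup>2"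
      by (intro power_mono norm_triangle_ineq) simp
    also have "\<dots> \<le> 2 * (norm (f x))\<^sup>2 + 2 * (norm (g x))\<^sup>2"
      using sum_squares_bound[of "norm (f x)" "norm (g x)"] by (simp add: power2_sum)
    finally show ?thesis .
  qed
  then show "AE x in M. (norm (f x + g x))\<^sup>2 \<le> 2 * (norm (f x))\<^sup>2 + 2 * (norm (g x))\<^sup>2" by simp
qed

lemma L2_mult_bounded:
  fixes k :: "'a \<Rightarrow> real"
  assumes "f \<in> L2 M" "k \<in> borel_measurable M" "AE x in M. \<bar>k x\<bar> \<le> B"
  shows "(\<lambda>x. k x *\<^sub>R f x) \<in> L2 M"
proof (rule L2_I_bound)
  show "(\<lambda>x. k x *\<^sub>R f x) \<in> borel_measurable M"
    using L2_measurable[OF assms(1)] assms(2) by measurable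
  show "integrable M (\<lambda>x. B\<^sup>2 * (norm (f x))\<^sup>2)" using assms by (simp add: L2_def)
  show "AE x in M. (norm (k x *\<^sub>R f x))\<^sup>2 \<le> B\<^sup>2 * (norm (f x))\<^sup>2"
    using assms(3) by eventually_elim (auto simp: power_mult_distrib intro!: mult_right_mono power2_le_iff_abs_le[THEN iffD2])
qed

lemma L2_scaleR: "f \<in> L2 M \<Longrightarrow> (\<lambda>x. c *\<^sub>R f x) \<in> L2 M"
  by (rule L2_mult_bounded[where B="\<bar>c\<bar>"]) auto

lemma L2_diff: "f \<in> L2 M \<Longrightarrow> g \<in> L2 M \<Longrightarrow> (\<lambda>x. f x - g x) \<in> L2 M"
  using L2_add[of f M "\<lambda>x. (-1) *\<^sub>R g x"] L2_scaleR[of g M "-1"] by simp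

lemma L2_sum: "(\<And>i. i \<in> I \<Longrightarrow> f i \<in> L2 M) \<Longrightarrow> (\<lambda>x. \<Sum>i\<in>I. f i x) \<in> L2 M"
  by (induction I rule: infinite_finite_induct) (auto simp: L2_zero L2_add)

lemma L2_inner_const: "f \<in> L2 M \<Longrightarrow> (\<lambda>x. f x \<bullet> b) \<in> L2 M"
proof (rule L2_I_bound)
  assume f: "f \<in> L2 M"
  show "(\<lambda>x. f x \<bullet> b) \<in> borel_measurable M" using L2_measurable[OF f] by measurable
  show "integrable M (\<lambda>x. (norm b)\<^sup>2 * (norm (f x))\<^sup>2)" using f by (simp add: L2_def)
  have "(norm (f x \<bullet> b))\<^sup>2 \<le> (norm b)\<^sup>2 * (norm (f x))\<^sup>2" for x
    using power_mono[OF Cauchy_Schwarz_ineq2[of "f x" b], of 2] by (simp add: power_mult_distrib mult.commute)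
  then show "AE x in M. (norm (f x \<bullet> b))\<^sup>2 \<le> (norm b)\<^sup>2 * (norm (f x))\<^sup>2" by simp
qed

lemma L2_scaleR_const: "f \<in> L2 M \<Longrightarrow> (\<lambda>x. f x *\<^sub>R b) \<in> L2 M"
  by (rule L2_I_bound[where g="\<lambda>x. (norm (f x))\<^sup>2 * (norm b)\<^sup>2"]) (auto simp: L2_def power_mult_distrib)

lemma L2_inner_integrable:
  assumes "f \<in> L2 M" "g \<in> L2 M"
  shows "integrable M (\<lambda>x. f x \<bullet> g x)"
proof (rule Bochner_Integration.integrable_bound)
  show "integrable M (\<lambda>x. (norm (f x))\<^sup>2 + (norm (g x))\<^sup>2)" using assms by (simp add: L2_def)
  show "(\<lambda>x. f x \<bullet> g x) \<in> borel_measurable M"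
    using L2_measurable[OF assms(1)] L2_measurable[OF assms(2)] by measurable
  have "norm (f x \<bullet> g x) \<le> norm ((norm (f x))\<^sup>2 + (norm (g x))\<^sup>2)" for x
    using Cauchy_Schwarz_ineq2[of "f x" "g x"] sum_squares_bound[of "norm (f x)" "norm (g x)"]
      mult_nonneg_nonneg[of "norm (f x)" "norm (g x)"]
    by simp
  then show "AE x in M. norm (f x \<bullet> g x) \<le> norm ((norm (f x))\<^sup>2 + (norm (g x))\<^sup>2)" by simp
qed

lemma L2_mult_integrable:
  fixes f g :: "'a \<Rightarrow> real"
  assumes "f \<in> L2 M" "g \<in> L2 M"
  shows "integrable M (\<lambda>x. f x * g x)"
  using L2_inner_integrable[OF assms] by simp

lemma L2_norm_power2: "(L2_norm M f)\<^sup>2 = (\<integral>x. (norm (f x))\<^sup>2 \<partial>M)"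
  by (simp add: L2_norm_def)

lemma L2_norm_nonneg: "L2_norm M f \<ge> 0"
  by (simp add: L2_norm_def)

text \<open>
  The quadratic \<open>t \<mapsto> \<integral> \<bar>f - t g\<bar>\<^sup>2\<close> is nonnegative, and its nonnegativity at the minimum
  \<open>t = \<integral> f \<bullet> g / \<integral> \<bar>g\<bar>\<^sup>2\<close> is the assertion. If \<open>\<integral> \<bar>g\<bar>\<^sup>2 = 0\<close> it is affine, hence constant.
\<close>

lemma L2_Cauchy_Schwarz:
  assumes "f \<in> L2 M" "g \<in> L2 M"
  shows "\<bar>L2_inner M f g\<bar> \<le> L2_norm M f * L2_norm M g"
proof -
  let ?A = "(L2_norm M f)\<^sup>2" and ?B = "L2_inner M f g" and ?D = "(L2_norm M g)\<^sup>2"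
  have quad: "0 \<le> ?A - 2 * t * ?B + t\<^sup>2 * ?D" for t
  proof -
    have "?A - 2 * t * ?B + t\<^sup>2 * ?D
        = (\<integral>x. (norm (f x))\<^sup>2 - 2 * t * (f x \<bullet> g x) + t\<^sup>2 * (norm (g x))\<^sup>2 \<partial>M)"
      using assms L2_inner_integrable[OF assms] unfolding L2_norm_power2 L2_inner_def
      by (simp add: L2_integrable_power2)
    also have "\<dots> = (\<integral>x. (norm (f x - t *\<^sub>R g x))\<^sup>2 \<partial>M)"
      by (intro Bochner_Integration.integral_cong refl)
        (simp add: power2_norm_eq_inner inner_diff inner_commute algebra_simps power2_eq_square[of t])
    finally show ?thesis by simp
  qed
  have "?B\<^sup>2 \<le> ?A * ?D"
  proof (cases "?D = 0")
    case True
    have "?B = 0"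
    proof (rule ccontr)
      assume "?B \<noteq> 0"
      with quad[of "(?A + 1) / (2 * ?B)"] True show False by simp
    qed
    with True show ?thesis by simp
  next
    case False
    then have D: "?D > 0" by (metis zero_less_power2 power_zero_numeral)
    have "?A - 2 * (?B / ?D) * ?B + (?B / ?D)\<^sup>2 * ?D = ?A - ?B\<^sup>2 / ?D"
      using D by (simp add: field_simps power2_eq_square)
    with quad[of "?B / ?D"] have "?B\<^sup>2 / ?D \<le> ?A" by simp
    with D show ?thesis by (simp add: pos_divide_le_eq)
  qed
  then have "\<bar>?B\<bar>\<^sup>2 \<le> (L2_norm M f * L2_norm M g)\<^sup>2"
    by (simp add: power_mult_distrib)
  then show ?thesis
    by (rule power2_le_imp_le) (simp add: L2_norm_nonneg)
qed

lemma L2_norm_triangle: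
  assumes "f \<in> L2 M" "g \<in> L2 M"
  shows "L2_norm M (\<lambda>x. f x + g x) \<le> L2_norm M f + L2_norm M g"
proof -
  have "(L2_norm M (\<lambda>x. f x + g x))\<^sup>2
      = (\<integral>x. (norm (f x))\<^sup>2 + 2 * (f x \<bullet> g x) + (norm (g x))\<^sup>2 \<partial>M)"
    unfolding L2_norm_power2
    by (intro Bochner_Integration.integral_cong refl)
      (simp add: power2_norm_eq_inner inner_add inner_commute)
  also have "\<dots> = (L2_norm M f)\<^sup>2 + 2 * L2_inner M f g + (L2_norm M g)\<^sup>2"
    using assms L2_inner_integrable[OF assms] unfolding L2_norm_power2 L2_inner_def
    by (simp add: L2_integrable_power2)
  also have "\<dots> \<le> (L2_norm M f + L2_norm M g)\<^sup>2"
    using L2_Cauchy_Schwarz[OF assms] by (simp add: power2_sum)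
  finally show ?thesis
    by (rule power2_le_imp_le) (simp add: L2_norm_nonneg)
qed

lemma L2_norm_scaleR: "L2_norm M (\<lambda>x. c *\<^sub>R f x) = \<bar>c\<bar> * L2_norm M f"
  by (simp add: L2_norm_def power_mult_distrib real_sqrt_mult)

lemma L2_norm_eq_0_iff:
  assumes "f \<in> L2 M"
  shows "L2_norm M f = 0 \<longleftrightarrow> (AE x in M. f x = 0)"
  using integral_nonneg_eq_0_iff_AE[OF L2_integrable_power2[OF assms]]
  by (simp add: L2_norm_def)

lemma L2_norm_cong_AE:
  assumes "f \<in> borel_measurable M" "g \<in> borel_measurable M" "AE x in M. f x = g x"
  shows "L2_norm M f = L2_norm M g"
proof -
  have "(\<integral>x. (norm (f x))\<^sup>2 \<partial>M) = (\<integral>x. (norm (g x))\<^sup>2 \<partial>M)"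
    by (rule integral_cong_AE) (use assms in auto)
  then show ?thesis by (simp add: L2_norm_def)
qed

section \<open>Lebesgue measure on an open set\<close>

text \<open>
  Completeness of Lebesgue measure: representatives may be changed on null sets.
\<close>

lemma borel_measurable_lebesgue_on_AE:
  fixes f g :: "'a::euclidean_space \<Rightarrow> 'b::euclidean_space"
  assumes "S \<in> sets lebesgue" "f \<in> borel_measurable (lebesgue_on S)" "AE x in lebesgue_on S. f x = g x"
  shows "g \<in> borel_measurable (lebesgue_on S)"
proof -
  have "AE x in lebesgue. x \<in> S \<longrightarrow> f x = g x"
    using assms(1,3) by (simp add: AE_restrict_space_iff)
  then have "AE x in lebesgue. (if x \<in> S then f x else 0) = (if x \<in> S then g x else 0)"
    by eventually_elim auto
  from borel_measurable_AE[OF borel_measurable_if_I[OF assms(2,1)] this] show ?thesis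
    by (rule borel_measurable_if_D)
qed

lemma L2_cong_AE:
  fixes f g :: "'a::euclidean_space \<Rightarrow> 'b::euclidean_space"
  assumes "S \<in> sets lebesgue" "f \<in> L2 (lebesgue_on S)" "AE x in lebesgue_on S. f x = g x"
  shows "g \<in> L2 (lebesgue_on S)"
proof (rule L2_I_bound[OF _ L2_integrable_power2[OF assms(2)]])
  show "g \<in> borel_measurable (lebesgue_on S)"
    using borel_measurable_lebesgue_on_AE[OF assms(1) L2_measurable[OF assms(2)] assms(3)] .
  show "AE x in lebesgue_on S. (norm (g x))\<^sup>2 \<le> (norm (f x))\<^sup>2"
    using assms(3) by eventually_elim simp
qed

lemma borel_measurable_lebesgue_on_borel:
  "f \<in> borel_measurable borel \<Longrightarrow> f \<in> borel_measurable (lebesgue_on S)"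
  by (simp add: measurable_completion measurable_restrict_space1)

lemma integrable_lborel_bounded_support:
  fixes f :: "'a::euclidean_space \<Rightarrow> real"
  assumes "f \<in> borel_measurable borel" "bounded K" "\<And>x. x \<notin> K \<Longrightarrow> f x = 0" "\<And>x. \<bar>f x\<bar> \<le> B"
  shows "integrable lborel f"
proof -
  obtain r where K: "K \<subseteq> cball 0 r"
    using assms(2) by (auto simp: bounded_iff subset_iff)
  show ?thesis
  proof (rule Bochner_Integration.integrable_bound)
    show "integrable lborel (\<lambda>x. B * indicat_real (cball 0 r) x)"
      using emeasure_lborel_cball_finite[of 0 r] by (auto intro!: integrable_mult_right simp: less_top)
    show "AE x in lborel. norm (f x) \<le> norm (B * indicat_real (cball 0 r) x)"
    proof (intro AE_I2)
      fix x show "norm (f x) \<le> norm (B * indicat_real (cball 0 r) x)"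
        using assms(3)[of x] assms(4)[of x] K by (cases "x \<in> K") (auto simp: indicator_def)
    qed
  qed (use assms in auto)
qed

lemma test_functions_integrable:
  assumes "\<phi> \<in> test_functions A"
  shows "integrable lborel \<phi>"
proof -
  obtain B where B: "\<And>x. \<bar>\<phi> x\<bar> \<le> B" using test_functions_bounded[OF assms] by blast
  obtain K where "smooth \<phi>" "compact K" "\<And>x. x \<notin> K \<Longrightarrow> \<phi> x = 0"
    using test_functionsE[OF assms] by metis
  then show ?thesis
    by (intro integrable_lborel_bounded_support[OF _ _ _ B, where K=K] smooth_measurable compact_imp_bounded)
qed

lemma integral_lborel_translate:
  fixes f :: "'a::euclidean_space \<Rightarrow> 'b::{banach, second_countable_topology}"
  assumes "f \<in> borel_measurable borel"
  shows "(LBINT x. f (a + x)) = (LBINT x. f x)"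
  using integral_distr[of "(+) a" lborel borel f] assms by (simp add: lborel_distr_plus)

lemma integrable_lborel_translate:
  fixes f :: "'a::euclidean_space \<Rightarrow> 'b::{banach, second_countable_topology}"
  assumes "integrable lborel f"
  shows "integrable lborel (\<lambda>x. f (a + x))"
  using integrable_distr_eq[of "(+) a" lborel borel f] assms by (simp add: lborel_distr_plus)

lemma integral_lborel_reflect:
  fixes f :: "'a::euclidean_space \<Rightarrow> 'b::{banach, second_countable_topology}"
  assumes [measurable]: "f \<in> borel_measurable borel"
  shows "(LBINT x. f (a - x)) = (LBINT x. f x)"
proof -
  have l: "lborel = distr lborel borel (\<lambda>x. a + (-1) *\<^sub>R x)"
    using lborel_affine[of "-1" a] by (simp add: density_1)
  have "(LBINT x. f x) = (\<integral>x. f x \<partial>distr lborel borel (\<lambda>x. a + (-1) *\<^sub>R x))"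
    using l by simp
  also have "\<dots> = (LBINT x. f (a - x))"
    by (subst integral_distr) auto
  finally show ?thesis by simp
qed

lemma integrable_lborel_reflect:
  fixes f :: "'a::euclidean_space \<Rightarrow> 'b::{banach, second_countable_topology}"
  assumes "integrable lborel f"
  shows "integrable lborel (\<lambda>x. f (a - x))"
proof -
  have l: "lborel = distr lborel borel (\<lambda>x. a + (-1) *\<^sub>R x)"
    using lborel_affine[of "-1" a] by (simp add: density_1)
  have [measurable]: "f \<in> borel_measurable borel" using assms by simp
  have "integrable (distr lborel borel (\<lambda>x. a + (-1) *\<^sub>R x)) f"
    using assms l by simp
  then show ?thesis by (subst (asm) integrable_distr_eq) auto
qed

text \<open>
  Difference quotients have integral 0 because Lebesgue measure is translation invariant; they
  converge boundedly to the partial derivative and vanish outside a fixed ball.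
\<close>

lemma integral_partial_eq_0:
  fixes \<phi> :: "'a::euclidean_space \<Rightarrow> real"
  assumes "\<phi> \<in> test_functions A" "i \<in> Basis"
  shows "(LBINT x. partial i \<phi> x) = 0"
proof -
  have D: "partial i \<phi> \<in> test_functions A" using assms by (rule test_functions_partial)
  obtain B where B: "\<And>x. \<bar>partial i \<phi> x\<bar> \<le> B" using test_functions_bounded[OF D] by blast
  obtain K where K: "smooth \<phi>" "compact K" "\<And>x. x \<notin> K \<Longrightarrow> \<phi> x = 0"
    using test_functionsE[OF assms(1)] by metis
  obtain r where r: "K \<subseteq> cball 0 r"
    using compact_imp_bounded[OF K(2)] by (auto simp: bounded_iff subset_iff)
  define h where "h n = 1 / real (Suc n)" for n
  define q where "q n x = (\<phi> (h n *\<^sub>R i + x) - \<phi> x) / h n" for n x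
  have h: "0 < h n" "h n \<le> 1" for n by (auto simp: h_def divide_simps)
  have d: "((\<lambda>t. \<phi> (t *\<^sub>R i + x)) has_real_derivative partial i \<phi> (t *\<^sub>R i + x)) (at t)" for t x
  proof -
    have "((\<lambda>t. t *\<^sub>R i + x) has_derivative (\<lambda>s. s *\<^sub>R i)) (at t)"
      by (auto intro!: derivative_eq_intros)
    from has_derivative_compose[OF this smooth_has_derivative[OF K(1)]]
    have "((\<lambda>t. \<phi> (t *\<^sub>R i + x)) has_derivative (\<lambda>s. partial (s *\<^sub>R i) \<phi> (t *\<^sub>R i + x))) (at t)" .
    moreover have "partial (s *\<^sub>R i) \<phi> y = partial i \<phi> y * s" for s y
      using linear_scale[OF has_derivative_linear[OF smooth_has_derivative[OF K(1), of y]], of s i] by simp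
    ultimately show ?thesis by (simp add: has_field_derivative_def)
  qed
  have lim: "(\<lambda>n. q n x) \<longlonglongrightarrow> partial i \<phi> x" for x
  proof -
    have "((\<lambda>s. (\<phi> (s *\<^sub>R i + x) - \<phi> x) / s) \<longlongrightarrow> partial i \<phi> x) (at 0)"
      using d[of x 0] by (simp add: DERIV_def)
    moreover have "filterlim h (at 0) sequentially"
      using h(1) LIMSEQ_inverse_real_of_nat by (auto simp: filterlim_at h_def[abs_def] inverse_eq_divide eventually_sequentially)
    ultimately show ?thesis unfolding q_def by (rule filterlim_compose)
  qed
  have bound: "norm (q n x) \<le> B * indicat_real (cball 0 (r + 1)) x" for n x
  proof (cases "x \<in> cball 0 (r + 1)")
    case True
    \<comment> \<open>mean value theorem along the segment from \<open>x\<close> to \<open>h n *\<^sub>R i + x\<close>\<close>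
    have "\<exists>z::real. z > 0 \<and> z < h n \<and> \<phi> (h n *\<^sub>R i + x) - \<phi> (0 *\<^sub>R i + x) = (h n - 0) * partial i \<phi> (z *\<^sub>R i + x)"
      using h d by (intro MVT2) auto
    then obtain z where "\<phi> (h n *\<^sub>R i + x) - \<phi> x = h n * partial i \<phi> (z *\<^sub>R i + x)" by auto
    then have "q n x = partial i \<phi> (z *\<^sub>R i + x)" using h(1)[of n] by (simp add: q_def)
    then show ?thesis using B True by simp
  next
    case False
    have "x \<notin> K" using False r by auto
    moreover have "h n *\<^sub>R i + x \<notin> K"
    proof
      assume "h n *\<^sub>R i + x \<in> K"
      then have "norm (h n *\<^sub>R i + x) \<le> r" using r by auto
      moreover have "norm (h n *\<^sub>R i) \<le> 1" using h[of n] assms(2) by simp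
      ultimately have "norm x \<le> r + 1"
        using norm_triangle_ineq4[of "h n *\<^sub>R i + x" "h n *\<^sub>R i"] by simp
      with False show False by simp
    qed
    ultimately show ?thesis using K(3) False by (simp add: q_def)
  qed
  have [measurable]: "\<phi> \<in> borel_measurable borel" "partial i \<phi> \<in> borel_measurable borel"
    using K(1) D test_functions_smooth smooth_measurable by blast+
  have int: "integrable lborel \<phi>" by (rule test_functions_integrable[OF assms(1)])
  have "(LBINT x. q n x) = 0" for n
    unfolding q_def using int integrable_lborel_translate[OF int] integral_lborel_translate[of \<phi>] by simp
  moreover have "(\<lambda>n. \<integral>x. q n x \<partial>lborel) \<longlonglongrightarrow> (LBINT x. partial i \<phi> x)"
  proof (rule integral_dominated_convergence)
    show "integrable lborel (\<lambda>x. B * indicat_real (cball 0 (r + 1)) x)"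
      using emeasure_lborel_cball_finite[of 0 "r + 1"] by (auto intro!: integrable_mult_right simp: less_top)
  qed (use lim bound in \<open>auto simp: q_def\<close>)
  ultimately show ?thesis by (simp add: LIMSEQ_const_iff)
qed

lemma integral_by_parts:
  fixes \<phi> f :: "'a::euclidean_space \<Rightarrow> real"
  assumes "\<phi> \<in> test_functions A" "smooth f" "i \<in> Basis"
  shows "(LBINT x. partial i \<phi> x * f x) = - (LBINT x. \<phi> x * partial i f x)"
proof -
  have sm: "smooth \<phi>" using assms(1) by (rule test_functions_smooth)
  have "integrable lborel (\<lambda>x. partial i \<phi> x * f x)" "integrable lborel (\<lambda>x. \<phi> x * partial i f x)"
    by (rule test_functions_integrable[of _ A], rule test_functions_mult;
        use assms test_functions_partial smooth_partial in blast)+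
  moreover have "(LBINT x. partial i (\<lambda>x. \<phi> x * f x) x) = 0"
    by (rule integral_partial_eq_0[OF test_functions_mult[OF assms(1,2)] assms(3)])
  ultimately show ?thesis
    by (simp add: partial_mult[OF sm assms(2)])
qed

section \<open>Continuity of translations and concentrating kernels\<close>

text \<open>
  Continuity of translations in mean passes to limits in \<open>L\<^sup>1\<close>, since translations are isometries of
  \<open>L\<^sup>1\<close>.
\<close>

lemma translation_continuous_approx:
  fixes f :: "'a::euclidean_space \<Rightarrow> real"
  assumes f: "integrable lborel f"
    and approx: "\<And>e. e > 0 \<Longrightarrow> \<exists>g. integrable lborel g \<and> (LBINT x. \<bar>f x - g x\<bar>) \<le> e \<and>
      (\<lambda>n. \<integral>x. \<bar>g (z n + x) - g x\<bar> \<partial>lborel) \<longlonglongrightarrow> 0"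
  shows "(\<lambda>n. \<integral>x. \<bar>f (z n + x) - f x\<bar> \<partial>lborel) \<longlonglongrightarrow> 0"
proof (rule LIMSEQ_I)
  fix e :: real assume "e > 0"
  then obtain g where g: "integrable lborel g" "(LBINT x. \<bar>f x - g x\<bar>) \<le> e / 4"
    "(\<lambda>n. \<integral>x. \<bar>g (z n + x) - g x\<bar> \<partial>lborel) \<longlonglongrightarrow> 0"
    using approx[of "e / 4"] by auto
  obtain N where N: "\<And>n. n \<ge> N \<Longrightarrow> (LBINT x. \<bar>g (z n + x) - g x\<bar>) < e / 4"
    using LIMSEQ_D[OF g(3), of "e / 4"] \<open>e > 0\<close> by auto
  have ft: "integrable lborel (\<lambda>x. f (z n + x))" and gt: "integrable lborel (\<lambda>x. g (z n + x))" for n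
    using f g(1) by (auto intro: integrable_lborel_translate)
  have "(LBINT x. \<bar>f (z n + x) - f x\<bar>) < e" if "n \<ge> N" for n
  proof -
    have "(LBINT x. \<bar>f (z n + x) - f x\<bar>)
        \<le> (LBINT x. \<bar>f (z n + x) - g (z n + x)\<bar> + \<bar>g (z n + x) - g x\<bar> + \<bar>f x - g x\<bar>)"
      by (rule integral_mono) (use f g(1) ft gt in auto)
    also have "\<dots> = (LBINT x. \<bar>f (z n + x) - g (z n + x)\<bar>) + (LBINT x. \<bar>g (z n + x) - g x\<bar>)
        + (LBINT x. \<bar>f x - g x\<bar>)"
      using f g(1) ft gt by simp
    also have "(LBINT x. \<bar>f (z n + x) - g (z n + x)\<bar>) = (LBINT x. \<bar>f x - g x\<bar>)"
      using f g(1) by (intro integral_lborel_translate[of "\<lambda>x. \<bar>f x - g x\<bar>"]) auto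
    finally show ?thesis using N[OF that] g(2) \<open>e > 0\<close> by linarith
  qed
  then show "\<exists>N. \<forall>n\<ge>N. norm ((LBINT x. \<bar>f (z n + x) - f x\<bar>) - 0) < e"
    by (auto intro!: exI[of _ N])
qed

text \<open>
  For an open set the part of \<open>U\<close> that leaves \<open>U\<close> under a small translation shrinks to a null set by
  dominated convergence, and by invariance the part that enters has the same measure.
\<close>

lemma translation_continuous_open:
  fixes U :: "'a::euclidean_space set"
  assumes U: "open U" "emeasure lborel U < \<infinity>" and z: "z \<longlonglongrightarrow> 0"
  shows "(\<lambda>n. \<integral>x. \<bar>indicat_real U (z n + x) - indicat_real U x\<bar> \<partial>lborel) \<longlonglongrightarrow> 0"
proof -
  have [measurable]: "U \<in> sets borel" using U by auto
  have i: "integrable lborel (indicat_real U)" using U by simp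
  have it: "integrable lborel (\<lambda>x. indicat_real U (z n + x))" for n
    by (rule integrable_lborel_translate[OF i])
  have ip: "integrable lborel (\<lambda>x. indicat_real U x * indicat_real U (z n + x))" for n
    by (rule Bochner_Integration.integrable_bound[OF i]) (auto simp: indicator_def)
  have eq: "(LBINT x. \<bar>indicat_real U (z n + x) - indicat_real U x\<bar>)
      = 2 * (LBINT x. indicat_real U x) - 2 * (LBINT x. indicat_real U x * indicat_real U (z n + x))" for n
  proof -
    have "(LBINT x. \<bar>indicat_real U (z n + x) - indicat_real U x\<bar>)
      = (LBINT x. indicat_real U (z n + x) + indicat_real U x - 2 * (indicat_real U x * indicat_real U (z n + x)))"
      by (intro Bochner_Integration.integral_cong refl) (auto simp: indicator_def)
    also have "\<dots> = (LBINT x. indicat_real U (z n + x)) + (LBINT x. indicat_real U x)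
        - 2 * (LBINT x. indicat_real U x * indicat_real U (z n + x))"
      using i it ip by simp
    also have "(LBINT x. indicat_real U (z n + x)) = (LBINT x. indicat_real U x)"
      by (rule integral_lborel_translate) auto
    finally show ?thesis by simp
  qed
  have "(\<lambda>n. \<integral>x. indicat_real U x * indicat_real U (z n + x) \<partial>lborel) \<longlonglongrightarrow> (LBINT x. indicat_real U x)"
  proof (rule integral_dominated_convergence[OF _ _ i])
    show "AE x in lborel. (\<lambda>n. indicat_real U x * indicat_real U (z n + x)) \<longlonglongrightarrow> indicat_real U x"
    proof (intro AE_I2)
      fix x
      show "(\<lambda>n. indicat_real U x * indicat_real U (z n + x)) \<longlonglongrightarrow> indicat_real U x"
      proof (cases "x \<in> U")
        case True
        have "(\<lambda>n. z n + x) \<longlonglongrightarrow> 0 + x" by (intro tendsto_intros z)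
        then have "eventually (\<lambda>n. z n + x \<in> U) sequentially"
          using U(1) True by (auto intro: topological_tendstoD)
        then have "eventually (\<lambda>n. indicat_real U x * indicat_real U (z n + x) = indicat_real U x) sequentially"
          by eventually_elim (simp add: True)
        then show ?thesis by (rule tendsto_eventually)
      qed simp
    qed
  qed (auto simp: indicator_def)
  from tendsto_diff[OF tendsto_const tendsto_mult[OF tendsto_const this], of "2 * (LBINT x. indicat_real U x)" 2]
  show ?thesis unfolding eq by simp
qed

text \<open>
  Indicators are approximated by those of open sets using outer regularity; linear combinations and
  limits follow from the approximation lemma.
\<close>

lemma translation_continuous_L1:
  fixes f :: "'a::euclidean_space \<Rightarrow> real"
  assumes "integrable lborel f" and z: "z \<longlonglongrightarrow> 0"
  shows "(\<lambda>n. \<integral>x. \<bar>f (z n + x) - f x\<bar> \<partial>lborel) \<longlonglongrightarrow> 0"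
  using assms(1)
proof (induct rule: integrable_induct)
  case (base A c)
  then have [measurable]: "A \<in> sets borel" by simp
  have i: "integrable lborel (indicat_real A)" using base by simp
  have "(\<lambda>n. \<integral>x. \<bar>indicat_real A (z n + x) - indicat_real A x\<bar> \<partial>lborel) \<longlonglongrightarrow> 0"
  proof (rule translation_continuous_approx[OF i])
    fix e :: real assume "e > 0"
    then obtain U where U: "open U" "A \<subseteq> U" "emeasure lborel (U - A) < e"
      using outer_regular_lborel[of A e] by auto
    then have [measurable]: "U \<in> sets borel" by auto
    have "emeasure lborel U = emeasure lborel A + emeasure lborel (U - A)"
      using U(2) by (subst plus_emeasure) (auto simp: Un_absorb1)
    also have "\<dots> < \<infinity>" using base order.strict_trans[OF U(3) ennreal_less_top] by simp
    finally have fin: "emeasure lborel U < \<infinity>" .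
    have "(LBINT x. \<bar>indicat_real A x - indicat_real U x\<bar>) = (LBINT x. indicat_real (U - A) x)"
      using U(2) by (intro Bochner_Integration.integral_cong refl) (auto simp: indicator_def)
    also have "\<dots> = measure lborel (U - A)" by simp
    also have "\<dots> \<le> e" using U(3) \<open>e > 0\<close> unfolding measure_def
      by (metis enn2real_leI less_imp_le)
    finally show "\<exists>g. integrable lborel g \<and> (LBINT x. \<bar>indicat_real A x - g x\<bar>) \<le> e \<and>
      (\<lambda>n. \<integral>x. \<bar>g (z n + x) - g x\<bar> \<partial>lborel) \<longlonglongrightarrow> 0"
      using fin translation_continuous_open[OF U(1) fin z] by (intro exI[of _ "indicat_real U"]) auto
  qed
  moreover have "(LBINT x. \<bar>indicat_real A (z n + x) *\<^sub>R c - indicat_real A x *\<^sub>R c\<bar>)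
      = \<bar>c\<bar> * (LBINT x. \<bar>indicat_real A (z n + x) - indicat_real A x\<bar>)" for n
    by (subst integral_mult_right_zero[symmetric])
      (intro Bochner_Integration.integral_cong refl, simp flip: left_diff_distrib add: abs_mult)
  ultimately show ?case using tendsto_mult_right_zero by simp
next
  case (add f g)
  have ft: "integrable lborel (\<lambda>x. f (z n + x))" and gt: "integrable lborel (\<lambda>x. g (z n + x))" for n
    using add by (auto intro: integrable_lborel_translate)
  show ?case
  proof (rule tendsto_sandwich[OF _ _ tendsto_const])
    show "(\<lambda>n. (LBINT x. \<bar>f (z n + x) - f x\<bar>) + (LBINT x. \<bar>g (z n + x) - g x\<bar>)) \<longlonglongrightarrow> 0"
      using tendsto_add[OF add(2) add(4)] by simp
    have "(LBINT x. \<bar>f (z n + x) + g (z n + x) - (f x + g x)\<bar>)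
        \<le> (LBINT x. \<bar>f (z n + x) - f x\<bar> + \<bar>g (z n + x) - g x\<bar>)" for n
      by (rule integral_mono) (use add ft gt in auto)
    then show "eventually (\<lambda>n. (LBINT x. \<bar>f (z n + x) + g (z n + x) - (f x + g x)\<bar>)
        \<le> (LBINT x. \<bar>f (z n + x) - f x\<bar>) + (LBINT x. \<bar>g (z n + x) - g x\<bar>)) sequentially"
      using add ft gt by simp
  qed simp
next
  case (lim f s)
  show ?case
  proof (rule translation_continuous_approx[OF lim(5)])
    fix e :: real assume "e > 0"
    have "(\<lambda>i. \<integral>x. \<bar>f x - s i x\<bar> \<partial>lborel) \<longlonglongrightarrow> (\<integral>x. 0 \<partial>(lborel :: 'a measure))"
    proof (rule integral_dominated_convergence[where w="\<lambda>x. 3 * \<bar>f x\<bar>"])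
      show "AE x in lborel. (\<lambda>i. \<bar>f x - s i x\<bar>) \<longlonglongrightarrow> 0"
      proof (intro AE_I2)
        fix x show "(\<lambda>i. \<bar>f x - s i x\<bar>) \<longlonglongrightarrow> 0"
          using tendsto_rabs[OF tendsto_diff[OF tendsto_const lim(3)[of x]], of "f x"] by simp
      qed
      show "AE x in lborel. norm \<bar>f x - s i x\<bar> \<le> 3 * \<bar>f x\<bar>" for i
      proof (intro AE_I2)
        fix x show "norm \<bar>f x - s i x\<bar> \<le> 3 * \<bar>f x\<bar>"
          using lim(4)[of x i] by auto
      qed
    qed (use lim(1,5) in auto)
    from LIMSEQ_D[OF this \<open>e > 0\<close>] obtain i where "(LBINT x. \<bar>f x - s i x\<bar>) < e"
      by auto
    then show "\<exists>g. integrable lborel g \<and> (LBINT x. \<bar>f x - g x\<bar>) \<le> e \<and>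
      (\<lambda>n. \<integral>x. \<bar>g (z n + x) - g x\<bar> \<partial>lborel) \<longlonglongrightarrow> 0"
      using lim(1,2) by (intro exI[of _ "s i"]) auto
  qed
qed

text \<open>
  The bounded part of \<open>a\<close> pairs with the \<open>L\<^sup>1\<close>-continuity of translations of \<open>b\<close>; the remaining part of
  \<open>a\<close> is small in \<open>L\<^sup>2\<close> and is controlled by the Cauchy--Schwarz inequality.
\<close>

lemma correlation_tendsto:
  fixes a b :: "'a::euclidean_space \<Rightarrow> real"
  assumes a: "a \<in> L2 lborel" and b: "b \<in> L2 lborel" "integrable lborel b" and z: "z \<longlonglongrightarrow> 0"
  shows "(\<lambda>n. \<integral>x. a x * b (z n + x) \<partial>lborel) \<longlonglongrightarrow> (LBINT x. a x * b x)"
proof (rule LIMSEQ_I)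
  fix e :: real assume "e > 0"
  define A where "A m x = a x * indicat_real {x. \<bar>a x\<bar> \<le> real m} x" for m :: nat and x
  have [measurable]: "a \<in> borel_measurable borel" "b \<in> borel_measurable borel"
    using L2_measurable[OF a] L2_measurable[OF b(1)] by auto
  have A2: "A m \<in> L2 lborel" for m
    by (rule L2_I_bound[OF _ L2_integrable_power2[OF a]]) (auto simp: A_def[abs_def] indicator_def)
  have bt2: "(\<lambda>x. b (z n + x)) \<in> L2 lborel" for n
    using integrable_lborel_translate[OF L2_integrable_power2[OF b(1)]] by (simp add: L2_def)
  have d2: "(\<lambda>x. b (z n + x) - b x) \<in> L2 lborel" for n
    by (rule L2_diff[OF bt2 b(1)])
  have db: "L2_norm lborel (\<lambda>x. b (z n + x) - b x) \<le> 2 * L2_norm lborel b" for n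
  proof -
    have "L2_norm lborel (\<lambda>x. b (z n + x)) = L2_norm lborel b"
      using integral_lborel_translate[of "\<lambda>x. (norm (b x))\<^sup>2" "z n"] by (simp add: L2_norm_def)
    moreover have "L2_norm lborel (\<lambda>x. (-1) *\<^sub>R b x) = L2_norm lborel b"
      by (subst L2_norm_scaleR) simp
    ultimately show ?thesis
      using L2_norm_triangle[OF bt2[of n] L2_scaleR[OF b(1), of "-1"]] by simp
  qed
  have "(\<lambda>m. \<integral>x. (norm (a x - A m x))\<^sup>2 \<partial>lborel) \<longlonglongrightarrow> (\<integral>x. 0 \<partial>(lborel :: 'a measure))"
  proof (rule integral_dominated_convergence[where w="\<lambda>x. (norm (a x))\<^sup>2"])
    show "integrable lborel (\<lambda>x. (norm (a x))\<^sup>2)" by (rule L2_integrable_power2[OF a])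
    show "AE x in lborel. (\<lambda>m. (norm (a x - A m x))\<^sup>2) \<longlonglongrightarrow> 0"
    proof (intro AE_I2 tendsto_eventually)
      fix x
      have "eventually (\<lambda>m. real m \<ge> \<bar>a x\<bar>) sequentially"
        using filterlim_real_sequentially by (simp add: filterlim_at_top)
      then show "eventually (\<lambda>m. (norm (a x - A m x))\<^sup>2 = 0) sequentially"
        by eventually_elim (simp add: A_def)
    qed
  qed (auto simp: A_def[abs_def] indicator_def)
  then have "(\<lambda>m. L2_norm lborel (\<lambda>x. a x - A m x)) \<longlonglongrightarrow> 0"
    unfolding L2_norm_def using tendsto_real_sqrt by fastforce
  then have "(\<lambda>m. L2_norm lborel (\<lambda>x. a x - A m x) * (2 * L2_norm lborel b)) \<longlonglongrightarrow> 0"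
    by (rule tendsto_mult_left_zero)
  from LIMSEQ_D[OF this, of "e / 2"] \<open>e > 0\<close>
  obtain m where "norm (L2_norm lborel (\<lambda>x. a x - A m x) * (2 * L2_norm lborel b) - 0) < e / 2" by auto
  then have m: "L2_norm lborel (\<lambda>x. a x - A m x) * (2 * L2_norm lborel b) < e / 2"
    unfolding real_norm_def diff_0_right by linarith
  have "(\<lambda>n. real m * (LBINT x. \<bar>b (z n + x) - b x\<bar>)) \<longlonglongrightarrow> 0"
    by (rule tendsto_mult_right_zero[OF translation_continuous_L1[OF b(2) z]])
  from LIMSEQ_D[OF this, of "e / 2"] \<open>e > 0\<close>
  obtain N where N: "\<And>n. n \<ge> N \<Longrightarrow> real m * (LBINT x. \<bar>b (z n + x) - b x\<bar>) < e / 2"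
    by (auto simp: abs_less_iff)
  have "\<bar>(LBINT x. a x * b (z n + x)) - (LBINT x. a x * b x)\<bar> < e" if "n \<ge> N" for n
  proof -
    have bt: "integrable lborel (\<lambda>x. b (z n + x))" by (rule integrable_lborel_translate[OF b(2)])
    have "(LBINT x. a x * b (z n + x)) - (LBINT x. a x * b x)
        = (LBINT x. a x * (b (z n + x) - b x))"
      using L2_mult_integrable[OF a b(1)] L2_mult_integrable[OF a bt2]
      by (simp add: right_diff_distrib)
    also have "\<dots> = (LBINT x. A m x * (b (z n + x) - b x) + (a x - A m x) * (b (z n + x) - b x))"
      by (simp add: algebra_simps)
    also have "\<dots> = (LBINT x. A m x * (b (z n + x) - b x)) + (LBINT x. (a x - A m x) * (b (z n + x) - b x))"
      by (intro Bochner_Integration.integral_add L2_mult_integrable A2 d2 L2_diff a)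
    finally have eq: "(LBINT x. a x * b (z n + x)) - (LBINT x. a x * b x)
        = (LBINT x. A m x * (b (z n + x) - b x)) + (LBINT x. (a x - A m x) * (b (z n + x) - b x))" .
    have "\<bar>\<integral>x. A m x * (b (z n + x) - b x) \<partial>lborel\<bar> \<le> (LBINT x. real m * \<bar>b (z n + x) - b x\<bar>)"
      by (rule order_trans[OF Bochner_Integration.integral_abs_bound], rule Bochner_Integration.integral_mono)
        (use integrable_abs[OF L2_mult_integrable[OF A2 d2]] bt b(2) in
          \<open>auto simp: abs_mult A_def indicator_def intro!: mult_right_mono\<close>)
    then have 1: "\<bar>\<integral>x. A m x * (b (z n + x) - b x) \<partial>lborel\<bar> < e / 2"
      using N[OF that] by simp
    have "\<bar>\<integral>x. (a x - A m x) * (b (z n + x) - b x) \<partial>lborel\<bar>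
        \<le> L2_norm lborel (\<lambda>x. a x - A m x) * L2_norm lborel (\<lambda>x. b (z n + x) - b x)"
      using L2_Cauchy_Schwarz[OF L2_diff[OF a A2] d2] by (simp add: L2_inner_def)
    also have "\<dots> \<le> L2_norm lborel (\<lambda>x. a x - A m x) * (2 * L2_norm lborel b)"
      by (intro mult_left_mono db L2_norm_nonneg)
    finally show ?thesis using 1 m eq by linarith
  qed
  then show "\<exists>N. \<forall>n\<ge>N. norm ((LBINT x. a x * b (z n + x)) - (LBINT x. a x * b x)) < e"
    by auto
qed

definition correlation :: "('a::euclidean_space \<Rightarrow> real) \<Rightarrow> ('a \<Rightarrow> real) \<Rightarrow> 'a \<Rightarrow> real" where
  "correlation a b z = (LBINT x. a x * b (x - z))"

lemma isCont_correlation: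
  assumes "a \<in> L2 lborel" "b \<in> L2 lborel" "integrable lborel b"
  shows "isCont (correlation a b) 0"
  unfolding isCont_def tendsto_at_iff_sequentially
proof (intro allI impI)
  fix z :: "nat \<Rightarrow> 'a" assume "z \<longlonglongrightarrow> 0"
  then have "(\<lambda>n. - z n) \<longlonglongrightarrow> 0" using tendsto_minus by fastforce
  from correlation_tendsto[OF assms this]
  show "(correlation a b \<circ> z) \<longlonglongrightarrow> correlation a b 0"
    by (simp add: correlation_def o_def)
qed

lemma kernel_integrable:
  fixes a b k :: "'a::euclidean_space \<Rightarrow> real"
  assumes "integrable lborel a" "integrable lborel b" "k \<in> borel_measurable borel" "\<And>x. \<bar>k x\<bar> \<le> B"
  shows "integrable (lborel \<Otimes>\<^sub>M lborel) (\<lambda>(x, y). a x * k (x - y) * b y)"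
proof (rule lborel_pair.Fubini_integrable)
  have [measurable]: "a \<in> borel_measurable borel" "b \<in> borel_measurable borel" "k \<in> borel_measurable borel"
    using assms by auto
  show "(\<lambda>(x, y). a x * k (x - y) * b y) \<in> borel_measurable (lborel \<Otimes>\<^sub>M lborel)" by measurable
  have i: "integrable lborel (\<lambda>y. k (x - y) * b y)" for x
  proof (rule Bochner_Integration.integrable_bound)
    show "integrable lborel (\<lambda>y. B * b y)" using assms(2) by simp
    show "AE y in lborel. norm (k (x - y) * b y) \<le> norm (B * b y)"
      using order_trans[OF assms(4) abs_ge_self] by (auto simp: abs_mult intro!: mult_right_mono)
  qed auto
  then show "AE x in lborel. integrable lborel (\<lambda>y. case (x, y) of (x, y) \<Rightarrow> a x * k (x - y) * b y)"
    by (simp add: mult.assoc)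
  show "integrable lborel (\<lambda>x. \<integral>y. norm (case (x, y) of (x, y) \<Rightarrow> a x * k (x - y) * b y) \<partial>lborel)"
  proof (rule Bochner_Integration.integrable_bound)
    show "integrable lborel (\<lambda>x. \<bar>a x\<bar> * (B * (LBINT y. \<bar>b y\<bar>)))" using assms by simp
    show "(\<lambda>x. \<integral>y. norm (case (x, y) of (x, y) \<Rightarrow> a x * k (x - y) * b y) \<partial>lborel) \<in> borel_measurable lborel"
      by measurable
    have "(LBINT y. \<bar>k (x - y) * b y\<bar>) \<le> (LBINT y. B * \<bar>b y\<bar>)" for x
      by (rule integral_mono) (use integrable_abs[OF i[of x]] assms(2,4) in \<open>auto simp: abs_mult intro!: mult_right_mono\<close>)
    then have *: "(LBINT y. \<bar>k (x - y) * b y\<bar>) \<le> B * (LBINT y. \<bar>b y\<bar>)" for x by simp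
    have "norm (LBINT y. norm (case (x, y) of (x, y) \<Rightarrow> a x * k (x - y) * b y))
        \<le> norm (\<bar>a x\<bar> * (B * (LBINT y. \<bar>b y\<bar>)))" for x
    proof -
      have "(LBINT y. norm (case (x, y) of (x, y) \<Rightarrow> a x * k (x - y) * b y))
          = \<bar>a x\<bar> * (LBINT y. \<bar>k (x - y) * b y\<bar>)"
        by (simp add: abs_mult mult.assoc)
      moreover have "0 \<le> (LBINT y. \<bar>k (x - y) * b y\<bar>)" by simp
      moreover have "0 \<le> B" using order_trans[OF abs_ge_zero assms(4)] .
      ultimately show ?thesis
        using mult_left_mono[OF *[of x], of "\<bar>a x\<bar>"] by (auto simp: abs_mult)
    qed
    then show "AE x in lborel. norm (LBINT y. norm (case (x, y) of (x, y) \<Rightarrow> a x * k (x - y) * b y))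
        \<le> norm (\<bar>a x\<bar> * (B * (LBINT y. \<bar>b y\<bar>)))" by simp
  qed
qed

text \<open>
  This is \<open>\<integral> a (k * b)\<close> with the convolution \<open>k * b\<close>, a mollification of \<open>b\<close> when \<open>k\<close> is a bump.
\<close>

definition kernel_form :: "('a::euclidean_space \<Rightarrow> real) \<Rightarrow> ('a \<Rightarrow> real) \<Rightarrow> ('a \<Rightarrow> real) \<Rightarrow> real" where
  "kernel_form a k b = (\<integral>x. \<integral>y. a x * k (x - y) * b y \<partial>lborel \<partial>lborel)"

lemma kernel_form_correlation:
  fixes a b k :: "'a::euclidean_space \<Rightarrow> real"
  assumes a: "integrable lborel a" and b: "integrable lborel b" and k: "k \<in> test_functions A"
  shows "integrable lborel (\<lambda>z. k z * correlation a b z)" (is ?int)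
    and "kernel_form a k b = (LBINT z. k z * correlation a b z)" (is ?eq)
proof -
  have [measurable]: "a \<in> borel_measurable borel" "b \<in> borel_measurable borel" "k \<in> borel_measurable borel"
    using a b smooth_measurable[OF test_functions_smooth[OF k]] by auto
  obtain B where B: "\<And>x. \<bar>k x\<bar> \<le> B" using test_functions_bounded[OF k] by blast
  have int: "integrable (lborel \<Otimes>\<^sub>M lborel) (\<lambda>(x, z). a x * k z * b (x - z))"
  proof (rule lborel_pair.Fubini_integrable)
    show "(\<lambda>(x, z). a x * k z * b (x - z)) \<in> borel_measurable (lborel \<Otimes>\<^sub>M lborel)" by measurable
    have K: "integrable (lborel \<Otimes>\<^sub>M lborel) (\<lambda>(x, y). a x * k (x - y) * b y)"
      by (rule kernel_integrable[OF a b _ B]) auto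
    have K': "integrable (lborel \<Otimes>\<^sub>M lborel) (\<lambda>(x, y). \<bar>a x * k (x - y) * b y\<bar>)"
      using integrable_abs[OF K] by (simp add: case_prod_beta')
    have r: "(LBINT z. \<bar>a x * k z * b (x - z)\<bar>) = (LBINT y. \<bar>a x * k (x - y) * b y\<bar>)" for x
      using integral_lborel_reflect[of "\<lambda>z. \<bar>a x * k z * b (x - z)\<bar>" x] by simp
    show "integrable lborel (\<lambda>x. \<integral>z. norm (case (x, z) of (x, z) \<Rightarrow> a x * k z * b (x - z)) \<partial>lborel)"
      using lborel_pair.integrable_fst[OF K'] r by simp
    have "integrable lborel (\<lambda>z. k z * b (x - z))" for x
    proof (rule Bochner_Integration.integrable_bound)
      show "integrable lborel (\<lambda>z. B * b (x - z))" using integrable_lborel_reflect[OF b] by simp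
      show "AE z in lborel. norm (k z * b (x - z)) \<le> norm (B * b (x - z))"
        using B order_trans[OF B abs_ge_self] by (auto simp: abs_mult intro!: mult_right_mono)
    qed auto
    then show "AE x in lborel. integrable lborel (\<lambda>z. case (x, z) of (x, z) \<Rightarrow> a x * k z * b (x - z))"
      by (simp add: mult.assoc)
  qed
  have inner: "(LBINT x. a x * k z * b (x - z)) = k z * correlation a b z" for z
    unfolding correlation_def
    by (subst integral_mult_right_zero[symmetric]) (intro Bochner_Integration.integral_cong refl, simp)
  show ?int using lborel_pair.integrable_snd[OF int] inner by simp
  have "kernel_form a k b = (\<integral>x. \<integral>z. a x * k z * b (x - z) \<partial>lborel \<partial>lborel)"
    unfolding kernel_form_def
  proof (rule Bochner_Integration.integral_cong[OF refl])
    fix x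
    show "(LBINT y. a x * k (x - y) * b y) = (LBINT z. a x * k z * b (x - z))"
      using integral_lborel_reflect[of "\<lambda>z. a x * k z * b (x - z)" x] by simp
  qed
  also have "\<dots> = (\<integral>z. \<integral>x. a x * k z * b (x - z) \<partial>lborel \<partial>lborel)"
    using lborel_pair.Fubini_integral[OF int] by simp
  finally show ?eq by (simp add: inner)
qed

text \<open>
  Both kernel forms average correlations against \<open>k\<close>, and the value of the correlation at 0 is the inner
  product. If the sum of the inner products were not 0, the sum of the correlations would
  by continuity stay close to this value near 0, and a bump \<open>k\<close> supported there would give a nonzero
  average. Allowing two pairs of functions matches the two sides of an integration by parts.
\<close>

proposition inner_products_from_kernels:
  fixes a b a' b' :: "'a::euclidean_space \<Rightarrow> real"
  assumes a: "a \<in> L2 lborel" "integrable lborel a" and b: "b \<in> L2 lborel" "integrable lborel b"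
    and a': "a' \<in> L2 lborel" "integrable lborel a'" and b': "b' \<in> L2 lborel" "integrable lborel b'"
    and \<delta>: "\<delta> > 0"
    and vanish: "\<And>k. k \<in> test_functions (ball 0 \<delta>) \<Longrightarrow> kernel_form a k b + kernel_form a' k b' = 0"
  shows "(LBINT x. a x * b x) + (LBINT x. a' x * b' x) = 0"
proof (rule ccontr)
  define \<Theta> where "\<Theta> z = correlation a b z + correlation a' b' z" for z
  assume "\<not> ?thesis"
  then have \<Theta>0: "\<Theta> 0 \<noteq> 0" by (simp add: \<Theta>_def correlation_def)
  have "isCont \<Theta> 0"
    unfolding \<Theta>_def using isCont_correlation a b a' b' by (intro continuous_intros) auto
  then have "\<exists>d>0. \<forall>z. dist z 0 < d \<longrightarrow> dist (\<Theta> z) (\<Theta> 0) < \<bar>\<Theta> 0\<bar> / 2"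
    using \<Theta>0 unfolding continuous_at_eps_delta by (meson half_gt_zero zero_less_abs_iff)
  then obtain d where d: "d > 0" "\<And>z. norm z < d \<Longrightarrow> \<bar>\<Theta> z - \<Theta> 0\<bar> < \<bar>\<Theta> 0\<bar> / 2"
    by (auto simp: dist_real_def)
  \<comment> \<open>half the radius, because the closed ball has to lie in the open one\<close>
  define r where "r = min d \<delta> / 2"
  have r: "r > 0" "r < d" "r < \<delta>" using d(1) \<delta> by (auto simp: r_def)
  have k: "bump 0 r \<in> test_functions (ball (0::'a) \<delta>)"
    using r by (intro bump_test_function) auto
  have ki: "integrable lborel (bump (0::'a) r)" by (rule test_functions_integrable[OF k])
  have i: "integrable lborel (\<lambda>z. bump 0 r z * \<Theta> z)"
    using kernel_form_correlation(1)[OF a(2) b(2) k] kernel_form_correlation(1)[OF a'(2) b'(2) k]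
    by (simp add: \<Theta>_def distrib_left)
  have "(LBINT z. bump 0 r z * \<Theta> z) = 0"
    using kernel_form_correlation[OF a(2) b(2) k] kernel_form_correlation[OF a'(2) b'(2) k] vanish[OF k]
    by (simp add: \<Theta>_def distrib_left)
  moreover have nn: "(LBINT z. bump (0::'a) r z) \<ge> 0" by (simp add: bump_nonneg)
  ultimately have "\<bar>\<Theta> 0\<bar> * (LBINT z. bump (0::'a) r z) = \<bar>\<integral>z. bump 0 r z * (\<Theta> 0 - \<Theta> z) \<partial>lborel\<bar>"
    using ki i nn by (simp add: right_diff_distrib abs_mult)
  also have "\<dots> \<le> (LBINT z. bump (0::'a) r z * (\<bar>\<Theta> 0\<bar> / 2))"
  proof (rule order_trans[OF Bochner_Integration.integral_abs_bound], rule Bochner_Integration.integral_mono)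
    fix z :: 'a
    show "\<bar>bump 0 r z * (\<Theta> 0 - \<Theta> z)\<bar> \<le> bump 0 r z * (\<bar>\<Theta> 0\<bar> / 2)"
    proof (cases "norm z < r")
      case True
      then have "\<bar>\<Theta> 0 - \<Theta> z\<bar> \<le> \<bar>\<Theta> 0\<bar> / 2"
        using d(2)[of z] r by (simp add: abs_minus_commute)
      from mult_left_mono[OF this bump_nonneg[of 0 r z]] show ?thesis
        by (simp add: abs_mult bump_nonneg)
    next
      case False
      then show ?thesis using bump_eq_0_iff[OF r(1), of 0 z] by simp
    qed
  qed (use ki i in \<open>auto simp: right_diff_distrib\<close>)
  also have "\<dots> = \<bar>\<Theta> 0\<bar> / 2 * (LBINT z. bump (0::'a) r z)" by simp
  finally have "(LBINT z. bump (0::'a) r z) \<le> 0"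
    using \<Theta>0 by (simp add: field_simps)
  with nn have "AE z in lborel. bump (0::'a) r z = 0"
    using integral_nonneg_eq_0_iff_AE[OF ki] bump_nonneg by fastforce
  then have "AE z in lborel. z \<notin> ball (0::'a) r"
    by eventually_elim (use bump_eq_0_iff[OF r(1)] in blast)
  then have "ball (0::'a) r \<in> null_sets lborel"
    by (subst AE_iff_null_sets) auto
  then have "emeasure lborel (ball (0::'a) r) = 0" by auto
  then show False
    using content_ball_pos[OF r(1), of "0::'a"] by (simp add: measure_def)
qed

section \<open>Weak derivatives\<close>

lemma integral_lebesgue_on_eq_lborel:
  fixes f g :: "'a::euclidean_space \<Rightarrow> real"
  assumes S: "S \<in> sets borel" and g: "g \<in> borel_measurable borel" "\<And>x. x \<notin> S \<Longrightarrow> g x = 0"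
    and eq: "AE x in lebesgue_on S. f x = g x"
  shows "(\<integral>x. f x \<partial>lebesgue_on S) = (LBINT x. g x)"
proof -
  have gm: "g \<in> borel_measurable (lebesgue_on S)"
    using g(1) by (rule borel_measurable_lebesgue_on_borel)
  have "f \<in> borel_measurable (lebesgue_on S)"
    using eq by (intro borel_measurable_lebesgue_on_AE[OF _ gm]) (use S in \<open>auto elim: eventually_mono\<close>)
  then have "(\<integral>x. f x \<partial>lebesgue_on S) = (\<integral>x. g x \<partial>lebesgue_on S)"
    using gm eq by (rule integral_cong_AE)
  also have "\<dots> = (\<integral>x. indicator S x *\<^sub>R g x \<partial>lebesgue)"
    using S by (intro integral_restrict_space) auto
  also have "\<dots> = (\<integral>x. g x \<partial>lebesgue)"
    using g(2) by (intro Bochner_Integration.integral_cong refl) (auto simp: indicator_def)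
  also have "\<dots> = (LBINT x. g x)"
    using g(1) by (intro integral_completion) simp
  finally show ?thesis .
qed

lemma integrable_lebesgue_on_iff_lborel:
  fixes g :: "'a::euclidean_space \<Rightarrow> real"
  assumes S: "S \<in> sets borel" and g: "g \<in> borel_measurable borel" "\<And>x. x \<notin> S \<Longrightarrow> g x = 0"
  shows "integrable (lebesgue_on S) g \<longleftrightarrow> integrable lborel g"
proof -
  have "integrable (lebesgue_on S) g \<longleftrightarrow> integrable lebesgue (\<lambda>x. indicator S x *\<^sub>R g x)"
    using S by (intro integrable_restrict_space) auto
  also have "(\<lambda>x. indicator S x *\<^sub>R g x) = g"
    using g(2) by (auto intro!: ext simp: indicator_def)
  also have "integrable lebesgue g \<longleftrightarrow> integrable lborel g"
    using g(1) by (intro integrable_completion) simp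
  finally show ?thesis .
qed

text \<open>
  Fubini's theorem is applied to Borel functions on the whole space, so elements of \<open>L\<^sup>2(S)\<close>
  are replaced by Borel representatives extended by 0. Boundedness of \<open>S\<close> makes them integrable.
\<close>

lemma L2_lebesgue_on_borel_representative:
  fixes u :: "'a::euclidean_space \<Rightarrow> real"
  assumes S: "S \<in> sets borel" "bounded S" and u: "u \<in> L2 (lebesgue_on S)"
  obtains u' where "u' \<in> L2 lborel" "integrable lborel u'" "\<And>x. x \<notin> S \<Longrightarrow> u' x = 0"
    "AE x in lebesgue_on S. u x = u' x" "u' \<in> borel_measurable borel"
proof -
  have Sl: "S \<in> sets lebesgue" using S by simp
  from borel_measurable_if_I[OF L2_measurable[OF u] Sl]
  obtain v where v: "v \<in> borel_measurable lborel" "AE x in lborel. (if x \<in> S then u x else 0) = v x"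
    using completion_ex_borel_measurable_real by blast
  define u' where "u' x = indicat_real S x * v x" for x
  have m: "u' \<in> borel_measurable borel" using v(1) S(1) unfolding u'_def by simp
  have z: "u' x = 0" if "x \<notin> S" for x using that by (simp add: u'_def)
  have "AE x in lebesgue. (if x \<in> S then u x else 0) = v x"
    using v(2) by (simp add: AE_completion_iff)
  then have "AE x in lebesgue. x \<in> S \<longrightarrow> u x = u' x"
    by eventually_elim (auto simp: u'_def)
  then have eq: "AE x in lebesgue_on S. u x = u' x"
    using Sl by (simp add: AE_restrict_space_iff)
  have "u' \<in> L2 (lebesgue_on S)" by (rule L2_cong_AE[OF Sl u eq])
  then have sq: "integrable lborel (\<lambda>x. (norm (u' x))\<^sup>2)"
    using integrable_lebesgue_on_iff_lborel[OF S(1), of "\<lambda>x. (norm (u' x))\<^sup>2"] m z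
    by (simp add: L2_def)
  have ind: "integrable lborel (indicat_real S)"
    using S by (auto simp: less_top[symmetric] dest: emeasure_bounded_finite)
  have "integrable lborel u'"
  proof (rule Bochner_Integration.integrable_bound)
    show "integrable lborel (\<lambda>x. indicat_real S x + (norm (u' x))\<^sup>2)"
      using ind sq by simp
    have "norm (u' x) \<le> norm (indicat_real S x + (norm (u' x))\<^sup>2)" for x
      using sum_squares_bound[of "\<bar>u' x\<bar>" 1] z[of x] by (cases "x \<in> S") auto
    then show "AE x in lborel. norm (u' x) \<le> norm (indicat_real S x + (norm (u' x))\<^sup>2)" by simp
  qed (use m in simp)
  moreover have "u' \<in> L2 lborel" using sq m by (simp add: L2_def)
  ultimately show thesis using that z eq m by blast
qed

lemma weak_deriv_borel:
  fixes u g :: "'a::euclidean_space \<Rightarrow> real"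
  assumes S: "S \<in> sets borel" and w: "has_weak_deriv S i u g" and i: "i \<in> Basis"
    and u: "u' \<in> borel_measurable borel" "\<And>x. x \<notin> S \<Longrightarrow> u' x = 0" "AE x in lebesgue_on S. u x = u' x"
    and g: "g' \<in> borel_measurable borel" "\<And>x. x \<notin> S \<Longrightarrow> g' x = 0" "AE x in lebesgue_on S. g x = g' x"
    and \<phi>: "\<phi> \<in> test_functions S"
  shows "(LBINT x. partial i \<phi> x * u' x) = - (LBINT x. \<phi> x * g' x)"
proof -
  have m: "\<phi> \<in> borel_measurable borel" "partial i \<phi> \<in> borel_measurable borel"
    using \<phi> test_functions_partial[OF \<phi> i] test_functions_smooth smooth_measurable by blast+
  have "(\<integral>x. partial i \<phi> x *\<^sub>R u x \<partial>lebesgue_on S) = (LBINT x. partial i \<phi> x * u' x)"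
    using u m by (intro integral_lebesgue_on_eq_lborel[OF S]) (auto elim!: eventually_mono)
  moreover have "(\<integral>x. \<phi> x *\<^sub>R g x \<partial>lebesgue_on S) = (LBINT x. \<phi> x * g' x)"
    using g m by (intro integral_lebesgue_on_eq_lborel[OF S]) (auto elim!: eventually_mono)
  ultimately show ?thesis using w \<phi> by (simp add: has_weak_deriv_def)
qed

lemma test_functions_shifted_kernel:
  assumes k: "k \<in> test_functions (ball 0 \<delta>)" and x: "ball x \<delta> \<subseteq> A"
  shows "(\<lambda>y. k (x - y)) \<in> test_functions A"
proof -
  obtain K where K: "smooth k" "compact K" "K \<subseteq> ball 0 \<delta>" "\<And>z. z \<notin> K \<Longrightarrow> k z = 0"
    using test_functionsE[OF k] by metis
  show ?thesis
  proof (rule test_functionsI)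
    show "smooth (\<lambda>y. k (x - y))" using smooth_affine[OF K(1), of x "-1"] by simp
    show "compact ((\<lambda>z. x - z) ` K)" using K(2) by (intro compact_continuous_image continuous_intros)
    show "(\<lambda>z. x - z) ` K \<subseteq> A"
    proof
      fix y assume "y \<in> (\<lambda>z. x - z) ` K"
      then obtain z where "z \<in> K" "y = x - z" by blast
      then have "y \<in> ball x \<delta>" using K(3) by (auto simp: dist_norm)
      then show "y \<in> A" using x by blast
    qed
    show "k (x - y) = 0" if "y \<notin> (\<lambda>z. x - z) ` K" for y
    proof (rule K(4), rule notI)
      assume "x - y \<in> K"
      then have "x - (x - y) \<in> (\<lambda>z. x - z) ` K" by blast
      with that show False by simp
    qed
  qed
qed

lemma partial_shifted_kernel: "smooth k \<Longrightarrow> partial i (\<lambda>y. k (x - y)) y = - partial i k (x - y)"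
  using partial_affine[of k x "-1" y i] by simp

text \<open>
  The fundamental lemma of the calculus of variations. On the points with distance at least
  \<open>1/(n+1)\<close> from the complement of \<open>S\<close>, translates of small bumps are test functions on \<open>S\<close>; pairing the
  restriction of \<open>g\<close> to this set with \<open>g\<close> through such kernels gives the integral of \<open>g\<^sup>2\<close> over it.
\<close>

lemma AE_zero_if_orthogonal_to_test_functions:
  fixes g :: "'a::euclidean_space \<Rightarrow> real"
  assumes S: "open S" "bounded S" and g: "g \<in> L2 (lebesgue_on S)"
    and orth: "\<And>\<phi>. \<phi> \<in> test_functions S \<Longrightarrow> (\<integral>x. \<phi> x * g x \<partial>lebesgue_on S) = 0"
  shows "AE x in lebesgue_on S. g x = 0"
proof -
  have Sb: "S \<in> sets borel" using S by simp
  obtain h where h: "h \<in> L2 lborel" "integrable lborel h" "\<And>x. x \<notin> S \<Longrightarrow> h x = 0"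
    "AE x in lebesgue_on S. g x = h x" "h \<in> borel_measurable borel"
    using L2_lebesgue_on_borel_representative[OF Sb S(2) g] by metis
  have h_orth: "(LBINT x. \<phi> x * h x) = 0" if "\<phi> \<in> test_functions S" for \<phi>
  proof -
    have "(\<integral>x. \<phi> x * g x \<partial>lebesgue_on S) = (LBINT x. \<phi> x * h x)"
      using h smooth_measurable[OF test_functions_smooth[OF that]]
      by (intro integral_lebesgue_on_eq_lborel[OF Sb]) (auto elim!: eventually_mono)
    with orth[OF that] show ?thesis by simp
  qed
  \<comment> \<open>these sets exhaust \<open>S\<close>\<close>
  define K where "K n = {x. 1 / real (Suc n) \<le> infdist x (- S)}" for n
  have Kb[measurable]: "K n \<in> sets borel" for n
    unfolding K_def by (intro borel_closed closed_Collect_le continuous_intros)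
  have "AE x in lborel. x \<in> K n \<longrightarrow> h x = 0" for n
  proof -
    define a where "a x = indicat_real (K n) x * h x" for x
    have a: "a \<in> L2 lborel" "integrable lborel a"
    proof -
      show "a \<in> L2 lborel"
        by (rule L2_I_bound[OF _ L2_integrable_power2[OF h(1)]])
          (use h(5) in \<open>auto simp: a_def[abs_def] indicator_def\<close>)
      show "integrable lborel a"
        by (rule Bochner_Integration.integrable_bound[OF h(2)])
          (use h(5) in \<open>auto simp: a_def[abs_def] indicator_def\<close>)
    qed
    have "(LBINT x. a x * h x) + (\<integral>x. 0 * (0::real) \<partial>(lborel :: 'a measure)) = 0"
    proof (rule inner_products_from_kernels[OF a h(1,2)])
      show "1 / real (Suc n) > 0" by simp
      fix k :: "'a \<Rightarrow> real" assume k: "k \<in> test_functions (ball 0 (1 / real (Suc n)))"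
      have "(LBINT y. a x * k (x - y) * h y) = 0" for x
      proof (cases "x \<in> K n")
        case True
        have "ball x (1 / real (Suc n)) \<subseteq> S"
        proof
          fix y assume y: "y \<in> ball x (1 / real (Suc n))"
          show "y \<in> S"
          proof (rule ccontr)
            assume "y \<notin> S"
            then have "infdist x (- S) \<le> dist x y" by (intro infdist_le) simp
            with y True show False by (simp add: K_def)
          qed
        qed
        from h_orth[OF test_functions_shifted_kernel[OF k this]] show ?thesis
          by (simp add: mult.assoc)
      qed (simp add: a_def)
      then show "kernel_form a k h + kernel_form (\<lambda>x. 0) k (\<lambda>x. 0) = 0"
        by (simp add: kernel_form_def)
    qed (auto simp: L2_zero)
    then have "(LBINT x. a x * h x) = 0" by simp
    moreover have "AE x in lborel. 0 \<le> a x * h x" by (simp add: a_def indicator_def)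
    ultimately have "AE x in lborel. a x * h x = 0"
      using integral_nonneg_eq_0_iff_AE[OF L2_mult_integrable[OF a(1) h(1)]] by simp
    then show ?thesis by eventually_elim (auto simp: a_def)
  qed
  then have "AE x in lborel. \<forall>n. x \<in> K n \<longrightarrow> h x = 0" by (subst AE_all_countable) simp
  then have "AE x in lborel. h x = 0"
  proof eventually_elim
    case (elim x)
    show ?case
    proof (cases "x \<in> S")
      case True
      have "S \<noteq> UNIV" using S(2) not_bounded_UNIV by auto
      then have "- S \<noteq> {}" by auto
      then have "infdist x (- S) > 0"
        using True S(1) by (intro infdist_pos_not_in_closed) auto
      then obtain n where "inverse (real (Suc n)) < infdist x (- S)"
        using reals_Archimedean by blast
      with elim show ?thesis by (auto simp: K_def inverse_eq_divide intro: less_imp_le)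
    qed (rule h(3))
  qed
  then have "AE x in lebesgue. h x = 0" by (simp add: AE_completion_iff)
  then have "AE x in lebesgue_on S. h x = 0"
    using Sb by (auto simp: AE_restrict_space_iff elim: eventually_mono)
  with h(4) show ?thesis by eventually_elim simp
qed

text \<open>
  The product rule for \<open>c \<eta>\<close> combined with integration by parts against a Sobolev function. The cutoff \<open>\<eta>\<close>
  keeps a positive distance \<open>\<delta>\<close> from the boundary, so that kernels supported in the ball of radius
  \<open>\<delta>\<close>, shifted to a point of the support of \<open>\<eta>\<close>, are test functions. First the derivative moves from \<open>v\<close> to the kernel,
  then, after exchanging the integrals, from the kernel to \<open>c \<eta>\<close>.
\<close>

proposition weak_deriv_integration_by_parts:
  fixes c c' v v' \<eta> :: "'a::euclidean_space \<Rightarrow> real"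
  assumes S: "open S" "bounded S" and i: "i \<in> Basis"
    and c: "c \<in> L2 (lebesgue_on S)" "c' \<in> L2 (lebesgue_on S)" "has_weak_deriv S i c c'"
    and v: "v \<in> L2 (lebesgue_on S)" "v' \<in> L2 (lebesgue_on S)" "has_weak_deriv S i v v'"
    and \<eta>: "\<eta> \<in> test_functions S"
  shows "(\<integral>x. c x * \<eta> x * v' x \<partial>lebesgue_on S)
    = - (\<integral>x. (c' x * \<eta> x + c x * partial i \<eta> x) * v x \<partial>lebesgue_on S)"
proof -
  have Sb: "S \<in> sets borel" using S by simp
  obtain C where C: "C \<in> L2 lborel" "integrable lborel C" "\<And>x. x \<notin> S \<Longrightarrow> C x = 0"
    "AE x in lebesgue_on S. c x = C x" "C \<in> borel_measurable borel"
    using L2_lebesgue_on_borel_representative[OF Sb S(2) c(1)] by metis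
  obtain C' where C': "C' \<in> L2 lborel" "integrable lborel C'" "\<And>x. x \<notin> S \<Longrightarrow> C' x = 0"
    "AE x in lebesgue_on S. c' x = C' x" "C' \<in> borel_measurable borel"
    using L2_lebesgue_on_borel_representative[OF Sb S(2) c(2)] by metis
  obtain V where V: "V \<in> L2 lborel" "integrable lborel V" "\<And>x. x \<notin> S \<Longrightarrow> V x = 0"
    "AE x in lebesgue_on S. v x = V x" "V \<in> borel_measurable borel"
    using L2_lebesgue_on_borel_representative[OF Sb S(2) v(1)] by metis
  obtain V' where V': "V' \<in> L2 lborel" "integrable lborel V'" "\<And>x. x \<notin> S \<Longrightarrow> V' x = 0"
    "AE x in lebesgue_on S. v' x = V' x" "V' \<in> borel_measurable borel"
    using L2_lebesgue_on_borel_representative[OF Sb S(2) v(2)] by metis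
  have wc: "(LBINT x. partial i \<phi> x * C x) = - (LBINT x. \<phi> x * C' x)"
    if "\<phi> \<in> test_functions S" for \<phi>
    using weak_deriv_borel[OF Sb c(3) i C(5,3,4) C'(5,3,4)] that by blast
  have wv: "(LBINT x. partial i \<phi> x * V x) = - (LBINT x. \<phi> x * V' x)"
    if "\<phi> \<in> test_functions S" for \<phi>
    using weak_deriv_borel[OF Sb v(3) i V(5,3,4) V'(5,3,4)] that by blast
  have \<eta>': "partial i \<eta> \<in> test_functions S" by (rule test_functions_partial[OF \<eta> i])
  have prod: "(\<lambda>x. C x * \<phi> x) \<in> L2 lborel \<and> integrable lborel (\<lambda>x. C x * \<phi> x)"
    if \<phi>: "\<phi> \<in> test_functions S" and C: "C \<in> L2 lborel" "integrable lborel C" for \<phi> C :: "'a \<Rightarrow> real"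
  proof -
    obtain B where B: "\<And>x. \<bar>\<phi> x\<bar> \<le> B" using test_functions_bounded[OF \<phi>] by blast
    have [measurable]: "\<phi> \<in> borel_measurable borel" "C \<in> borel_measurable borel"
      using smooth_measurable[OF test_functions_smooth[OF \<phi>]] C(2) by auto
    have "(\<lambda>x. \<phi> x *\<^sub>R C x) \<in> L2 lborel"
      by (rule L2_mult_bounded[OF C(1), where B=B]) (use B in auto)
    moreover have "integrable lborel (\<lambda>x. C x * \<phi> x)"
    proof (rule Bochner_Integration.integrable_bound)
      show "integrable lborel (\<lambda>x. C x * B)" using C(2) by simp
      show "AE x in lborel. norm (C x * \<phi> x) \<le> norm (C x * B)"
        using order_trans[OF B abs_ge_self] by (auto simp: abs_mult intro!: mult_left_mono)
    qed auto
    ultimately show ?thesis by (simp add: mult.commute)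
  qed
  define a where "a x = C x * \<eta> x" for x
  define a' where "a' x = C' x * \<eta> x + C x * partial i \<eta> x" for x
  have a: "a \<in> L2 lborel" "integrable lborel a"
    using prod[OF \<eta> C(1,2)] by (auto simp: a_def[abs_def])
  have a': "a' \<in> L2 lborel" "integrable lborel a'"
    using prod[OF \<eta> C'(1,2)] prod[OF \<eta>' C(1,2)] by (auto simp: a'_def[abs_def] intro: L2_add)
  have sm: "smooth \<eta>" by (rule test_functions_smooth[OF \<eta>])
  have m: "\<eta> \<in> borel_measurable borel" "partial i \<eta> \<in> borel_measurable borel"
    using smooth_measurable sm smooth_partial[OF sm i] by auto
  obtain K where K: "compact K" "K \<subseteq> S" "\<And>x. x \<notin> K \<Longrightarrow> \<eta> x = 0"
    using test_functionsE[OF \<eta>] by metis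
  obtain \<delta> where \<delta>: "\<delta> > 0" "\<And>x. x \<in> K \<Longrightarrow> ball x \<delta> \<subseteq> S"
    using compact_subset_open_imp_ball_epsilon_subset[OF K(1) S(1) K(2)] by (metis UN_subset_iff)
  have "(LBINT x. a x * V' x) + (LBINT x. a' x * V x) = 0"
  proof (rule inner_products_from_kernels[OF a V'(1,2) a' V(1,2) \<delta>(1)])
    fix k :: "'a \<Rightarrow> real" assume k: "k \<in> test_functions (ball 0 \<delta>)"
    have ks: "smooth k" by (rule test_functions_smooth[OF k])
    have k': "partial i k \<in> test_functions (ball 0 \<delta>)" by (rule test_functions_partial[OF k i])
    obtain B where B: "\<And>x. \<bar>k x\<bar> \<le> B" using test_functions_bounded[OF k] by blast
    obtain B' where B': "\<And>x. \<bar>partial i k x\<bar> \<le> B'" using test_functions_bounded[OF k'] by blast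
    have km: "k \<in> borel_measurable borel" "partial i k \<in> borel_measurable borel"
      using smooth_measurable ks smooth_partial[OF ks i] by auto
    \<comment> \<open>the two signs from differentiating \<open>k (x - y)\<close> in \<open>y\<close> and from the weak derivative cancel\<close>
    have "(LBINT y. a x * k (x - y) * V' y) = (LBINT y. a x * partial i k (x - y) * V y)" for x
    proof (cases "x \<in> K")
      case True
      have "(LBINT y. partial i (\<lambda>y. k (x - y)) y * V y) = - (LBINT y. k (x - y) * V' y)"
        by (rule wv) (rule test_functions_shifted_kernel[OF k \<delta>(2)[OF True]])
      then show ?thesis by (simp add: partial_shifted_kernel[OF ks] mult.assoc)
    qed (simp add: a_def K(3))
    then have "kernel_form a k V' = kernel_form a (partial i k) V"
      by (simp add: kernel_form_def)
    also have "\<dots> = (\<integral>y. \<integral>x. a x * partial i k (x - y) * V y \<partial>lborel \<partial>lborel)"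
      unfolding kernel_form_def
      by (rule lborel_pair.Fubini_integral[symmetric], rule kernel_integrable[OF a(2) V(2) km(2) B'])
    also have "\<dots> = (\<integral>y. - (LBINT x. a' x * k (x - y) * V y) \<partial>lborel)"
    proof (rule Bochner_Integration.integral_cong[OF refl])
      fix y
      have s: "smooth (\<lambda>x. k (x - y))" using smooth_affine[OF ks, of "- y" 1] by simp
      have p: "partial i (\<lambda>x. k (x - y)) x = partial i k (x - y)" for x
        using partial_affine[OF ks, of "- y" 1 x i] by simp
      have t: "(\<lambda>x. \<eta> x * k (x - y)) \<in> test_functions S" by (rule test_functions_mult[OF \<eta> s])
      have t1: "(\<lambda>x. partial i \<eta> x * k (x - y)) \<in> test_functions S" by (rule test_functions_mult[OF \<eta>' s])
      have s2: "smooth (\<lambda>x. partial i k (x - y))"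
        using smooth_affine[OF smooth_partial[OF ks i], of "- y" 1] by simp
      have t2: "(\<lambda>x. \<eta> x * partial i k (x - y)) \<in> test_functions S" by (rule test_functions_mult[OF \<eta> s2])
      have "(LBINT x. partial i (\<lambda>x. \<eta> x * k (x - y)) x * C x) = - (LBINT x. \<eta> x * k (x - y) * C' x)"
        by (rule wc[OF t])
      also have "(LBINT x. partial i (\<lambda>x. \<eta> x * k (x - y)) x * C x)
          = (LBINT x. C x * (partial i \<eta> x * k (x - y)) + C x * (\<eta> x * partial i k (x - y)))"
        by (simp add: partial_mult[OF sm s] p algebra_simps)
      also have "\<dots> = (LBINT x. C x * (partial i \<eta> x * k (x - y))) + (LBINT x. C x * (\<eta> x * partial i k (x - y)))"
        using prod[OF t1 C(1,2)] prod[OF t2 C(1,2)] by simp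
      finally have "(LBINT x. C x * (\<eta> x * partial i k (x - y)))
          = - ((LBINT x. C' x * (\<eta> x * k (x - y))) + (LBINT x. C x * (partial i \<eta> x * k (x - y))))"
        by (simp add: mult.commute mult.left_commute)
      also have "\<dots> = - (LBINT x. C' x * (\<eta> x * k (x - y)) + C x * (partial i \<eta> x * k (x - y)))"
        using prod[OF t1 C(1,2)] prod[OF t C'(1,2)] by simp
      finally have "(LBINT x. C x * (\<eta> x * partial i k (x - y))) * V y
          = - (LBINT x. C' x * (\<eta> x * k (x - y)) + C x * (partial i \<eta> x * k (x - y))) * V y"
        by (rule arg_cong)
      moreover have "(LBINT x. a x * partial i k (x - y) * V y)
          = (LBINT x. C x * (\<eta> x * partial i k (x - y))) * V y"
        unfolding a_def integral_mult_left_zero[symmetric] by (simp only: mult.assoc)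
      moreover have "(LBINT x. a' x * k (x - y) * V y)
          = (LBINT x. C' x * (\<eta> x * k (x - y)) + C x * (partial i \<eta> x * k (x - y))) * V y"
        unfolding a'_def integral_mult_left_zero[symmetric] by (simp only: mult.assoc distrib_right)
      ultimately show "(LBINT x. a x * partial i k (x - y) * V y)
          = - (LBINT x. a' x * k (x - y) * V y)"
        unfolding minus_mult_left[symmetric] by (simp only:)
    qed
    also have "\<dots> = - (\<integral>y. \<integral>x. a' x * k (x - y) * V y \<partial>lborel \<partial>lborel)" by simp
    also have "(\<integral>y. \<integral>x. a' x * k (x - y) * V y \<partial>lborel \<partial>lborel) = kernel_form a' k V"
      unfolding kernel_form_def
      by (rule lborel_pair.Fubini_integral, rule kernel_integrable[OF a'(2) V(2) km(1) B])
    finally show "kernel_form a k V' + kernel_form a' k V = 0" by simp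
  qed
  moreover have "(\<integral>x. c x * \<eta> x * v' x \<partial>lebesgue_on S) = (LBINT x. a x * V' x)"
    by (rule integral_lebesgue_on_eq_lborel[OF Sb])
      (use C V' m in \<open>auto simp: a_def intro: eventually_mono[OF eventually_conj[OF C(4) V'(4)]]\<close>)
  moreover have "(\<integral>x. (c' x * \<eta> x + c x * partial i \<eta> x) * v x \<partial>lebesgue_on S) = (LBINT x. a' x * V x)"
    by (rule integral_lebesgue_on_eq_lborel[OF Sb])
      (use C C' V m in \<open>auto simp: a'_def intro: eventually_mono[OF eventually_conj[OF eventually_conj[OF C(4) C'(4)] V(4)]]\<close>)
  ultimately show ?thesis by simp
qed

lemma L2_scaleR_integrable:
  fixes f :: "'a \<Rightarrow> real" and g :: "'a \<Rightarrow> 'b::euclidean_space"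
  assumes "f \<in> L2 M" "g \<in> L2 M"
  shows "integrable M (\<lambda>x. f x *\<^sub>R g x)"
proof (rule Bochner_Integration.integrable_bound)
  show "integrable M (\<lambda>x. (norm (f x))\<^sup>2 + (norm (g x))\<^sup>2)" using assms by (simp add: L2_def)
  show "(\<lambda>x. f x *\<^sub>R g x) \<in> borel_measurable M"
    using L2_measurable[OF assms(1)] L2_measurable[OF assms(2)] by measurable
  have "norm (f x *\<^sub>R g x) \<le> norm ((norm (f x))\<^sup>2 + (norm (g x))\<^sup>2)" for x
  proof -
    have "norm (f x) * norm (g x) \<le> 2 * norm (f x) * norm (g x)" by simp
    also have "\<dots> \<le> (norm (f x))\<^sup>2 + (norm (g x))\<^sup>2" by (rule sum_squares_bound)
    finally show ?thesis by simp
  qed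
  then show "AE x in M. norm (f x *\<^sub>R g x) \<le> norm ((norm (f x))\<^sup>2 + (norm (g x))\<^sup>2)" by simp
qed

lemma test_functions_L2:
  assumes "\<phi> \<in> test_functions A" "S \<in> sets lebesgue"
  shows "\<phi> \<in> L2 (lebesgue_on S)"
proof -
  have m: "\<phi> \<in> borel_measurable borel" using assms(1) test_functions_smooth smooth_measurable by blast
  have "(\<lambda>x. \<phi> x * \<phi> x) \<in> test_functions A"
    using assms(1) by (intro test_functions_mult test_functions_smooth)
  then have "integrable lborel (\<lambda>x. (norm (\<phi> x))\<^sup>2)"
    using test_functions_integrable by (fastforce simp: power2_eq_square)
  then have i: "integrable lebesgue (\<lambda>x. (norm (\<phi> x))\<^sup>2)"
    using m by (subst integrable_completion) auto
  have "integrable (lebesgue_on S) (\<lambda>x. (norm (\<phi> x))\<^sup>2)"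
    using integrable_mult_indicator[OF assms(2) i] assms(2) by (subst integrable_restrict_space) auto
  then show ?thesis using borel_measurable_lebesgue_on_borel[OF m] by (simp add: L2_def)
qed

lemma has_weak_derivI:
  assumes "\<And>\<phi>. \<phi> \<in> test_functions S \<Longrightarrow>
    (\<integral>x. partial i \<phi> x *\<^sub>R u x \<partial>lebesgue_on S) = - (\<integral>x. \<phi> x *\<^sub>R g x \<partial>lebesgue_on S)"
  shows "has_weak_deriv S i u g"
  using assms by (simp add: has_weak_deriv_def)

lemma has_weak_derivD:
  assumes "has_weak_deriv S i u g" "\<phi> \<in> test_functions S"
  shows "(\<integral>x. partial i \<phi> x *\<^sub>R u x \<partial>lebesgue_on S) = - (\<integral>x. \<phi> x *\<^sub>R g x \<partial>lebesgue_on S)"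
  using assms by (simp add: has_weak_deriv_def)

lemma has_weak_deriv_component:
  fixes u g :: "'a::euclidean_space \<Rightarrow> 'b::euclidean_space"
  assumes S: "S \<in> sets lebesgue" and i: "i \<in> Basis"
    and u: "u \<in> L2 (lebesgue_on S)" and g: "g \<in> L2 (lebesgue_on S)" and w: "has_weak_deriv S i u g"
  shows "has_weak_deriv S i (\<lambda>x. u x \<bullet> b) (\<lambda>x. g x \<bullet> b)"
proof (rule has_weak_derivI)
  fix \<phi> assume \<phi>: "\<phi> \<in> test_functions S"
  have 1: "integrable (lebesgue_on S) (\<lambda>x. partial i \<phi> x *\<^sub>R u x)"
    by (rule L2_scaleR_integrable[OF test_functions_L2[OF test_functions_partial[OF \<phi> i] S] u])
  have 2: "integrable (lebesgue_on S) (\<lambda>x. \<phi> x *\<^sub>R g x)"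
    by (rule L2_scaleR_integrable[OF test_functions_L2[OF \<phi> S] g])
  have "(\<integral>x. (partial i \<phi> x *\<^sub>R u x) \<bullet> b \<partial>lebesgue_on S) = - (\<integral>x. (\<phi> x *\<^sub>R g x) \<bullet> b \<partial>lebesgue_on S)"
    using integral_inner_left[of b, OF 1] integral_inner_left[of b, OF 2] has_weak_derivD[OF w \<phi>]
    by (simp del: inner_scaleR_left integral_inner_left)
  then show "(\<integral>x. partial i \<phi> x *\<^sub>R (u x \<bullet> b) \<partial>lebesgue_on S) = - (\<integral>x. \<phi> x *\<^sub>R (g x \<bullet> b) \<partial>lebesgue_on S)"
    by simp
qed

lemma has_weak_deriv_add:
  assumes S: "S \<in> sets lebesgue" and i: "i \<in> Basis"
    and "u \<in> L2 (lebesgue_on S)" "g \<in> L2 (lebesgue_on S)" "has_weak_deriv S i u g"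
    and "v \<in> L2 (lebesgue_on S)" "h \<in> L2 (lebesgue_on S)" "has_weak_deriv S i v h"
  shows "has_weak_deriv S i (\<lambda>x. u x + v x) (\<lambda>x. g x + h x)"
proof (rule has_weak_derivI)
  fix \<phi> assume \<phi>: "\<phi> \<in> test_functions S"
  note \<phi>2 = test_functions_L2[OF \<phi> S] and \<phi>'2 = test_functions_L2[OF test_functions_partial[OF \<phi> i] S]
  show "(\<integral>x. partial i \<phi> x *\<^sub>R (u x + v x) \<partial>lebesgue_on S) = - (\<integral>x. \<phi> x *\<^sub>R (g x + h x) \<partial>lebesgue_on S)"
    using L2_scaleR_integrable[OF \<phi>'2 assms(3)] L2_scaleR_integrable[OF \<phi>'2 assms(6)]
      L2_scaleR_integrable[OF \<phi>2 assms(4)] L2_scaleR_integrable[OF \<phi>2 assms(7)]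
      has_weak_derivD[OF assms(5) \<phi>] has_weak_derivD[OF assms(8) \<phi>]
    by (simp add: scaleR_add_right)
qed

lemma has_weak_deriv_scaleR:
  assumes S: "S \<in> sets lebesgue" and i: "i \<in> Basis"
    and u: "u \<in> L2 (lebesgue_on S)" and g: "g \<in> L2 (lebesgue_on S)" and w: "has_weak_deriv S i u g"
  shows "has_weak_deriv S i (\<lambda>x. c *\<^sub>R u x) (\<lambda>x. c *\<^sub>R g x)"
proof (rule has_weak_derivI)
  fix \<phi> assume \<phi>: "\<phi> \<in> test_functions S"
  have "(\<integral>x. c *\<^sub>R (partial i \<phi> x *\<^sub>R u x) \<partial>lebesgue_on S) = - (\<integral>x. c *\<^sub>R (\<phi> x *\<^sub>R g x) \<partial>lebesgue_on S)"
    using L2_scaleR_integrable[OF test_functions_L2[OF test_functions_partial[OF \<phi> i] S] u]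
      L2_scaleR_integrable[OF test_functions_L2[OF \<phi> S] g] has_weak_derivD[OF w \<phi>]
    by (subst (1 2) integral_scaleR_right) simp_all
  then show "(\<integral>x. partial i \<phi> x *\<^sub>R c *\<^sub>R u x \<partial>lebesgue_on S) = - (\<integral>x. \<phi> x *\<^sub>R c *\<^sub>R g x \<partial>lebesgue_on S)"
    by (simp add: mult.commute)
qed

lemma has_weak_deriv_cong_AE:
  fixes u v :: "'a::euclidean_space \<Rightarrow> 'b::euclidean_space"
  assumes S: "S \<in> sets lebesgue" and i: "i \<in> Basis"
    and u: "u \<in> borel_measurable (lebesgue_on S)" and eq: "AE x in lebesgue_on S. u x = v x"
  shows "has_weak_deriv S i u g \<longleftrightarrow> has_weak_deriv S i v g"
proof -
  have v: "v \<in> borel_measurable (lebesgue_on S)" by (rule borel_measurable_lebesgue_on_AE[OF S u eq])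
  have "(\<integral>x. partial i \<phi> x *\<^sub>R u x \<partial>lebesgue_on S) = (\<integral>x. partial i \<phi> x *\<^sub>R v x \<partial>lebesgue_on S)"
    if "\<phi> \<in> test_functions S" for \<phi>
  proof (rule integral_cong_AE)
    have "partial i \<phi> \<in> borel_measurable (lebesgue_on S)"
      by (rule L2_measurable[OF test_functions_L2[OF test_functions_partial[OF that i] S]])
    then show "(\<lambda>x. partial i \<phi> x *\<^sub>R u x) \<in> borel_measurable (lebesgue_on S)"
      "(\<lambda>x. partial i \<phi> x *\<^sub>R v x) \<in> borel_measurable (lebesgue_on S)"
      using u v by measurable
  qed (use eq in \<open>auto elim: eventually_mono\<close>)
  then show ?thesis unfolding has_weak_deriv_def by simp
qed

lemma AE_euclidean_eqI:
  fixes f g :: "'a \<Rightarrow> 'b::euclidean_space"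
  assumes "\<And>b. b \<in> Basis \<Longrightarrow> AE x in M. f x \<bullet> b = g x \<bullet> b"
  shows "AE x in M. f x = g x"
proof -
  have "AE x in M. \<forall>b\<in>Basis. f x \<bullet> b = g x \<bullet> b"
    using assms by (intro AE_finite_allI) auto
  then show ?thesis by eventually_elim (auto intro: euclidean_eqI)
qed

lemma weak_deriv_unique:
  fixes u g h :: "'a::euclidean_space \<Rightarrow> 'b::euclidean_space"
  assumes S: "open S" "bounded S"
    and g: "g \<in> L2 (lebesgue_on S)" "has_weak_deriv S i u g"
    and h: "h \<in> L2 (lebesgue_on S)" "has_weak_deriv S i u h"
  shows "AE x in lebesgue_on S. g x = h x"
proof (rule AE_euclidean_eqI)
  fix b :: 'b
  have Sl: "S \<in> sets lebesgue" using S by auto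
  have "AE x in lebesgue_on S. (g x - h x) \<bullet> b = 0"
  proof (rule AE_zero_if_orthogonal_to_test_functions[OF S])
    show "(\<lambda>x. (g x - h x) \<bullet> b) \<in> L2 (lebesgue_on S)"
      by (intro L2_inner_const L2_diff g h)
    fix \<phi> assume \<phi>: "\<phi> \<in> test_functions S"
    have i: "integrable (lebesgue_on S) (\<lambda>x. \<phi> x *\<^sub>R g x)" "integrable (lebesgue_on S) (\<lambda>x. \<phi> x *\<^sub>R h x)"
      by (intro L2_scaleR_integrable test_functions_L2[OF \<phi> Sl] g h)+
    have "(\<integral>x. (\<phi> x *\<^sub>R g x) \<bullet> b - (\<phi> x *\<^sub>R h x) \<bullet> b \<partial>lebesgue_on S) = 0"
      using i has_weak_derivD[OF g(2) \<phi>] has_weak_derivD[OF h(2) \<phi>]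
      by (subst Bochner_Integration.integral_diff) (auto simp del: inner_scaleR_left)
    then show "(\<integral>x. \<phi> x * ((g x - h x) \<bullet> b) \<partial>lebesgue_on S) = 0"
      by (simp add: inner_diff_left right_diff_distrib)
  qed
  then show "AE x in lebesgue_on S. g x \<bullet> b = h x \<bullet> b"
    by eventually_elim (simp add: inner_diff_left)
qed

section \<open>The space \<open>H\<^sup>1\<close>\<close>

lemma H1_L2: "u \<in> H1 S \<Longrightarrow> u \<in> L2 (lebesgue_on S)"
  by (simp add: H1_def)

lemma weak_deriv_H1:
  assumes "u \<in> H1 S" "i \<in> Basis"
  shows "weak_deriv S i u \<in> L2 (lebesgue_on S)" "has_weak_deriv S i u (weak_deriv S i u)"
proof -
  have "\<exists>g. g \<in> L2 (lebesgue_on S) \<and> has_weak_deriv S i u g"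
    using assms by (auto simp: H1_def)
  from someI_ex[OF this]
  show "weak_deriv S i u \<in> L2 (lebesgue_on S)" "has_weak_deriv S i u (weak_deriv S i u)"
    by (auto simp: weak_deriv_def)
qed

lemma weak_deriv_eqI:
  assumes "open S" "bounded S" "u \<in> H1 S" "i \<in> Basis" "g \<in> L2 (lebesgue_on S)" "has_weak_deriv S i u g"
  shows "AE x in lebesgue_on S. weak_deriv S i u x = g x"
  using assms weak_deriv_H1 by (intro weak_deriv_unique) auto

text \<open>
  The weak derivative is chosen among all functions satisfying a condition that depends only on the class
  of \<open>u\<close>, so functions in the same class get literally the same derivative.
\<close>

lemma weak_deriv_cong_AE:
  assumes "S \<in> sets lebesgue" "u \<in> borel_measurable (lebesgue_on S)"
    "AE x in lebesgue_on S. u x = v x" "i \<in> Basis"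
  shows "weak_deriv S i u = weak_deriv S i v"
  unfolding weak_deriv_def using has_weak_deriv_cong_AE[OF assms(1,4,2,3)] by simp

lemma H1_cong_AE:
  assumes "S \<in> sets lebesgue" "u \<in> H1 S" "AE x in lebesgue_on S. u x = v x"
  shows "v \<in> H1 S"
  using assms L2_cong_AE[OF assms(1) H1_L2 assms(3)] has_weak_deriv_cong_AE[OF assms(1) _ L2_measurable[OF H1_L2] assms(3)]
  unfolding H1_def by blast

lemma H1_norm_cong_AE:
  assumes "S \<in> sets lebesgue" "u \<in> borel_measurable (lebesgue_on S)" "AE x in lebesgue_on S. u x = v x"
  shows "H1_norm S u = H1_norm S v"
proof -
  have "L2_norm (lebesgue_on S) u = L2_norm (lebesgue_on S) v"
    using assms(2) borel_measurable_lebesgue_on_AE[OF assms] assms(3) by (rule L2_norm_cong_AE)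
  then show ?thesis
    unfolding H1_norm_def using weak_deriv_cong_AE[OF assms] by simp
qed

lemma H1_zero: "(\<lambda>x. 0) \<in> H1 S"
  unfolding H1_def by (auto simp: L2_zero has_weak_deriv_def intro!: bexI[of _ "\<lambda>x. 0"])

lemma H1_add:
  assumes "S \<in> sets lebesgue" "u \<in> H1 S" "v \<in> H1 S"
  shows "(\<lambda>x. u x + v x) \<in> H1 S"
  unfolding H1_def
proof (intro CollectI conjI ballI)
  show "(\<lambda>x. u x + v x) \<in> L2 (lebesgue_on S)" using assms by (intro L2_add H1_L2)
  fix i :: 'a assume i: "i \<in> Basis"
  show "\<exists>g\<in>L2 (lebesgue_on S). has_weak_deriv S i (\<lambda>x. u x + v x) g"
    using has_weak_deriv_add[OF assms(1) i H1_L2[OF assms(2)] weak_deriv_H1[OF assms(2) i]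
        H1_L2[OF assms(3)] weak_deriv_H1[OF assms(3) i]]
      L2_add[OF weak_deriv_H1(1)[OF assms(2) i] weak_deriv_H1(1)[OF assms(3) i]] by blast
qed

lemma H1_scaleR:
  assumes "S \<in> sets lebesgue" "u \<in> H1 S"
  shows "(\<lambda>x. c *\<^sub>R u x) \<in> H1 S"
  unfolding H1_def
proof (intro CollectI conjI ballI)
  show "(\<lambda>x. c *\<^sub>R u x) \<in> L2 (lebesgue_on S)" using assms by (intro L2_scaleR H1_L2)
  fix i :: 'a assume i: "i \<in> Basis"
  show "\<exists>g\<in>L2 (lebesgue_on S). has_weak_deriv S i (\<lambda>x. c *\<^sub>R u x) g"
    using has_weak_deriv_scaleR[OF assms(1) i H1_L2[OF assms(2)] weak_deriv_H1[OF assms(2) i]]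
      L2_scaleR[OF weak_deriv_H1(1)[OF assms(2) i]] by blast
qed

text \<open>
  The chosen derivatives are linear only up to null sets, by uniqueness of weak derivatives.
\<close>

lemma weak_deriv_add:
  assumes S: "open S" "bounded S" and u: "u \<in> H1 S" and v: "v \<in> H1 S" and i: "i \<in> Basis"
  shows "AE x in lebesgue_on S. weak_deriv S i (\<lambda>x. u x + v x) x = weak_deriv S i u x + weak_deriv S i v x"
proof -
  have Sl: "S \<in> sets lebesgue" using S by auto
  show ?thesis
    by (intro weak_deriv_eqI[OF S H1_add[OF Sl u v] i] L2_add
        has_weak_deriv_add[OF Sl i H1_L2[OF u] _ _ H1_L2[OF v]] weak_deriv_H1 i u v)
qed

lemma weak_deriv_scaleR:
  assumes S: "open S" "bounded S" and u: "u \<in> H1 S" and i: "i \<in> Basis"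
  shows "AE x in lebesgue_on S. weak_deriv S i (\<lambda>x. c *\<^sub>R u x) x = c *\<^sub>R weak_deriv S i u x"
proof -
  have Sl: "S \<in> sets lebesgue" using S by auto
  show ?thesis
    by (intro weak_deriv_eqI[OF S H1_scaleR[OF Sl u] i] L2_scaleR has_weak_deriv_scaleR[OF Sl i H1_L2[OF u]]
        weak_deriv_H1 i u)
qed

lemma L2_norm_le_H1_norm: "L2_norm (lebesgue_on S) u \<le> H1_norm S u"
  unfolding H1_norm_def by (rule real_le_rsqrt) (simp add: sum_nonneg)

lemma H1_norm_L2_set:
  "H1_norm S u = sqrt ((L2_norm (lebesgue_on S) u)\<^sup>2
     + (L2_set (\<lambda>i. L2_norm (lebesgue_on S) (weak_deriv S i u)) Basis)\<^sup>2)"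
  by (simp add: H1_norm_def L2_set_def sum_nonneg)

lemma H1_norm_triangle:
  assumes S: "open S" "bounded S" and u: "u \<in> H1 S" and v: "v \<in> H1 S"
  shows "H1_norm S (\<lambda>x. u x + v x) \<le> H1_norm S u + H1_norm S v"
proof -
  let ?n = "L2_norm (lebesgue_on S)" and ?g = "\<lambda>u. L2_set (\<lambda>i. L2_norm (lebesgue_on S) (weak_deriv S i u)) Basis"
  have Sl: "S \<in> sets lebesgue" using S by auto
  have "?g (\<lambda>x. u x + v x) \<le> L2_set (\<lambda>i. ?n (weak_deriv S i u) + ?n (weak_deriv S i v)) Basis"
  proof (rule L2_set_mono)
    fix i :: 'a assume i: "i \<in> Basis"
    note Lu = weak_deriv_H1(1)[OF u i] and Lv = weak_deriv_H1(1)[OF v i]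
    have "?n (weak_deriv S i (\<lambda>x. u x + v x)) = ?n (\<lambda>x. weak_deriv S i u x + weak_deriv S i v x)"
      by (intro L2_norm_cong_AE weak_deriv_add S u v i L2_measurable L2_add Lu Lv
          weak_deriv_H1(1)[OF H1_add[OF Sl u v] i])
    then show "?n (weak_deriv S i (\<lambda>x. u x + v x)) \<le> ?n (weak_deriv S i u) + ?n (weak_deriv S i v)"
      using L2_norm_triangle[OF Lu Lv] by simp
  qed (rule L2_norm_nonneg)
  also have "\<dots> \<le> ?g u + ?g v" by (rule L2_set_triangle_ineq)
  finally have g: "?g (\<lambda>x. u x + v x) \<le> ?g u + ?g v" .
  have "H1_norm S (\<lambda>x. u x + v x) \<le> sqrt ((?n u + ?n v)\<^sup>2 + (?g u + ?g v)\<^sup>2)"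
    unfolding H1_norm_L2_set
    by (intro real_sqrt_le_mono add_mono power_mono g L2_norm_triangle H1_L2 u v L2_norm_nonneg L2_set_nonneg)
  also have "\<dots> \<le> H1_norm S u + H1_norm S v"
    unfolding H1_norm_L2_set by (rule real_sqrt_sum_squares_triangle_ineq)
  finally show ?thesis .
qed

lemma H1_norm_scaleR:
  assumes S: "open S" "bounded S" and u: "u \<in> H1 S"
  shows "H1_norm S (\<lambda>x. c *\<^sub>R u x) = \<bar>c\<bar> * H1_norm S u"
proof -
  have "L2_norm (lebesgue_on S) (weak_deriv S i (\<lambda>x. c *\<^sub>R u x)) = \<bar>c\<bar> * L2_norm (lebesgue_on S) (weak_deriv S i u)"
    if i: "i \<in> Basis" for i
  proof -
    have "L2_norm (lebesgue_on S) (weak_deriv S i (\<lambda>x. c *\<^sub>R u x)) = L2_norm (lebesgue_on S) (\<lambda>x. c *\<^sub>R weak_deriv S i u x)"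
      using S by (intro L2_norm_cong_AE weak_deriv_scaleR S u i L2_measurable L2_scaleR weak_deriv_H1(1) H1_scaleR) auto
    then show ?thesis by (simp add: L2_norm_scaleR)
  qed
  then have "H1_norm S (\<lambda>x. c *\<^sub>R u x) = sqrt (c\<^sup>2 * ((L2_norm (lebesgue_on S) u)\<^sup>2
      + (\<Sum>i\<in>Basis. (L2_norm (lebesgue_on S) (weak_deriv S i u))\<^sup>2)))"
    unfolding H1_norm_def by (simp add: L2_norm_scaleR power_mult_distrib sum_distrib_left distrib_left)
  then show ?thesis by (simp add: real_sqrt_mult H1_norm_def)
qed

section \<open>Bochner spaces\<close>

lemma integrable_const_interval: "integrable (lebesgue_on {0<..<T::real}) (\<lambda>t. c :: real)"
  by (intro finite_measure.integrable_const finite_measure_lebesgue_on) simp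

text \<open>
  The common structure of \<open>L\<^sup>2\<close> and \<open>H\<^sup>1\<close> on which the Bochner spaces rest. Only a seminorm is
  available, since elements are functions and not classes.
\<close>

locale seminormed_functions =
  fixes S :: "('a \<Rightarrow> 'b::euclidean_space) set" and N :: "('a \<Rightarrow> 'b) \<Rightarrow> real"
  assumes zero_closed: "(\<lambda>x. 0) \<in> S"
    and add_closed: "u \<in> S \<Longrightarrow> v \<in> S \<Longrightarrow> (\<lambda>x. u x + v x) \<in> S"
    and scaleR_closed: "u \<in> S \<Longrightarrow> (\<lambda>x. c *\<^sub>R u x) \<in> S"
    and triangle: "u \<in> S \<Longrightarrow> v \<in> S \<Longrightarrow> N (\<lambda>x. u x + v x) \<le> N u + N v"
    and N_scaleR: "u \<in> S \<Longrightarrow> N (\<lambda>x. c *\<^sub>R u x) = \<bar>c\<bar> * N u"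
begin

lemma N_zero: "N (\<lambda>x. 0) = 0"
  using N_scaleR[OF zero_closed, of 0] by simp

lemma diff_closed: "u \<in> S \<Longrightarrow> v \<in> S \<Longrightarrow> u - v \<in> S"
  using add_closed[OF _ scaleR_closed[of v "-1"], of u] by (simp add: fun_diff_def)

lemma N_diff_commute:
  assumes "u \<in> S" "v \<in> S" shows "N (u - v) = N (v - u)"
  using N_scaleR[OF diff_closed[OF assms], of "-1"] by (simp add: fun_diff_def)

lemma N_nonneg: assumes "u \<in> S" shows "N u \<ge> 0"
  using triangle[OF assms scaleR_closed[OF assms, of "-1"]] N_scaleR[OF assms, of "-1"] N_zero by simp

lemma reverse_triangle:
  assumes "u \<in> S" "v \<in> S"
  shows "\<bar>N u - N v\<bar> \<le> N (u - v)"
proof -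
  have "N u \<le> N (u - v) + N v" if "u \<in> S" "v \<in> S" for u v
    using triangle[OF diff_closed[OF that] that(2)] by (simp add: fun_diff_def)
  from this[OF assms] this[OF assms(2,1)] show ?thesis
    using N_diff_commute[OF assms] by linarith
qed

lemma sum_closed: "(\<And>k. k \<in> I \<Longrightarrow> v k \<in> S) \<Longrightarrow> (\<lambda>x. \<Sum>k\<in>I. v k x) \<in> S"
  by (induction I rule: infinite_finite_induct) (auto simp: zero_closed add_closed)

lemma simple_into_closed: "simple_into T S s \<Longrightarrow> s t \<in> S"
  unfolding simple_into_def by (elim exE conjE) (auto intro!: sum_closed scaleR_closed)

lemma simple_into_add:
  assumes "simple_into T S s" "simple_into T S r"
  shows "simple_into T S (\<lambda>t x. s t x + r t x)"
proof -
  obtain n :: nat and A v where s: "\<forall>k<n. A k \<in> sets (lebesgue_on {0<..<T}) \<and> v k \<in> S"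
    "s = (\<lambda>t x. \<Sum>k<n. indicat_real (A k) t *\<^sub>R v k x)"
    using assms(1) unfolding simple_into_def by blast
  obtain m :: nat and B w where r: "\<forall>k<m. B k \<in> sets (lebesgue_on {0<..<T}) \<and> w k \<in> S"
    "r = (\<lambda>t x. \<Sum>k<m. indicat_real (B k) t *\<^sub>R w k x)"
    using assms(2) unfolding simple_into_def by blast
  define D where "D k = (if k < n then A k else B (k - n))" for k
  define q where "q k = (if k < n then v k else w (k - n))" for k
  have sum_split: "(\<Sum>k<n + m. f k) = (\<Sum>k<n. f k) + (\<Sum>k<m. f (n + k))" for f :: "nat \<Rightarrow> 'b"
    by (induction m) (auto simp: add.assoc)
  show ?thesis
    unfolding simple_into_def
  proof (intro exI conjI)
    show "\<forall>k<n + m. D k \<in> sets (lebesgue_on {0<..<T}) \<and> q k \<in> S"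
      using s(1) r(1) by (auto simp: D_def q_def)
    show "(\<lambda>t x. s t x + r t x) = (\<lambda>t x. \<Sum>k<n + m. indicat_real (D k) t *\<^sub>R q k x)"
      unfolding sum_split s(2) r(2) by (auto simp: D_def q_def fun_eq_iff)
  qed
qed

lemma simple_into_scaleR:
  assumes "simple_into T S s"
  shows "simple_into T S (\<lambda>t x. c *\<^sub>R s t x)"
proof -
  obtain n :: nat and A v where s: "\<forall>k<n. A k \<in> sets (lebesgue_on {0<..<T}) \<and> v k \<in> S"
    "s = (\<lambda>t x. \<Sum>k<n. indicat_real (A k) t *\<^sub>R v k x)"
    using assms(1) unfolding simple_into_def by blast
  show ?thesis
    unfolding simple_into_def
  proof (intro exI conjI)
    show "\<forall>k<n. A k \<in> sets (lebesgue_on {0<..<T}) \<and> (\<lambda>x. c *\<^sub>R v k x) \<in> S"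
      using s(1) by (auto intro: scaleR_closed)
    show "(\<lambda>t x. c *\<^sub>R s t x) = (\<lambda>t x. \<Sum>k<n. indicat_real (A k) t *\<^sub>R (c *\<^sub>R v k x))"
      unfolding s(2) scaleR_sum_right by (intro ext sum.cong refl scaleR_left_commute)
  qed
qed

text \<open>
  Whatever the functional is, it takes only finitely many values along a simple function. Splitting off the
  last set reduces the number of terms, with the vector added so far as a parameter.
\<close>

lemma simple_into_measurable:
  fixes F :: "('a \<Rightarrow> 'b) \<Rightarrow> real"
  assumes "simple_into T S s"
  shows "(\<lambda>t. F (s t)) \<in> borel_measurable (lebesgue_on {0<..<T})"
proof -
  obtain n :: nat and A v where s: "\<forall>k<n. A k \<in> sets (lebesgue_on {0<..<T}) \<and> v k \<in> S"
    "s = (\<lambda>t x. \<Sum>k<n. indicat_real (A k) t *\<^sub>R v k x)"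
    using assms(1) unfolding simple_into_def by blast
  have "(\<lambda>t. F (\<lambda>x. u x + (\<Sum>k<m. indicat_real (A k) t *\<^sub>R v k x))) \<in> borel_measurable (lebesgue_on {0<..<T})"
    if "m \<le> n" for u m
    using that
  proof (induction m arbitrary: u)
    case (Suc m)
    have A: "A m \<in> sets (lebesgue_on {0<..<T})" using s(1) Suc.prems by auto
    have "(\<lambda>t. if t \<in> A m then F (\<lambda>x. (u x + v m x) + (\<Sum>k<m. indicat_real (A k) t *\<^sub>R v k x))
        else F (\<lambda>x. u x + (\<Sum>k<m. indicat_real (A k) t *\<^sub>R v k x))) \<in> borel_measurable (lebesgue_on {0<..<T})"
      using Suc A by (intro measurable_If_set) auto
    also have "(\<lambda>t. if t \<in> A m then F (\<lambda>x. (u x + v m x) + (\<Sum>k<m. indicat_real (A k) t *\<^sub>R v k x))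
        else F (\<lambda>x. u x + (\<Sum>k<m. indicat_real (A k) t *\<^sub>R v k x)))
      = (\<lambda>t. F (\<lambda>x. u x + (\<Sum>k<Suc m. indicat_real (A k) t *\<^sub>R v k x)))"
      by (auto simp: fun_eq_iff add_ac)
    finally show ?case .
  qed simp
  from this[of n "\<lambda>x. 0"] show ?thesis by (simp add: s(2))
qed

text \<open>
  A functional that is Lipschitz with respect to the seminorm commutes with the limit of simple
  functions. It is applied to the seminorm itself and to bounded linear functionals.
\<close>

lemma strongly_measurable_functional:
  fixes F :: "('a \<Rightarrow> 'b) \<Rightarrow> real"
  assumes f: "strongly_measurable T S N f" "AE t in lebesgue_on {0<..<T}. f t \<in> S"
    and F: "\<And>u v. u \<in> S \<Longrightarrow> v \<in> S \<Longrightarrow> \<bar>F u - F v\<bar> \<le> c * N (u - v)"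
  shows "(\<lambda>t. F (f t)) \<in> borel_measurable (lebesgue_on {0<..<T})"
proof -
  obtain s where s: "\<And>n. simple_into T S (s n)"
    "AE t in lebesgue_on {0<..<T}. (\<lambda>n. N (s n t - f t)) \<longlonglongrightarrow> 0"
    using f(1) unfolding strongly_measurable_def by blast
  have eq: "AE t in lebesgue_on {0<..<T}. lim (\<lambda>n. F (s n t)) = F (f t)"
    using s(2) f(2)
  proof eventually_elim
    case (elim t)
    have "(\<lambda>n. F (s n t) - F (f t)) \<longlonglongrightarrow> 0"
    proof (rule Lim_null_comparison)
      show "(\<lambda>n. c * N (s n t - f t)) \<longlonglongrightarrow> 0" by (rule tendsto_mult_right_zero[OF elim(1)])
      show "eventually (\<lambda>n. norm (F (s n t) - F (f t)) \<le> c * N (s n t - f t)) sequentially"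
        using F[OF simple_into_closed[OF s(1)] elim(2)] by simp
    qed
    then show ?case by (intro limI) (simp add: LIM_zero_iff)
  qed
  have m: "(\<lambda>t. lim (\<lambda>n. F (s n t))) \<in> borel_measurable (lebesgue_on {0<..<T})"
    by (rule borel_measurable_lim_metric) (rule simple_into_measurable[OF s(1)])
  show ?thesis by (rule borel_measurable_lebesgue_on_AE[OF _ m eq]) simp
qed

lemma Bochner_L2_N_measurable:
  "f \<in> Bochner_L2 T S N \<Longrightarrow> (\<lambda>t. N (f t)) \<in> borel_measurable (lebesgue_on {0<..<T})"
  by (rule strongly_measurable_functional[where c=1]) (auto simp: Bochner_L2_def reverse_triangle)

lemma Bochner_L2_add:
  assumes f: "f \<in> Bochner_L2 T S N" and g: "g \<in> Bochner_L2 T S N"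
  shows "(\<lambda>t x. f t x + g t x) \<in> Bochner_L2 T S N"
proof -
  have AE: "AE t in lebesgue_on {0<..<T}. f t \<in> S" "AE t in lebesgue_on {0<..<T}. g t \<in> S"
    using f g by (auto simp: Bochner_L2_def)
  then have AEs: "AE t in lebesgue_on {0<..<T}. (\<lambda>x. f t x + g t x) \<in> S"
    by eventually_elim (rule add_closed)
  obtain s where s: "\<And>n. simple_into T S (s n)"
    "AE t in lebesgue_on {0<..<T}. (\<lambda>n. N (s n t - f t)) \<longlonglongrightarrow> 0"
    using f unfolding Bochner_L2_def strongly_measurable_def by blast
  obtain r where r: "\<And>n. simple_into T S (r n)"
    "AE t in lebesgue_on {0<..<T}. (\<lambda>n. N (r n t - g t)) \<longlonglongrightarrow> 0"
    using g unfolding Bochner_L2_def strongly_measurable_def by blast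
  have "AE t in lebesgue_on {0<..<T}. (\<lambda>n. N ((\<lambda>x. s n t x + r n t x) - (\<lambda>x. f t x + g t x))) \<longlonglongrightarrow> 0"
    using s(2) r(2) AE
  proof eventually_elim
    case (elim t)
    note d = diff_closed[OF simple_into_closed[OF s(1)] elim(3)] diff_closed[OF simple_into_closed[OF r(1)] elim(4)]
    have e: "(\<lambda>x. s n t x + r n t x) - (\<lambda>x. f t x + g t x) = (\<lambda>x. (s n t - f t) x + (r n t - g t) x)" for n
      by (simp add: fun_diff_def algebra_simps)
    show ?case
    proof (rule tendsto_sandwich[OF _ _ tendsto_const])
      show "(\<lambda>n. N (s n t - f t) + N (r n t - g t)) \<longlonglongrightarrow> 0" using tendsto_add[OF elim(1,2)] by simp
      show "eventually (\<lambda>n. N ((\<lambda>x. s n t x + r n t x) - (\<lambda>x. f t x + g t x)) \<le> N (s n t - f t) + N (r n t - g t)) sequentially"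
        unfolding e using triangle[OF d] by simp
      show "eventually (\<lambda>n. 0 \<le> N ((\<lambda>x. s n t x + r n t x) - (\<lambda>x. f t x + g t x))) sequentially"
        unfolding e using N_nonneg[OF add_closed[OF d]] by simp
    qed
  qed
  then have sm: "strongly_measurable T S N (\<lambda>t x. f t x + g t x)"
    unfolding strongly_measurable_def using simple_into_add[OF s(1) r(1)]
    by (intro exI[of _ "\<lambda>n t x. s n t x + r n t x"]) auto
  have m: "(\<lambda>t. N (\<lambda>x. f t x + g t x)) \<in> borel_measurable (lebesgue_on {0<..<T})"
    by (rule strongly_measurable_functional[OF sm AEs, where c=1]) (simp add: reverse_triangle)
  have "integrable (lebesgue_on {0<..<T}) (\<lambda>t. (N (\<lambda>x. f t x + g t x))\<^sup>2)"
  proof (rule Bochner_Integration.integrable_bound)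
    show "integrable (lebesgue_on {0<..<T}) (\<lambda>t. 2 * (N (f t))\<^sup>2 + 2 * (N (g t))\<^sup>2)"
      using f g by (auto simp: Bochner_L2_def)
    show "AE t in lebesgue_on {0<..<T}. norm ((N (\<lambda>x. f t x + g t x))\<^sup>2) \<le> norm (2 * (N (f t))\<^sup>2 + 2 * (N (g t))\<^sup>2)"
      using AE
    proof eventually_elim
      case (elim t)
      have "(N (\<lambda>x. f t x + g t x))\<^sup>2 \<le> (N (f t) + N (g t))\<^sup>2"
        by (intro power_mono triangle N_nonneg add_closed elim)
      also have "\<dots> \<le> 2 * (N (f t))\<^sup>2 + 2 * (N (g t))\<^sup>2"
        using sum_squares_bound[of "N (f t)" "N (g t)"] by (simp add: power2_sum)
      finally show ?case by simp
    qed
  qed (use m in measurable)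
  with sm AEs show ?thesis by (simp add: Bochner_L2_def)
qed

lemma Bochner_L2_scaleR:
  assumes f: "f \<in> Bochner_L2 T S N"
  shows "(\<lambda>t x. c *\<^sub>R f t x) \<in> Bochner_L2 T S N"
proof -
  have AE: "AE t in lebesgue_on {0<..<T}. f t \<in> S"
    using f by (auto simp: Bochner_L2_def)
  then have AEs: "AE t in lebesgue_on {0<..<T}. (\<lambda>x. c *\<^sub>R f t x) \<in> S"
    by eventually_elim (rule scaleR_closed)
  obtain s where s: "\<And>n. simple_into T S (s n)"
    "AE t in lebesgue_on {0<..<T}. (\<lambda>n. N (s n t - f t)) \<longlonglongrightarrow> 0"
    using f unfolding Bochner_L2_def strongly_measurable_def by blast
  have "AE t in lebesgue_on {0<..<T}. (\<lambda>n. N ((\<lambda>x. c *\<^sub>R s n t x) - (\<lambda>x. c *\<^sub>R f t x))) \<longlonglongrightarrow> 0"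
    using s(2) AE
  proof eventually_elim
    case (elim t)
    have "N ((\<lambda>x. c *\<^sub>R s n t x) - (\<lambda>x. c *\<^sub>R f t x)) = \<bar>c\<bar> * N (s n t - f t)" for n
      using N_scaleR[OF diff_closed[OF simple_into_closed[OF s(1)] elim(2)]]
      by (simp add: fun_diff_def scaleR_diff_right)
    then show ?case using tendsto_mult_right_zero[OF elim(1)] by simp
  qed
  then have "strongly_measurable T S N (\<lambda>t x. c *\<^sub>R f t x)"
    unfolding strongly_measurable_def using simple_into_scaleR[OF s(1)]
    by (intro exI[of _ "\<lambda>n t x. c *\<^sub>R s n t x"]) auto
  moreover have "integrable (lebesgue_on {0<..<T}) (\<lambda>t. (N (\<lambda>x. c *\<^sub>R f t x))\<^sup>2)"
  proof (rule integrable_cong_AE_imp)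
    show "integrable (lebesgue_on {0<..<T}) (\<lambda>t. c\<^sup>2 * (N (f t))\<^sup>2)"
      using f by (simp add: Bochner_L2_def)
    show eq: "AE t in lebesgue_on {0<..<T}. c\<^sup>2 * (N (f t))\<^sup>2 = (N (\<lambda>x. c *\<^sub>R f t x))\<^sup>2"
      using AE by eventually_elim (simp add: N_scaleR power_mult_distrib)
    show "(\<lambda>t. (N (\<lambda>x. c *\<^sub>R f t x))\<^sup>2) \<in> borel_measurable (lebesgue_on {0<..<T})"
      by (rule borel_measurable_lebesgue_on_AE[OF _ _ eq]) (use Bochner_L2_N_measurable[OF f] in auto)
  qed
  ultimately show ?thesis using AEs by (simp add: Bochner_L2_def)
qed

text \<open>
  A scalar function of time is a pointwise limit of simple ones; each of them has finitely many values
  \<open>y\<close>, which turn into the vectors \<open>y *\<^sub>R v\<close> of a simple function with values in \<open>S\<close>.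
\<close>

lemma Bochner_L2_separated:
  fixes \<phi> :: "real \<Rightarrow> real"
  assumes \<phi>: "\<phi> \<in> borel_measurable borel" "\<And>t. \<bar>\<phi> t\<bar> \<le> B" and v: "v \<in> S"
  shows "(\<lambda>t x. \<phi> t *\<^sub>R v x) \<in> Bochner_L2 T S N"
proof -
  let ?I = "lebesgue_on {0<..<T}"
  have \<phi>m: "\<phi> \<in> borel_measurable ?I" using \<phi>(1) by (rule borel_measurable_lebesgue_on_borel)
  obtain s where s: "\<And>n. simple_function ?I (s n)" "\<And>t. t \<in> space ?I \<Longrightarrow> (\<lambda>n. s n t) \<longlonglongrightarrow> \<phi> t"
    using borel_measurable_implies_sequence_metric[OF \<phi>m, of 0] by blast
  \<comment> \<open>the values of \<open>s n\<close> outside the interval are unrestricted and may be infinitely many\<close>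
  define r where "r n t = indicat_real {0<..<T} t * s n t" for n t
  have simple: "simple_into T S (\<lambda>t x. r n t *\<^sub>R v x)" for n
  proof -
    have fin: "finite (s n ` {0<..<T})" using s(1)[of n] by (simp add: simple_function_def)
    then obtain h where h: "bij_betw h {0..<card (s n ` {0<..<T})} (s n ` {0<..<T})"
      using ex_bij_betw_nat_finite by blast
    let ?n = "card (s n ` {0<..<T})"
    show ?thesis
      unfolding simple_into_def
    proof (intro exI conjI allI impI)
      fix k
      show "s n -` {h k} \<inter> {0<..<T} \<in> sets ?I"
        using simple_functionD(2)[OF s(1)[of n], of "{h k}"] by simp
      show "(\<lambda>x. h k *\<^sub>R v x) \<in> S" by (rule scaleR_closed[OF v])
    next
      show "(\<lambda>t x. r n t *\<^sub>R v x) = (\<lambda>t x. \<Sum>k<?n. indicat_real (s n -` {h k} \<inter> {0<..<T}) t *\<^sub>R (h k *\<^sub>R v x))"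
      proof (intro ext)
        fix t x
        have "(\<Sum>k<?n. indicat_real (s n -` {h k} \<inter> {0<..<T}) t *\<^sub>R (h k *\<^sub>R v x))
            = (\<Sum>y\<in>s n ` {0<..<T}. indicat_real (s n -` {y} \<inter> {0<..<T}) t *\<^sub>R (y *\<^sub>R v x))"
          using sum.reindex_bij_betw[OF h, of "\<lambda>y. indicat_real (s n -` {y} \<inter> {0<..<T}) t *\<^sub>R (y *\<^sub>R v x)"]
          by (simp add: atLeast0LessThan)
        also have "\<dots> = r n t *\<^sub>R v x"
        proof (cases "t \<in> {0<..<T}")
          case True
          then have "(\<Sum>y\<in>s n ` {0<..<T}. indicat_real (s n -` {y} \<inter> {0<..<T}) t *\<^sub>R (y *\<^sub>R v x))
              = (\<Sum>y\<in>s n ` {0<..<T}. if y = s n t then y *\<^sub>R v x else 0)"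
            by (intro sum.cong refl) (auto simp: indicator_def)
          also have "\<dots> = s n t *\<^sub>R v x" using fin True by (subst sum.delta) auto
          finally show ?thesis using True by (simp add: r_def)
        qed (simp add: r_def)
        finally show "r n t *\<^sub>R v x = (\<Sum>k<?n. indicat_real (s n -` {h k} \<inter> {0<..<T}) t *\<^sub>R (h k *\<^sub>R v x))" by simp
      qed
    qed
  qed
  have "(\<lambda>n. N ((\<lambda>x. r n t *\<^sub>R v x) - (\<lambda>x. \<phi> t *\<^sub>R v x))) \<longlonglongrightarrow> 0" if "t \<in> space ?I" for t
  proof -
    have "N ((\<lambda>x. r n t *\<^sub>R v x) - (\<lambda>x. \<phi> t *\<^sub>R v x)) = \<bar>s n t - \<phi> t\<bar> * N v" for n
      using that N_scaleR[OF v, of "s n t - \<phi> t"] by (simp add: r_def fun_diff_def scaleR_diff_left)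
    moreover have "(\<lambda>n. \<bar>s n t - \<phi> t\<bar>) \<longlonglongrightarrow> 0"
      using tendsto_rabs[OF LIM_zero[OF s(2)[OF that]]] by simp
    ultimately show ?thesis using tendsto_mult_left_zero by simp
  qed
  then have "strongly_measurable T S N (\<lambda>t x. \<phi> t *\<^sub>R v x)"
    unfolding strongly_measurable_def using simple
    by (intro exI[of _ "\<lambda>n t x. r n t *\<^sub>R v x"]) auto
  moreover have "integrable ?I (\<lambda>t. (N (\<lambda>x. \<phi> t *\<^sub>R v x))\<^sup>2)"
    unfolding N_scaleR[OF v]
  proof (rule Bochner_Integration.integrable_bound)
    show "integrable ?I (\<lambda>t. B\<^sup>2 * (N v)\<^sup>2)"
      by (rule integrable_const_interval)
    show "(\<lambda>t. (\<bar>\<phi> t\<bar> * N v)\<^sup>2) \<in> borel_measurable ?I" using \<phi>m by measurable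
    show "AE t in ?I. norm ((\<bar>\<phi> t\<bar> * N v)\<^sup>2) \<le> norm (B\<^sup>2 * (N v)\<^sup>2)"
      using power_mono[OF \<phi>(2) abs_ge_zero, of _ 2] by (auto simp: power_mult_distrib intro!: mult_right_mono AE_I2)
  qed
  ultimately show ?thesis using scaleR_closed[OF v] by (simp add: Bochner_L2_def)
qed

lemma Bochner_L2_functional_integrable:
  fixes F :: "('a \<Rightarrow> 'b) \<Rightarrow> real"
  assumes f: "f \<in> Bochner_L2 T S N"
    and lin: "\<And>u v. u \<in> S \<Longrightarrow> v \<in> S \<Longrightarrow> F (u - v) = F u - F v"
    and bd: "\<And>u. u \<in> S \<Longrightarrow> \<bar>F u\<bar> \<le> c * N u"
  shows "integrable (lebesgue_on {0<..<T}) (\<lambda>t. F (f t))"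
proof (rule Bochner_Integration.integrable_bound)
  have AE: "AE t in lebesgue_on {0<..<T}. f t \<in> S" and sm: "strongly_measurable T S N f"
    using f by (auto simp: Bochner_L2_def)
  show "integrable (lebesgue_on {0<..<T}) (\<lambda>t. \<bar>c\<bar> * (1 + (N (f t))\<^sup>2))"
    using f by (intro integrable_mult_right Bochner_Integration.integrable_add integrable_const_interval)
      (simp add: Bochner_L2_def)
  show "(\<lambda>t. F (f t)) \<in> borel_measurable (lebesgue_on {0<..<T})"
    by (rule strongly_measurable_functional[OF sm AE, where c=c]) (metis bd diff_closed lin)
  show "AE t in lebesgue_on {0<..<T}. norm (F (f t)) \<le> norm (\<bar>c\<bar> * (1 + (N (f t))\<^sup>2))"
    using AE
  proof eventually_elim
    case (elim t)
    have "\<bar>F (f t)\<bar> \<le> \<bar>c\<bar> * N (f t)"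
      using bd[OF elim] mult_right_mono[OF abs_ge_self N_nonneg[OF elim], of c] by linarith
    also have "\<dots> \<le> \<bar>c\<bar> * (1 + (N (f t))\<^sup>2)"
      using sum_squares_bound[of "N (f t)" 1] N_nonneg[OF elim] by (intro mult_left_mono) auto
    finally show ?case by (simp add: abs_mult)
  qed
qed

end

lemma seminormed_L2: "seminormed_functions (L2 M) (L2_norm M)"
  by unfold_locales (auto simp: L2_zero L2_add L2_scaleR L2_norm_triangle L2_norm_scaleR)

lemma seminormed_H1:
  assumes "open S" "bounded S"
  shows "seminormed_functions (H1 S) (H1_norm S)"
proof -
  have "S \<in> sets lebesgue" using assms by auto
  then show ?thesis
    by unfold_locales (auto simp: H1_zero H1_add H1_scaleR H1_norm_triangle H1_norm_scaleR assms)
qed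

lemma Bochner_L2_mono:
  assumes "seminormed_functions S N" "seminormed_functions S' N'"
    and f: "f \<in> Bochner_L2 T S N" and sub: "S \<subseteq> S'" and le: "\<And>u. u \<in> S \<Longrightarrow> N' u \<le> N u"
  shows "f \<in> Bochner_L2 T S' N'"
proof -
  interpret A: seminormed_functions S N by fact
  interpret B: seminormed_functions S' N' by fact
  have AE: "AE t in lebesgue_on {0<..<T}. f t \<in> S"
    using f by (auto simp: Bochner_L2_def)
  then have AE': "AE t in lebesgue_on {0<..<T}. f t \<in> S'"
    by eventually_elim (use sub in auto)
  obtain s where s: "\<And>n. simple_into T S (s n)"
    "AE t in lebesgue_on {0<..<T}. (\<lambda>n. N (s n t - f t)) \<longlonglongrightarrow> 0"
    using f unfolding Bochner_L2_def strongly_measurable_def by blast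
  have "simple_into T S' (s n)" for n
    using s(1)[of n] sub unfolding simple_into_def by blast
  moreover have "AE t in lebesgue_on {0<..<T}. (\<lambda>n. N' (s n t - f t)) \<longlonglongrightarrow> 0"
    using s(2) AE
  proof eventually_elim
    case (elim t)
    note d = A.diff_closed[OF A.simple_into_closed[OF s(1)] elim(2)]
    show ?case
    proof (rule tendsto_sandwich[OF _ _ tendsto_const elim(1)])
      show "eventually (\<lambda>n. 0 \<le> N' (s n t - f t)) sequentially"
        using B.N_nonneg d sub by (auto intro!: always_eventually)
      show "eventually (\<lambda>n. N' (s n t - f t) \<le> N (s n t - f t)) sequentially"
        using le[OF d] by simp
    qed
  qed
  ultimately have sm: "strongly_measurable T S' N' f"
    unfolding strongly_measurable_def by blast
  have "integrable (lebesgue_on {0<..<T}) (\<lambda>t. (N' (f t))\<^sup>2)"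
  proof (rule Bochner_Integration.integrable_bound)
    show "integrable (lebesgue_on {0<..<T}) (\<lambda>t. (N (f t))\<^sup>2)" using f by (simp add: Bochner_L2_def)
    have "(\<lambda>t. N' (f t)) \<in> borel_measurable (lebesgue_on {0<..<T})"
      by (rule B.strongly_measurable_functional[OF sm AE', where c=1]) (simp add: B.reverse_triangle)
    then show "(\<lambda>t. (N' (f t))\<^sup>2) \<in> borel_measurable (lebesgue_on {0<..<T})" by measurable
    show "AE t in lebesgue_on {0<..<T}. norm ((N' (f t))\<^sup>2) \<le> norm ((N (f t))\<^sup>2)"
      using AE by eventually_elim (use le sub B.N_nonneg in \<open>auto intro!: power_mono\<close>)
  qed
  with sm AE' show ?thesis by (simp add: Bochner_L2_def)
qed

lemma
  fixes f g :: "'a::euclidean_space \<Rightarrow> real"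
  assumes "S \<in> sets lebesgue" "integrable (lebesgue_on S) f" "AE x in lebesgue_on S. f x = g x"
  shows integrable_lebesgue_on_AE: "integrable (lebesgue_on S) g"
    and integral_lebesgue_on_AE: "(\<integral>x. f x \<partial>lebesgue_on S) = (\<integral>x. g x \<partial>lebesgue_on S)"
proof -
  have g: "g \<in> borel_measurable (lebesgue_on S)"
    by (rule borel_measurable_lebesgue_on_AE[OF assms(1) borel_measurable_integrable[OF assms(2)] assms(3)])
  show "integrable (lebesgue_on S) g" by (rule integrable_cong_AE_imp[OF assms(2) g assms(3)])
  show "(\<integral>x. f x \<partial>lebesgue_on S) = (\<integral>x. g x \<partial>lebesgue_on S)"
    by (rule integral_cong_AE) (use assms g in auto)
qed

lemma test_functions_mult_integrable:
  assumes "k \<in> test_functions A" "integrable (lebesgue_on S) f"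
  shows "integrable (lebesgue_on S) (\<lambda>t. k t * f t :: real)"
proof -
  obtain B where B: "\<And>x. \<bar>k x\<bar> \<le> B" using test_functions_bounded[OF assms(1)] by blast
  have "k \<in> borel_measurable (lebesgue_on S)"
    by (intro borel_measurable_lebesgue_on_borel smooth_measurable test_functions_smooth[OF assms(1)])
  then show ?thesis
    using assms(2) by (intro Bochner_Integration.integrable_bound[OF integrable_mult_right[of B, OF assms(2)]])
      (auto simp: abs_mult intro!: mult_right_mono AE_I2 order_trans[OF B abs_ge_self])
qed

lemma test_functions_deriv:
  fixes \<phi> :: "real \<Rightarrow> real"
  assumes "\<phi> \<in> test_functions A"
  shows "deriv \<phi> \<in> test_functions A"
proof -
  have "deriv \<phi> = partial 1 \<phi>"
    using deriv_eq_partial[OF test_functions_smooth[OF assms]] by (rule ext)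
  then show ?thesis using test_functions_partial[OF assms, of 1] by simp
qed

text \<open>
  No boundary terms arise because one factor vanishes near 0 and \<open>T\<close>; the other one is
  arbitrary there, since the test functions that encode the initial velocity need not vanish at 0.
\<close>

lemma integral_by_parts_interval:
  fixes \<phi> \<theta> :: "real \<Rightarrow> real"
  assumes "\<phi> \<in> test_functions {0<..<T}" "smooth \<theta>"
  shows "(\<integral>t. deriv \<theta> t * \<phi> t \<partial>lebesgue_on {0<..<T}) = - (\<integral>t. \<theta> t * deriv \<phi> t \<partial>lebesgue_on {0<..<T})"
proof -
  have d: "deriv \<phi> \<in> test_functions {0<..<T}" by (rule test_functions_deriv[OF assms(1)])
  have [measurable]: "\<phi> \<in> borel_measurable borel" "deriv \<phi> \<in> borel_measurable borel"
    "\<theta> \<in> borel_measurable borel" "deriv \<theta> \<in> borel_measurable borel"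
  proof -
    have "deriv \<theta> = partial 1 \<theta>" using deriv_eq_partial[OF assms(2)] by (rule ext)
    then show "deriv \<theta> \<in> borel_measurable borel"
      using smooth_measurable[OF smooth_partial[OF assms(2), of 1]] by simp
  qed (use assms d test_functions_smooth smooth_measurable in blast)+
  have "(\<integral>t. deriv \<theta> t * \<phi> t \<partial>lebesgue_on {0<..<T}) = (LBINT t. deriv \<theta> t * \<phi> t)"
    by (rule integral_lebesgue_on_eq_lborel) (auto simp: test_functions_outside[OF assms(1)])
  moreover have "(\<integral>t. \<theta> t * deriv \<phi> t \<partial>lebesgue_on {0<..<T}) = (LBINT t. \<theta> t * deriv \<phi> t)"
    by (rule integral_lebesgue_on_eq_lborel) (auto simp: test_functions_outside[OF d])
  moreover have "(LBINT t. partial 1 \<phi> t * \<theta> t) = - (LBINT t. \<phi> t * partial 1 \<theta> t)"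
    by (rule integral_by_parts[OF assms]) simp
  ultimately show ?thesis
    using deriv_eq_partial[OF test_functions_smooth[OF assms(1)]] deriv_eq_partial[OF assms(2)]
    by (simp add: mult.commute)
qed

lemma L2_inner_linear:
  assumes "a \<in> L2 M" "b \<in> L2 M" "h \<in> L2 M"
  shows "L2_inner M (\<lambda>x. a x + c *\<^sub>R b x) h = L2_inner M a h + c * L2_inner M b h"
  using L2_inner_integrable[OF assms(1,3)] L2_inner_integrable[OF assms(2,3)]
  by (simp add: L2_inner_def inner_add_left)

lemma L2_inner_scaleR: "L2_inner M (\<lambda>x. c *\<^sub>R b x) h = c * L2_inner M b h"
  by (simp add: L2_inner_def)

text \<open>
  Moving a bounded mass density to the test field turns the kinetic term into a bounded functional of the velocity
  in the sense of \<open>Bochner_L2_inner_integrable\<close>.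
\<close>

lemma L2_inner_weight: "L2_inner M (\<lambda>x. \<rho> x *\<^sub>R a x) v = L2_inner M a (\<lambda>x. \<rho> x *\<^sub>R v x)"
  by (simp add: L2_inner_def)

lemma Bochner_L2_inner_integrable:
  assumes F: "F \<in> Bochner_L2 T (L2 M) (L2_norm M)" and h: "h \<in> L2 M"
  shows "integrable (lebesgue_on {0<..<T}) (\<lambda>t. L2_inner M (F t) h)"
proof -
  interpret seminormed_functions "L2 M" "L2_norm M" by (rule seminormed_L2)
  show ?thesis
  proof (rule Bochner_L2_functional_integrable[OF F, where c="L2_norm M h"])
    fix u v :: "'a \<Rightarrow> 'b" assume u: "u \<in> L2 M" and v: "v \<in> L2 M"
    show "L2_inner M (u - v) h = L2_inner M u h - L2_inner M v h"
      using L2_inner_linear[OF u v h, of "-1"] by (simp add: fun_diff_def)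
  next
    fix u :: "'a \<Rightarrow> 'b" assume u: "u \<in> L2 M"
    show "\<bar>L2_inner M u h\<bar> \<le> L2_norm M h * L2_norm M u"
      using L2_Cauchy_Schwarz[OF u h] by (simp add: mult.commute)
  qed
qed

lemma integral_L2_inner_linear:
  assumes F: "F \<in> Bochner_L2 T (L2 M) (L2_norm M)" and G: "G \<in> Bochner_L2 T (L2 M) (L2_norm M)"
    and h: "h \<in> L2 M" and k: "k \<in> test_functions A"
  shows "(\<integral>t. k t * L2_inner M (\<lambda>x. F t x + c *\<^sub>R G t x) h \<partial>lebesgue_on {0<..<T})
    = (\<integral>t. k t * L2_inner M (F t) h \<partial>lebesgue_on {0<..<T}) + c * (\<integral>t. k t * L2_inner M (G t) h \<partial>lebesgue_on {0<..<T})"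
proof -
  note iF = test_functions_mult_integrable[OF k Bochner_L2_inner_integrable[OF F h]]
    and iG = test_functions_mult_integrable[OF k Bochner_L2_inner_integrable[OF G h]]
  have AE: "AE t in lebesgue_on {0<..<T}. F t \<in> L2 M" "AE t in lebesgue_on {0<..<T}. G t \<in> L2 M"
    using F G by (auto simp: Bochner_L2_def)
  have "(\<integral>t. k t * L2_inner M (F t) h + c * (k t * L2_inner M (G t) h) \<partial>lebesgue_on {0<..<T})
      = (\<integral>t. k t * L2_inner M (\<lambda>x. F t x + c *\<^sub>R G t x) h \<partial>lebesgue_on {0<..<T})"
  proof (rule integral_lebesgue_on_AE)
    show "integrable (lebesgue_on {0<..<T}) (\<lambda>t. k t * L2_inner M (F t) h + c * (k t * L2_inner M (G t) h))"
      using iF iG by simp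
    show "AE t in lebesgue_on {0<..<T}. k t * L2_inner M (F t) h + c * (k t * L2_inner M (G t) h)
        = k t * L2_inner M (\<lambda>x. F t x + c *\<^sub>R G t x) h"
      using AE by eventually_elim (simp add: L2_inner_linear h distrib_left)
  qed simp
  then show ?thesis using iF iG by simp
qed

lemma Bochner_H1_L2:
  assumes "open S" "bounded S" "u \<in> Bochner_L2 T (H1 S) (H1_norm S)"
  shows "u \<in> Bochner_L2 T (L2 (lebesgue_on S)) (L2_norm (lebesgue_on S))"
  using assms by (intro Bochner_L2_mono[OF seminormed_H1 seminormed_L2])
    (auto intro: H1_L2 L2_norm_le_H1_norm)

section \<open>The elastic wave equation\<close>

lemma weak_grad_linear:
  assumes S: "open S" "bounded S" and u: "u \<in> H1 S" and w: "w \<in> H1 S"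
  shows "AE x in lebesgue_on S. weak_grad S (\<lambda>x. u x + c *\<^sub>R w x) x = weak_grad S u x + c *\<^sub>R weak_grad S w x"
proof -
  have Sl: "S \<in> sets lebesgue" using S by auto
  have "AE x in lebesgue_on S. \<forall>j\<in>UNIV. weak_deriv S (axis j 1) (\<lambda>x. u x + c *\<^sub>R w x) x
      = weak_deriv S (axis j 1) u x + c *\<^sub>R weak_deriv S (axis j 1) w x"
  proof (rule AE_finite_allI)
    fix j :: 3
    have j: "axis j (1::real) \<in> Basis" by simp
    show "AE x in lebesgue_on S. weak_deriv S (axis j 1) (\<lambda>x. u x + c *\<^sub>R w x) x
      = weak_deriv S (axis j 1) u x + c *\<^sub>R weak_deriv S (axis j 1) w x"
      using weak_deriv_add[OF S u H1_scaleR[OF Sl w, of c] j] weak_deriv_scaleR[OF S w j, of c]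
      by eventually_elim simp
  qed simp
  then show ?thesis by eventually_elim (simp add: weak_grad_def vec_eq_iff)
qed

lemma elastic_density_linear:
  assumes S: "open S" "bounded S" and u: "u \<in> H1 S" and w: "w \<in> H1 S"
  shows "AE x in lebesgue_on S. elastic_density S C (\<lambda>x. u x + c *\<^sub>R w x) v x
    = elastic_density S C u v x + c * elastic_density S C w v x"
  using weak_grad_linear[OF assms, of c]
proof eventually_elim
  case (elim x)
  have s: "strain S (\<lambda>x. u x + c *\<^sub>R w x) x = strain S u x + c *\<^sub>R strain S w x"
    unfolding strain_def elim by (simp add: vec_eq_iff transpose_def algebra_simps)
  have d: "ddot (C x) (A + c *\<^sub>R B) = ddot (C x) A + c *\<^sub>R ddot (C x) B" for A B
    by (simp add: ddot_def vec_eq_iff sum.distrib sum_distrib_left algebra_simps)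
  show ?case unfolding elastic_density_def s d by (simp add: inner_add_left)
qed

lemma elastic_form_linear:
  assumes S: "open S" "bounded S" and u: "u \<in> H1 S" and w: "w \<in> H1 S"
    and iu: "integrable (lebesgue_on S) (elastic_density S C u v)"
    and iw: "integrable (lebesgue_on S) (elastic_density S C w v)"
  shows "integrable (lebesgue_on S) (elastic_density S C (\<lambda>x. u x + c *\<^sub>R w x) v)"
    and "elastic_form S C (\<lambda>x. u x + c *\<^sub>R w x) v = elastic_form S C u v + c * elastic_form S C w v"
proof -
  have Sl: "S \<in> sets lebesgue" using S by auto
  have i: "integrable (lebesgue_on S) (\<lambda>x. elastic_density S C u v x + c * elastic_density S C w v x)"
    using iu iw by simp
  have eq: "AE x in lebesgue_on S. elastic_density S C u v x + c * elastic_density S C w v x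
      = elastic_density S C (\<lambda>x. u x + c *\<^sub>R w x) v x"
    using elastic_density_linear[OF S u w, of C c v] by eventually_elim simp
  show "integrable (lebesgue_on S) (elastic_density S C (\<lambda>x. u x + c *\<^sub>R w x) v)"
    by (rule integrable_lebesgue_on_AE[OF Sl i eq])
  show "elastic_form S C (\<lambda>x. u x + c *\<^sub>R w x) v = elastic_form S C u v + c * elastic_form S C w v"
    unfolding elastic_form_def integral_lebesgue_on_AE[OF Sl i eq, symmetric] using iu iw by simp
qed

text \<open>
  All terms of the weak formulation are linear up to null sets of times and points. The proof has to establish
  that every integral exists before it is split.
\<close>

proposition weak_solution_superposition:
  assumes S: "open \<Omega>" "bounded \<Omega>"
    and \<rho>: "\<rho> \<in> borel_measurable (lebesgue_on \<Omega>)" "AE x in lebesgue_on \<Omega>. \<bar>\<rho> x\<bar> \<le> R"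
    and f: "f \<in> Bochner_L2 T (L2 (lebesgue_on \<Omega>)) (L2_norm (lebesgue_on \<Omega>))"
    and g: "g \<in> Bochner_L2 T (L2 (lebesgue_on \<Omega>)) (L2_norm (lebesgue_on \<Omega>))"
    and u: "weak_solution T \<Omega> C \<rho> u0 u1 f u"
    and w: "weak_solution T \<Omega> C \<rho> (\<lambda>x. 0) (\<lambda>x. 0) g w"
  shows "weak_solution T \<Omega> C \<rho> u0 u1 (\<lambda>t x. f t x + c *\<^sub>R g t x) (\<lambda>t x. u t x + c *\<^sub>R w t x)"
proof -
  let ?M = "lebesgue_on \<Omega>" and ?I = "lebesgue_on {0<..<T}"
  interpret H: seminormed_functions "H1 \<Omega> :: (real^3 \<Rightarrow> real^3) set" "H1_norm \<Omega>"
    by (rule seminormed_H1[OF S])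
  interpret L: seminormed_functions "L2 ?M :: (real^3 \<Rightarrow> real^3) set" "L2_norm ?M" by (rule seminormed_L2)
  have Sl: "\<Omega> \<in> sets lebesgue" using S by auto
  from u obtain u' where uB: "u \<in> Bochner_L2 T (H1 \<Omega>) (H1_norm \<Omega>)" and uinit: "has_initial_value T \<Omega> u u0"
    and u': "u' \<in> Bochner_L2 T (L2 ?M) (L2_norm ?M)" "has_time_deriv T \<Omega> u u'"
    and uweak: "\<And>v. v \<in> H1 \<Omega> \<Longrightarrow> (AE t in ?I. integrable ?M (elastic_density \<Omega> C (u t) v)) \<and>
      integrable ?I (\<lambda>t. elastic_form \<Omega> C (u t) v) \<and>
      (\<forall>\<phi>\<in>test_functions {..<T}.
        - (\<integral>t. deriv \<phi> t * L2_inner ?M (\<lambda>x. \<rho> x *\<^sub>R u' t x) v \<partial>?I) + (\<integral>t. \<phi> t * elastic_form \<Omega> C (u t) v \<partial>?I)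
          = (\<integral>t. \<phi> t * L2_inner ?M (f t) v \<partial>?I) + \<phi> 0 * L2_inner ?M (\<lambda>x. \<rho> x *\<^sub>R u1 x) v)"
    unfolding weak_solution_def by blast
  from w obtain w' where wB: "w \<in> Bochner_L2 T (H1 \<Omega>) (H1_norm \<Omega>)" and winit: "has_initial_value T \<Omega> w (\<lambda>x. 0)"
    and w': "w' \<in> Bochner_L2 T (L2 ?M) (L2_norm ?M)" "has_time_deriv T \<Omega> w w'"
    and wweak: "\<And>v. v \<in> H1 \<Omega> \<Longrightarrow> (AE t in ?I. integrable ?M (elastic_density \<Omega> C (w t) v)) \<and>
      integrable ?I (\<lambda>t. elastic_form \<Omega> C (w t) v) \<and>
      (\<forall>\<phi>\<in>test_functions {..<T}.
        - (\<integral>t. deriv \<phi> t * L2_inner ?M (\<lambda>x. \<rho> x *\<^sub>R w' t x) v \<partial>?I) + (\<integral>t. \<phi> t * elastic_form \<Omega> C (w t) v \<partial>?I)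
          = (\<integral>t. \<phi> t * L2_inner ?M (g t) v \<partial>?I) + \<phi> 0 * L2_inner ?M (\<lambda>x. \<rho> x *\<^sub>R 0) v)"
    unfolding weak_solution_def by blast
  note uL = Bochner_H1_L2[OF S uB] and wL = Bochner_H1_L2[OF S wB]
  show ?thesis
    unfolding weak_solution_def
  proof (intro conjI bexI[of _ "\<lambda>t x. u' t x + c *\<^sub>R w' t x"] ballI)
    show "(\<lambda>t x. u t x + c *\<^sub>R w t x) \<in> Bochner_L2 T (H1 \<Omega>) (H1_norm \<Omega>)"
      by (intro H.Bochner_L2_add H.Bochner_L2_scaleR uB wB)
    show "(\<lambda>t x. u' t x + c *\<^sub>R w' t x) \<in> Bochner_L2 T (L2 ?M) (L2_norm ?M)"
      by (intro L.Bochner_L2_add L.Bochner_L2_scaleR u' w')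
    show "has_initial_value T \<Omega> (\<lambda>t x. u t x + c *\<^sub>R w t x) u0"
    proof -
      obtain U where U: "\<forall>t\<in>{0..T}. U t \<in> L2 ?M"
        "\<forall>s\<in>{0..T}. ((\<lambda>t. L2_norm ?M (U t - U s)) \<longlongrightarrow> 0) (at s within {0..T})"
        "AE t in ?I. AE x in ?M. U t x = u t x" "AE x in ?M. U 0 x = u0 x"
        using uinit unfolding has_initial_value_def by blast
      obtain W where W: "\<forall>t\<in>{0..T}. W t \<in> L2 ?M"
        "\<forall>s\<in>{0..T}. ((\<lambda>t. L2_norm ?M (W t - W s)) \<longlongrightarrow> 0) (at s within {0..T})"
        "AE t in ?I. AE x in ?M. W t x = w t x" "AE x in ?M. W 0 x = 0"
        using winit unfolding has_initial_value_def by blast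
      show ?thesis
        unfolding has_initial_value_def
      proof (intro exI[of _ "\<lambda>t x. U t x + c *\<^sub>R W t x"] conjI ballI)
        show "(\<lambda>x. U t x + c *\<^sub>R W t x) \<in> L2 ?M" if "t \<in> {0..T}" for t
          using U(1) W(1) that by (intro L2_add L2_scaleR) auto
        show "AE t in ?I. AE x in ?M. U t x + c *\<^sub>R W t x = u t x + c *\<^sub>R w t x"
          using U(3) W(3)
        proof eventually_elim
          case (elim t)
          show ?case using elim by eventually_elim simp
        qed
        show "AE x in ?M. U 0 x + c *\<^sub>R W 0 x = u0 x"
          using U(4) W(4) by eventually_elim simp
        show "((\<lambda>t. L2_norm ?M ((\<lambda>x. U t x + c *\<^sub>R W t x) - (\<lambda>x. U s x + c *\<^sub>R W s x))) \<longlongrightarrow> 0) (at s within {0..T})"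
          if s: "s \<in> {0..T}" for s
        proof (rule tendsto_sandwich[OF _ _ tendsto_const])
          show "((\<lambda>t. L2_norm ?M (U t - U s) + \<bar>c\<bar> * L2_norm ?M (W t - W s)) \<longlongrightarrow> 0) (at s within {0..T})"
            using tendsto_add[OF U(2)[rule_format, OF s] tendsto_mult_right_zero[OF W(2)[rule_format, OF s]]] by simp
          show "\<forall>\<^sub>F t in at s within {0..T}. 0 \<le> L2_norm ?M ((\<lambda>x. U t x + c *\<^sub>R W t x) - (\<lambda>x. U s x + c *\<^sub>R W s x))"
            by (simp add: L2_norm_nonneg)
          have "L2_norm ?M ((\<lambda>x. U t x + c *\<^sub>R W t x) - (\<lambda>x. U s x + c *\<^sub>R W s x))
              \<le> L2_norm ?M (U t - U s) + \<bar>c\<bar> * L2_norm ?M (W t - W s)" if t: "t \<in> {0..T}" for t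
          proof -
            have dU: "U t - U s \<in> L2 ?M" and dW: "W t - W s \<in> L2 ?M"
              using U(1) W(1) s t by (auto intro!: L.diff_closed)
            have "(\<lambda>x. U t x + c *\<^sub>R W t x) - (\<lambda>x. U s x + c *\<^sub>R W s x)
                = (\<lambda>x. (U t - U s) x + c *\<^sub>R (W t - W s) x)"
              by (simp add: fun_diff_def algebra_simps)
            then show ?thesis
              using L2_norm_triangle[OF dU L2_scaleR[OF dW, of c]] L2_norm_scaleR[of ?M c "W t - W s"] by simp
          qed
          then show "\<forall>\<^sub>F t in at s within {0..T}. L2_norm ?M ((\<lambda>x. U t x + c *\<^sub>R W t x) - (\<lambda>x. U s x + c *\<^sub>R W s x))
              \<le> L2_norm ?M (U t - U s) + \<bar>c\<bar> * L2_norm ?M (W t - W s)"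
            by (auto simp: eventually_at_filter)
        qed
      qed
    qed
    show "has_time_deriv T \<Omega> (\<lambda>t x. u t x + c *\<^sub>R w t x) (\<lambda>t x. u' t x + c *\<^sub>R w' t x)"
      unfolding has_time_deriv_def
    proof (intro ballI)
      fix \<phi> and h :: "real^3 \<Rightarrow> real^3" assume \<phi>: "\<phi> \<in> test_functions {0<..<T}" and h: "h \<in> L2 ?M"
      show "(\<integral>t. deriv \<phi> t * L2_inner ?M (\<lambda>x. u t x + c *\<^sub>R w t x) h \<partial>?I)
          = - (\<integral>t. \<phi> t * L2_inner ?M (\<lambda>x. u' t x + c *\<^sub>R w' t x) h \<partial>?I)"
        unfolding integral_L2_inner_linear[OF uL wL h test_functions_deriv[OF \<phi>]]
          integral_L2_inner_linear[OF u'(1) w'(1) h \<phi>]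
        using u'(2) w'(2) \<phi> h by (simp add: has_time_deriv_def)
    qed
    fix v :: "real^3 \<Rightarrow> real^3" assume v: "v \<in> H1 \<Omega>"
    have uA: "AE t in ?I. u t \<in> H1 \<Omega>" and wA: "AE t in ?I. w t \<in> H1 \<Omega>"
      using uB wB by (auto simp: Bochner_L2_def)
    note uv = uweak[OF v] and wv = wweak[OF v]
    show "AE t in ?I. integrable ?M (elastic_density \<Omega> C (\<lambda>x. u t x + c *\<^sub>R w t x) v)"
      using uA wA uv[THEN conjunct1] wv[THEN conjunct1]
      by eventually_elim (rule elastic_form_linear(1)[OF S])
    have form: "AE t in ?I. elastic_form \<Omega> C (u t) v + c * elastic_form \<Omega> C (w t) v
        = elastic_form \<Omega> C (\<lambda>x. u t x + c *\<^sub>R w t x) v"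
      using uA wA uv[THEN conjunct1] wv[THEN conjunct1]
      by eventually_elim (simp add: elastic_form_linear(2)[OF S])
    have iu: "integrable ?I (\<lambda>t. elastic_form \<Omega> C (u t) v)" and iw: "integrable ?I (\<lambda>t. elastic_form \<Omega> C (w t) v)"
      using uv wv by auto
    show "integrable ?I (\<lambda>t. elastic_form \<Omega> C (\<lambda>x. u t x + c *\<^sub>R w t x) v)"
      by (rule integrable_lebesgue_on_AE[OF _ _ form]) (use iu iw in auto)
    fix \<phi> :: "real \<Rightarrow> real" assume \<phi>: "\<phi> \<in> test_functions {..<T}"
    note i = test_functions_mult_integrable[OF \<phi> iu] test_functions_mult_integrable[OF \<phi> iw]
    have "(\<integral>t. \<phi> t * elastic_form \<Omega> C (u t) v + c * (\<phi> t * elastic_form \<Omega> C (w t) v) \<partial>?I)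
        = (\<integral>t. \<phi> t * elastic_form \<Omega> C (\<lambda>x. u t x + c *\<^sub>R w t x) v \<partial>?I)"
    proof (rule integral_lebesgue_on_AE)
      show "AE t in ?I. \<phi> t * elastic_form \<Omega> C (u t) v + c * (\<phi> t * elastic_form \<Omega> C (w t) v)
          = \<phi> t * elastic_form \<Omega> C (\<lambda>x. u t x + c *\<^sub>R w t x) v"
        using form
      proof eventually_elim
        case (elim t)
        show ?case unfolding elim[symmetric] by (simp add: algebra_simps)
      qed
    qed (use i in auto)
    then have eform: "(\<integral>t. \<phi> t * elastic_form \<Omega> C (\<lambda>x. u t x + c *\<^sub>R w t x) v \<partial>?I)
        = (\<integral>t. \<phi> t * elastic_form \<Omega> C (u t) v \<partial>?I) + c * (\<integral>t. \<phi> t * elastic_form \<Omega> C (w t) v \<partial>?I)"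
      using i by simp
    have \<rho>v: "(\<lambda>x. \<rho> x *\<^sub>R v x) \<in> L2 ?M" by (rule L2_mult_bounded[OF H1_L2[OF v] \<rho>])
    have kin: "(\<integral>t. deriv \<phi> t * L2_inner ?M (\<lambda>x. \<rho> x *\<^sub>R (u' t x + c *\<^sub>R w' t x)) v \<partial>?I)
        = (\<integral>t. deriv \<phi> t * L2_inner ?M (\<lambda>x. \<rho> x *\<^sub>R u' t x) v \<partial>?I)
          + c * (\<integral>t. deriv \<phi> t * L2_inner ?M (\<lambda>x. \<rho> x *\<^sub>R w' t x) v \<partial>?I)"
      unfolding L2_inner_weight
      by (rule integral_L2_inner_linear[OF u'(1) w'(1) \<rho>v test_functions_deriv[OF \<phi>]])
    have "L2_inner ?M (\<lambda>x. \<rho> x *\<^sub>R 0) v = 0" by (simp add: L2_inner_def)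
    then show "- (\<integral>t. deriv \<phi> t * L2_inner ?M (\<lambda>x. \<rho> x *\<^sub>R (u' t x + c *\<^sub>R w' t x)) v \<partial>?I)
        + (\<integral>t. \<phi> t * elastic_form \<Omega> C (\<lambda>x. u t x + c *\<^sub>R w t x) v \<partial>?I)
        = (\<integral>t. \<phi> t * L2_inner ?M (\<lambda>x. f t x + c *\<^sub>R g t x) v \<partial>?I) + \<phi> 0 * L2_inner ?M (\<lambda>x. \<rho> x *\<^sub>R u1 x) v"
      unfolding kin eform integral_L2_inner_linear[OF f g H1_L2[OF v] \<phi>]
      using uv[THEN conjunct2, THEN conjunct2, rule_format, OF \<phi>] wv[THEN conjunct2, THEN conjunct2, rule_format, OF \<phi>]
      by (simp add: algebra_simps)
  qed
qed

lemma has_weak_deriv_test_function: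
  assumes S: "S \<in> sets borel" and \<psi>: "\<psi> \<in> test_functions S" and i: "i \<in> Basis"
  shows "has_weak_deriv S i (\<lambda>x. \<psi> x *\<^sub>R e) (\<lambda>x. partial i \<psi> x *\<^sub>R (e :: 'b::euclidean_space))"
proof (rule has_weak_derivI)
  fix \<phi> assume \<phi>: "\<phi> \<in> test_functions S"
  have Sl: "S \<in> sets lebesgue" using S by simp
  note t = test_functions_partial[OF \<phi> i] test_functions_partial[OF \<psi> i]
  have [measurable]: "\<phi> \<in> borel_measurable borel" "\<psi> \<in> borel_measurable borel"
    "partial i \<phi> \<in> borel_measurable borel" "partial i \<psi> \<in> borel_measurable borel"
    using \<phi> \<psi> t test_functions_smooth smooth_measurable by blast+
  have "(LBINT x. partial i \<phi> x * \<psi> x) = - (LBINT x. \<phi> x * partial i \<psi> x)"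
    by (rule integral_by_parts[OF \<phi> test_functions_smooth[OF \<psi>] i])
  moreover have "(\<integral>x. partial i \<phi> x * \<psi> x \<partial>lebesgue_on S) = (LBINT x. partial i \<phi> x * \<psi> x)"
    by (rule integral_lebesgue_on_eq_lborel[OF S]) (auto simp: test_functions_outside[OF \<psi>])
  moreover have "(\<integral>x. \<phi> x * partial i \<psi> x \<partial>lebesgue_on S) = (LBINT x. \<phi> x * partial i \<psi> x)"
    by (rule integral_lebesgue_on_eq_lborel[OF S]) (auto simp: test_functions_outside[OF \<phi>])
  ultimately have "(\<integral>x. partial i \<phi> x * \<psi> x \<partial>lebesgue_on S) *\<^sub>R e = - (\<integral>x. \<phi> x * partial i \<psi> x \<partial>lebesgue_on S) *\<^sub>R e"
    by simp
  moreover have "integrable (lebesgue_on S) (\<lambda>x. partial i \<phi> x * \<psi> x)" "integrable (lebesgue_on S) (\<lambda>x. \<phi> x * partial i \<psi> x)"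
    by (intro L2_mult_integrable test_functions_L2[OF t(1) Sl] test_functions_L2[OF \<psi> Sl],
        intro L2_mult_integrable test_functions_L2[OF t(2) Sl] test_functions_L2[OF \<phi> Sl])
  ultimately show "(\<integral>x. partial i \<phi> x *\<^sub>R \<psi> x *\<^sub>R e \<partial>lebesgue_on S) = - (\<integral>x. \<phi> x *\<^sub>R partial i \<psi> x *\<^sub>R e \<partial>lebesgue_on S)"
    by simp
qed

lemma test_function_H1:
  assumes S: "S \<in> sets borel" and \<psi>: "\<psi> \<in> test_functions S"
  shows "(\<lambda>x. \<psi> x *\<^sub>R e) \<in> H1 S"
proof -
  have Sl: "S \<in> sets lebesgue" using S by simp
  show ?thesis
    unfolding H1_def
  proof (intro CollectI conjI ballI)
    show "(\<lambda>x. \<psi> x *\<^sub>R e) \<in> L2 (lebesgue_on S)" by (intro L2_scaleR_const test_functions_L2[OF \<psi> Sl])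
    fix i :: 'a assume i: "i \<in> Basis"
    show "\<exists>g\<in>L2 (lebesgue_on S). has_weak_deriv S i (\<lambda>x. \<psi> x *\<^sub>R e) g"
      using has_weak_deriv_test_function[OF S \<psi> i, of e]
        L2_scaleR_const[OF test_functions_L2[OF test_functions_partial[OF \<psi> i] Sl], of e] by blast
  qed
qed

text \<open>
  \<open>Q\<close> plays the role of \<open>- \<nabla>\<cdot>(C:\<epsilon>(W))\<close> together with the traction-free boundary condition, expressed
  by testing with all of \<open>H\<^sup>1\<close>. Since \<open>\<phi>\<close> vanishes near 0, the initial data are 0, and the wave equation for
  \<open>\<phi>(t) W\<close> reduces to one integration by parts in time.
\<close>

proposition weak_solution_separated:
  fixes W Q :: "real^3 \<Rightarrow> real^3"
  assumes S: "open \<Omega>" "bounded \<Omega>"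
    and \<rho>: "\<rho> \<in> borel_measurable (lebesgue_on \<Omega>)" "AE x in lebesgue_on \<Omega>. \<bar>\<rho> x\<bar> \<le> R"
    and W: "W \<in> H1 \<Omega>" and Q: "Q \<in> L2 (lebesgue_on \<Omega>)"
    and WQ: "\<And>v. v \<in> H1 \<Omega> \<Longrightarrow> integrable (lebesgue_on \<Omega>) (elastic_density \<Omega> C W v) \<and>
      elastic_form \<Omega> C W v = L2_inner (lebesgue_on \<Omega>) Q v"
    and \<phi>: "\<phi> \<in> test_functions {0<..<T}"
  defines "g \<equiv> \<lambda>t x. deriv (deriv \<phi>) t *\<^sub>R (\<rho> x *\<^sub>R W x) + \<phi> t *\<^sub>R Q x"
  shows "g \<in> Bochner_L2 T (L2 (lebesgue_on \<Omega>)) (L2_norm (lebesgue_on \<Omega>))"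
    and "weak_solution T \<Omega> C \<rho> (\<lambda>x. 0) (\<lambda>x. 0) g (\<lambda>t x. \<phi> t *\<^sub>R W x)"
proof -
  let ?M = "lebesgue_on \<Omega>" and ?I = "lebesgue_on {0<..<T}"
  interpret H: seminormed_functions "H1 \<Omega> :: (real^3 \<Rightarrow> real^3) set" "H1_norm \<Omega>"
    by (rule seminormed_H1[OF S])
  interpret L: seminormed_functions "L2 ?M :: (real^3 \<Rightarrow> real^3) set" "L2_norm ?M" by (rule seminormed_L2)
  have Sl: "\<Omega> \<in> sets lebesgue" using S by auto
  have \<phi>': "deriv \<phi> \<in> test_functions {0<..<T}" and \<phi>'': "deriv (deriv \<phi>) \<in> test_functions {0<..<T}"
    using \<phi> by (auto intro: test_functions_deriv)
  have WL: "W \<in> L2 ?M" using W by (rule H1_L2)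
  have \<rho>W: "(\<lambda>x. \<rho> x *\<^sub>R W x) \<in> L2 ?M" by (rule L2_mult_bounded[OF WL \<rho>])
  have sepL: "(\<lambda>t x. k t *\<^sub>R V x) \<in> Bochner_L2 T (L2 ?M) (L2_norm ?M)"
    if k: "k \<in> test_functions {0<..<T}" and V: "V \<in> L2 ?M" for k and V :: "real^3 \<Rightarrow> real^3"
    using test_functions_bounded[OF k] L.Bochner_L2_separated[OF smooth_measurable[OF test_functions_smooth[OF k]] _ V] by metis
  have sepH: "(\<lambda>t x. \<phi> t *\<^sub>R W x) \<in> Bochner_L2 T (H1 \<Omega>) (H1_norm \<Omega>)"
    using test_functions_bounded[OF \<phi>] H.Bochner_L2_separated[OF smooth_measurable[OF test_functions_smooth[OF \<phi>]] _ W] by metis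
  show gB: "g \<in> Bochner_L2 T (L2 ?M) (L2_norm ?M)"
    unfolding g_def by (intro L.Bochner_L2_add sepL \<phi> \<phi>'' \<rho>W Q)
  have form: "integrable ?M (elastic_density \<Omega> C (\<lambda>x. s *\<^sub>R W x) v)"
    "elastic_form \<Omega> C (\<lambda>x. s *\<^sub>R W x) v = s * L2_inner ?M Q v" if v: "v \<in> H1 \<Omega>" for s v
    \<comment> \<open>\<open>s *\<^sub>R W\<close> is written as \<open>W + (s - 1) *\<^sub>R W\<close>\<close>
    using elastic_form_linear[OF S W W conjunct1[OF WQ[OF v]] conjunct1[OF WQ[OF v]], of "s - 1"] WQ[OF v]
    by (simp_all add: algebra_simps)
  show "weak_solution T \<Omega> C \<rho> (\<lambda>x. 0) (\<lambda>x. 0) g (\<lambda>t x. \<phi> t *\<^sub>R W x)"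
    unfolding weak_solution_def
  proof (intro conjI bexI[of _ "\<lambda>t x. deriv \<phi> t *\<^sub>R W x"] ballI)
    show "(\<lambda>t x. \<phi> t *\<^sub>R W x) \<in> Bochner_L2 T (H1 \<Omega>) (H1_norm \<Omega>)" by (rule sepH)
    show "(\<lambda>t x. deriv \<phi> t *\<^sub>R W x) \<in> Bochner_L2 T (L2 ?M) (L2_norm ?M)" by (rule sepL[OF \<phi>' WL])
    show "has_initial_value T \<Omega> (\<lambda>t x. \<phi> t *\<^sub>R W x) (\<lambda>x. 0)"
      unfolding has_initial_value_def
    proof (intro exI[of _ "\<lambda>t x. \<phi> t *\<^sub>R W x"] conjI ballI)
      show "(\<lambda>x. \<phi> t *\<^sub>R W x) \<in> L2 ?M" for t by (rule L2_scaleR[OF WL])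
      show "AE x in ?M. \<phi> 0 *\<^sub>R W x = 0" using test_functions_outside[OF \<phi>, of 0] by simp
      show "((\<lambda>t. L2_norm ?M ((\<lambda>x. \<phi> t *\<^sub>R W x) - (\<lambda>x. \<phi> s *\<^sub>R W x))) \<longlongrightarrow> 0) (at s within {0..T})" for s
      proof -
        have "L2_norm ?M ((\<lambda>x. \<phi> t *\<^sub>R W x) - (\<lambda>x. \<phi> s *\<^sub>R W x)) = \<bar>\<phi> t - \<phi> s\<bar> * L2_norm ?M W" for t
          using L2_norm_scaleR[of ?M "\<phi> t - \<phi> s" W] by (simp add: fun_diff_def scaleR_diff_left)
        moreover have "(\<phi> \<longlongrightarrow> \<phi> s) (at s within {0..T})"
          using smooth_continuous[OF test_functions_smooth[OF \<phi>], of UNIV]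
          by (meson UNIV_I continuous_on_eq_continuous_within continuous_within tendsto_within_subset top_greatest)
        then have "((\<lambda>t. \<bar>\<phi> t - \<phi> s\<bar> * L2_norm ?M W) \<longlongrightarrow> 0) (at s within {0..T})"
          by (intro tendsto_mult_left_zero tendsto_rabs_zero LIM_zero)
        ultimately show ?thesis by simp
      qed
    qed auto
    show "has_time_deriv T \<Omega> (\<lambda>t x. \<phi> t *\<^sub>R W x) (\<lambda>t x. deriv \<phi> t *\<^sub>R W x)"
      unfolding has_time_deriv_def
    proof (intro ballI)
      fix \<theta> and h :: "real^3 \<Rightarrow> real^3" assume \<theta>: "\<theta> \<in> test_functions {0<..<T}"
      show "(\<integral>t. deriv \<theta> t * L2_inner ?M (\<lambda>x. \<phi> t *\<^sub>R W x) h \<partial>?I)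
          = - (\<integral>t. \<theta> t * L2_inner ?M (\<lambda>x. deriv \<phi> t *\<^sub>R W x) h \<partial>?I)"
        using integral_by_parts_interval[OF \<phi> test_functions_smooth[OF \<theta>]]
        by (simp add: L2_inner_scaleR mult.assoc[symmetric])
    qed
    fix v :: "real^3 \<Rightarrow> real^3" assume v: "v \<in> H1 \<Omega>"
    have vL: "v \<in> L2 ?M" using v by (rule H1_L2)
    show "AE t in ?I. integrable ?M (elastic_density \<Omega> C (\<lambda>x. \<phi> t *\<^sub>R W x) v)"
      using form(1)[OF v] by simp
    have i1: "integrable ?I (\<lambda>t. k t * 1)" if "k \<in> test_functions A" for k A
      by (rule test_functions_mult_integrable[OF that integrable_const_interval])
    show "integrable ?I (\<lambda>t. elastic_form \<Omega> C (\<lambda>x. \<phi> t *\<^sub>R W x) v)"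
      using i1[OF \<phi>] by (simp add: form(2)[OF v])
    fix \<theta> :: "real \<Rightarrow> real" assume \<theta>: "\<theta> \<in> test_functions {..<T}"
    let ?A = "L2_inner ?M (\<lambda>x. \<rho> x *\<^sub>R W x) v" and ?B = "L2_inner ?M Q v"
    have i2: "integrable ?I (\<lambda>t. \<theta> t * deriv (deriv \<phi>) t)" "integrable ?I (\<lambda>t. \<theta> t * \<phi> t)"
      using test_functions_mult_integrable[OF \<theta>] i1[OF \<phi>] i1[OF \<phi>''] by auto
    have kin: "(\<integral>t. deriv \<theta> t * L2_inner ?M (\<lambda>x. \<rho> x *\<^sub>R deriv \<phi> t *\<^sub>R W x) v \<partial>?I)
        = - (\<integral>t. \<theta> t * deriv (deriv \<phi>) t \<partial>?I) * ?A"
    proof -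
      have "L2_inner ?M (\<lambda>x. \<rho> x *\<^sub>R deriv \<phi> t *\<^sub>R W x) v = deriv \<phi> t * ?A" for t
        using L2_inner_scaleR[of ?M "deriv \<phi> t" "\<lambda>x. \<rho> x *\<^sub>R W x" v] by (simp add: mult.commute)
      then show ?thesis
        using integral_by_parts_interval[OF \<phi>' test_functions_smooth[OF \<theta>]]
        by (simp add: mult.assoc[symmetric])
    qed
    have rhs: "L2_inner ?M (g t) v = deriv (deriv \<phi>) t * ?A + \<phi> t * ?B" for t
      unfolding g_def L2_inner_linear[OF L2_scaleR[OF \<rho>W] Q vL] L2_inner_scaleR ..
    have "(\<integral>t. \<theta> t * L2_inner ?M (g t) v \<partial>?I)
        = (\<integral>t. (\<theta> t * deriv (deriv \<phi>) t) * ?A + (\<theta> t * \<phi> t) * ?B \<partial>?I)"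
      by (simp add: rhs algebra_simps)
    also have "\<dots> = (\<integral>t. \<theta> t * deriv (deriv \<phi>) t \<partial>?I) * ?A + (\<integral>t. \<theta> t * \<phi> t \<partial>?I) * ?B"
      using i2 by simp
    finally show "- (\<integral>t. deriv \<theta> t * L2_inner ?M (\<lambda>x. \<rho> x *\<^sub>R deriv \<phi> t *\<^sub>R W x) v \<partial>?I)
        + (\<integral>t. \<theta> t * elastic_form \<Omega> C (\<lambda>x. \<phi> t *\<^sub>R W x) v \<partial>?I)
        = (\<integral>t. \<theta> t * L2_inner ?M (g t) v \<partial>?I) + \<theta> 0 * L2_inner ?M (\<lambda>x. \<rho> x *\<^sub>R 0) v"
      unfolding kin by (simp add: form(2)[OF v] L2_inner_def mult.assoc[symmetric])
  qed
qed

text \<open>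
  The strain of \<open>\<psi> e\<close> has the test functions \<open>\<eta> k l\<close> as its entries, so each summand
  \<open>C\<^sub>i\<^sub>j\<^sub>k\<^sub>l \<eta>\<^sub>k\<^sub>l \<partial>\<^sub>jv\<^sub>i\<close> of the elastic energy can be integrated by parts. The resulting
  \<open>q i j k l = \<partial>\<^sub>j(C\<^sub>i\<^sub>j\<^sub>k\<^sub>l \<eta>\<^sub>k\<^sub>l)\<close> are the summands of the divergence of the stress.
\<close>

lemma elastic_force_exists:
  fixes C :: "real^3 \<Rightarrow> real^3^3^3^3" and e :: "real^3"
  assumes S: "open \<Omega>" "bounded \<Omega>" and C: "C \<in> H1 \<Omega>" and \<psi>: "\<psi> \<in> test_functions \<Omega>"
  obtains Q where "Q \<in> L2 (lebesgue_on \<Omega>)"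
    "\<And>v. v \<in> H1 \<Omega> \<Longrightarrow> integrable (lebesgue_on \<Omega>) (elastic_density \<Omega> C (\<lambda>x. \<psi> x *\<^sub>R e) v) \<and>
      elastic_form \<Omega> C (\<lambda>x. \<psi> x *\<^sub>R e) v = L2_inner (lebesgue_on \<Omega>) Q v"
proof -
  let ?M = "lebesgue_on \<Omega>" and ?W = "\<lambda>x. \<psi> x *\<^sub>R e"
  have Sb: "\<Omega> \<in> sets borel" and Sl: "\<Omega> \<in> sets lebesgue" using S by auto
  have W: "?W \<in> H1 \<Omega>" by (rule test_function_H1[OF Sb \<psi>])
  have ax: "axis j (1::real) \<in> Basis" for j :: 3 by simp
  define d where "d j = partial (axis j (1::real)) \<psi>" for j :: 3
  have d: "d j \<in> test_functions \<Omega>" for j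
    unfolding d_def by (rule test_functions_partial[OF \<psi> ax])
  define \<eta> where "\<eta> k l x = d l x * (e $ k / 2) + d k x * (e $ l / 2)" for k l x
  have \<eta>: "\<eta> k l \<in> test_functions \<Omega>" for k l
    unfolding \<eta>_def[abs_def] by (intro test_functions_add test_functions_mult d smooth_const)
  \<comment> \<open>unit tensors: the inner product with them extracts components, to which the scalar lemmas apply\<close>
  define b :: "3 \<Rightarrow> 3 \<Rightarrow> 3 \<Rightarrow> 3 \<Rightarrow> real^3^3^3^3" where
    "b i j k l = axis i (axis j (axis k (axis l 1)))" for i j k l
  have b: "X \<bullet> b i j k l = X $ i $ j $ k $ l" for X i j k l by (simp add: b_def inner_axis)
  define c where "c i j k l x = C x \<bullet> b i j k l" for i j k l x
  define c' where "c' i j k l x = weak_deriv \<Omega> (axis j 1) C x \<bullet> b i j k l" for i j k l x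
  have c: "c i j k l \<in> L2 ?M" "c' i j k l \<in> L2 ?M" "has_weak_deriv \<Omega> (axis j 1) (c i j k l) (c' i j k l)" for i j k l
    unfolding c_def[abs_def] c'_def[abs_def]
    by (intro L2_inner_const H1_L2[OF C] weak_deriv_H1(1)[OF C ax]
        has_weak_deriv_component[OF Sl ax H1_L2[OF C] weak_deriv_H1[OF C ax]])+
  define q where "q i j k l x = c' i j k l x * \<eta> k l x + c i j k l x * partial (axis j 1) (\<eta> k l) x" for i j k l x
  have times: "(\<lambda>x. f x * \<theta> x) \<in> L2 ?M" if f: "f \<in> L2 ?M" and \<theta>: "\<theta> \<in> test_functions \<Omega>" for f \<theta> :: "real^3 \<Rightarrow> real"
  proof -
    obtain B where B: "\<And>x. \<bar>\<theta> x\<bar> \<le> B" using test_functions_bounded[OF \<theta>] by blast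
    have "(\<lambda>x. \<theta> x *\<^sub>R f x) \<in> L2 ?M"
      by (rule L2_mult_bounded[OF f L2_measurable[OF test_functions_L2[OF \<theta> Sl]], where B=B]) (simp add: B)
    then show ?thesis by (simp add: mult.commute)
  qed
  have q: "q i j k l \<in> L2 ?M" for i j k l
    unfolding q_def[abs_def] by (intro L2_add times c \<eta> test_functions_partial ax)
  define Q :: "real^3 \<Rightarrow> real^3" where
    "Q x = (\<Sum>i\<in>UNIV. \<Sum>j\<in>UNIV. \<Sum>k\<in>UNIV. \<Sum>l\<in>UNIV. q i j k l x *\<^sub>R (- axis i 1))" for x
  have Q: "Q \<in> L2 ?M"
    unfolding Q_def[abs_def] by (intro L2_sum L2_scaleR_const q)
  have strain: "AE x in ?M. \<forall>k l. strain \<Omega> ?W x $ k $ l = \<eta> k l x"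
  proof -
    have "AE x in ?M. \<forall>j\<in>UNIV. weak_deriv \<Omega> (axis j 1) ?W x = d j x *\<^sub>R e"
    proof (rule AE_finite_allI)
      fix j :: 3
      show "AE x in ?M. weak_deriv \<Omega> (axis j 1) ?W x = d j x *\<^sub>R e"
        unfolding d_def
        by (intro weak_deriv_eqI[OF S W ax] L2_scaleR_const test_functions_L2[OF _ Sl, of _ \<Omega>]
            test_functions_partial[OF \<psi> ax] has_weak_deriv_test_function[OF Sb \<psi> ax])
    qed simp
    then show ?thesis
      by eventually_elim (simp add: strain_def weak_grad_def transpose_def \<eta>_def algebra_simps)
  qed
  show thesis
  proof (rule that[OF Q])
    fix v :: "real^3 \<Rightarrow> real^3" assume v: "v \<in> H1 \<Omega>"
    define D where "D i j x = weak_deriv \<Omega> (axis j 1) v x \<bullet> axis i 1" for i j x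
    have D: "D i j \<in> L2 ?M" "has_weak_deriv \<Omega> (axis j 1) (\<lambda>x. v x \<bullet> axis i 1) (D i j)" for i j
      unfolding D_def[abs_def]
      by (intro L2_inner_const weak_deriv_H1(1)[OF v ax]
          has_weak_deriv_component[OF Sl ax H1_L2[OF v] weak_deriv_H1[OF v ax]])+
    have vi: "(\<lambda>x. v x \<bullet> axis i 1) \<in> L2 ?M" for i by (intro L2_inner_const H1_L2[OF v])
    have parts: "(\<integral>x. c i j k l x * \<eta> k l x * D i j x \<partial>?M) = - (\<integral>x. q i j k l x * (v x \<bullet> axis i 1) \<partial>?M)" for i j k l
      unfolding q_def
      by (rule weak_deriv_integration_by_parts[OF S ax c vi D \<eta>])
    have i1: "integrable ?M (\<lambda>x. c i j k l x * \<eta> k l x * D i j x)" for i j k l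
      by (intro L2_mult_integrable times c \<eta> D)
    have i2: "integrable ?M (\<lambda>x. q i j k l x * (v x \<bullet> axis i 1))" for i j k l
      by (intro L2_mult_integrable q vi)
    have int: "integrable ?M (\<lambda>x. \<Sum>i\<in>UNIV. \<Sum>j\<in>UNIV. \<Sum>k\<in>UNIV. \<Sum>l\<in>UNIV. c i j k l x * \<eta> k l x * D i j x)"
      by (intro Bochner_Integration.integrable_sum i1)
    have dens: "AE x in ?M. (\<Sum>i\<in>UNIV. \<Sum>j\<in>UNIV. \<Sum>k\<in>UNIV. \<Sum>l\<in>UNIV. c i j k l x * \<eta> k l x * D i j x)
        = elastic_density \<Omega> C ?W v x"
      using strain
    proof eventually_elim
      case (elim x)
      have "elastic_density \<Omega> C ?W v x
          = (\<Sum>i\<in>UNIV. \<Sum>j\<in>UNIV. (\<Sum>k\<in>UNIV. \<Sum>l\<in>UNIV. C x $ i $ j $ k $ l * \<eta> k l x) * weak_deriv \<Omega> (axis j 1) v x $ i)"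
        by (simp add: elastic_density_def inner_vec_def ddot_def elim weak_grad_def)
      then show ?case
        by (simp add: c_def b D_def inner_axis sum_distrib_right)
    qed
    have "elastic_form \<Omega> C ?W v
        = (\<integral>x. (\<Sum>i\<in>UNIV. \<Sum>j\<in>UNIV. \<Sum>k\<in>UNIV. \<Sum>l\<in>UNIV. c i j k l x * \<eta> k l x * D i j x) \<partial>?M)"
      unfolding elastic_form_def by (rule integral_lebesgue_on_AE[OF Sl int dens, symmetric])
    also have "\<dots> = (\<Sum>i\<in>UNIV. \<Sum>j\<in>UNIV. \<Sum>k\<in>UNIV. \<Sum>l\<in>UNIV. - (\<integral>x. q i j k l x * (v x \<bullet> axis i 1) \<partial>?M))"
      using i1 by (simp add: Bochner_Integration.integral_sum Bochner_Integration.integrable_sum parts)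
    also have "\<dots> = (\<integral>x. (\<Sum>i\<in>UNIV. \<Sum>j\<in>UNIV. \<Sum>k\<in>UNIV. \<Sum>l\<in>UNIV. - (q i j k l x * (v x \<bullet> axis i 1))) \<partial>?M)"
      using i2 by (simp add: Bochner_Integration.integral_sum Bochner_Integration.integrable_sum)
    also have "\<dots> = L2_inner ?M Q v"
      unfolding L2_inner_def Q_def
      by (intro Bochner_Integration.integral_cong refl)  (simp add: inner_sum_left inner_axis inner_axis')
    finally have "elastic_form \<Omega> C ?W v = L2_inner ?M Q v" .
    with integrable_lebesgue_on_AE[OF Sl int dens]
    show "integrable ?M (elastic_density \<Omega> C ?W v) \<and> elastic_form \<Omega> C ?W v = L2_inner ?M Q v" by simp
  qed
qed

section \<open>Traces and interior perturbations\<close>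

lemma smooth_borel_lebesgue_on: "smooth f \<Longrightarrow> f \<in> borel_measurable (lebesgue_on S)"
  by (intro borel_measurable_lebesgue_on_borel smooth_measurable)

lemma has_trace_cong_AE:
  fixes u w :: "real^3 \<Rightarrow> 'b::euclidean_space"
  assumes S: "\<Omega> \<in> sets lebesgue" and eq: "AE x in lebesgue_on \<Omega>. u x = w x" and tr: "has_trace \<Omega> u g"
  shows "has_trace \<Omega> w g"
proof -
  from tr obtain v where u: "u \<in> H1 \<Omega>" and g: "g \<in> L2 (surface_measure \<Omega>)"
    and v: "\<And>n::nat. smooth (v n)" "(\<lambda>n. H1_norm \<Omega> (v n - u)) \<longlonglongrightarrow> 0"
      "(\<lambda>n. L2_norm (surface_measure \<Omega>) (v n - g)) \<longlonglongrightarrow> 0"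
    unfolding has_trace_def by blast
  have "H1_norm \<Omega> (v n - u) = H1_norm \<Omega> (v n - w)" for n
  proof (rule H1_norm_cong_AE[OF S])
    show "v n - u \<in> borel_measurable (lebesgue_on \<Omega>)"
      using smooth_borel_lebesgue_on[OF v(1)] L2_measurable[OF H1_L2[OF u]] by (simp add: fun_diff_def)
    show "AE x in lebesgue_on \<Omega>. (v n - u) x = (v n - w) x"
      using eq by eventually_elim simp
  qed
  then show ?thesis
    unfolding has_trace_def using H1_cong_AE[OF S u eq] g v by (auto intro!: exI[of _ v])
qed

text \<open>
  Adding \<open>w\<close> to the approximating smooth functions changes neither the distance to the perturbed function
  in \<open>H\<^sup>1\<close> nor the boundary values.
\<close>

lemma has_trace_add_interior:
  fixes u w :: "real^3 \<Rightarrow> 'b::euclidean_space"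
  assumes S: "\<Omega> \<in> sets lebesgue" and w: "smooth w" "w \<in> H1 \<Omega>" "\<And>x. x \<in> frontier \<Omega> \<Longrightarrow> w x = 0"
    and tr: "has_trace \<Omega> u g"
  shows "has_trace \<Omega> (\<lambda>x. u x + w x) g"
proof -
  from tr obtain v where u: "u \<in> H1 \<Omega>" and g: "g \<in> L2 (surface_measure \<Omega>)"
    and v: "\<And>n::nat. smooth (v n)" "(\<lambda>n. H1_norm \<Omega> (v n - u)) \<longlonglongrightarrow> 0"
      "(\<lambda>n. L2_norm (surface_measure \<Omega>) (v n - g)) \<longlonglongrightarrow> 0"
    unfolding has_trace_def by blast
  have H: "(\<lambda>x. v n x + w x) - (\<lambda>x. u x + w x) = v n - u" for n by (simp add: fun_diff_def)
  have B: "L2_norm (surface_measure \<Omega>) ((\<lambda>x. v n x + w x) - g) = L2_norm (surface_measure \<Omega>) (v n - g)" for n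
    unfolding L2_norm_def
    by (intro arg_cong[where f=sqrt] Bochner_Integration.integral_cong refl)
      (simp add: surface_measure_def space_restrict_space w(3))
  show ?thesis
    unfolding has_trace_def
  proof (intro conjI exI[of _ "\<lambda>n x. v n x + w x"] allI)
    show "(\<lambda>x. u x + w x) \<in> H1 \<Omega>" by (rule H1_add[OF S u w(2)])
    show "smooth (\<lambda>x. v n x + w x)" for n by (rule smooth_add[OF v(1) w(1)])
  qed (use g v H B in auto)
qed

text \<open>
  The trace is chosen by a condition that is unaffected by null sets and interior perturbations, so the chosen
  functions coincide.
\<close>

lemma trace_on_add_interior:
  fixes u u' w :: "real^3 \<Rightarrow> 'b::euclidean_space"
  assumes S: "\<Omega> \<in> sets lebesgue" and w: "smooth w" "w \<in> H1 \<Omega>" "\<And>x. x \<in> frontier \<Omega> \<Longrightarrow> w x = 0"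
    and eq: "AE x in lebesgue_on \<Omega>. u' x = u x + w x"
  shows "trace_on \<Omega> u' = trace_on \<Omega> u"
proof -
  have "has_trace \<Omega> u' g \<longleftrightarrow> has_trace \<Omega> u g" for g
  proof
    have eq': "AE x in lebesgue_on \<Omega>. u x + w x = u' x" using eq by eventually_elim simp
    show "has_trace \<Omega> u g \<Longrightarrow> has_trace \<Omega> u' g"
      by (rule has_trace_cong_AE[OF S eq' has_trace_add_interior[OF S w]])
    assume "has_trace \<Omega> u' g"
    then have "has_trace \<Omega> (\<lambda>x. u' x + (-1) *\<^sub>R w x) g"
      using w by (intro has_trace_add_interior[OF S] smooth_scaleR smooth_const H1_scaleR[OF S]) auto
    then show "has_trace \<Omega> u g"
      by (rule has_trace_cong_AE[OF S, rotated]) (use eq in eventually_elim, simp)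
  qed
  then have "has_trace \<Omega> u' = has_trace \<Omega> u" by (rule ext)
  then show ?thesis by (simp add: trace_on_def)
qed

section \<open>Ill-posedness\<close>

text \<open>
  The load enters the weak formulation only through its inner products with fixed fields.
\<close>

lemma weak_solution_rhs_cong_AE:
  assumes f: "f \<in> Bochner_L2 T (L2 (lebesgue_on \<Omega>)) (L2_norm (lebesgue_on \<Omega>))"
    and eq: "AE t in lebesgue_on {0<..<T}. AE x in lebesgue_on \<Omega>. f t x = f' t x"
    and f': "f' \<in> Bochner_L2 T (L2 (lebesgue_on \<Omega>)) (L2_norm (lebesgue_on \<Omega>))"
    and u: "weak_solution T \<Omega> C \<rho> u0 u1 f u"
  shows "weak_solution T \<Omega> C \<rho> u0 u1 f' u"
proof -
  have "(\<integral>t. \<phi> t * L2_inner (lebesgue_on \<Omega>) (f t) v \<partial>lebesgue_on {0<..<T})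
      = (\<integral>t. \<phi> t * L2_inner (lebesgue_on \<Omega>) (f' t) v \<partial>lebesgue_on {0<..<T})"
    if v: "v \<in> H1 \<Omega>" and \<phi>: "\<phi> \<in> test_functions {..<T}" for v \<phi>
  proof (rule integral_lebesgue_on_AE)
    show "integrable (lebesgue_on {0<..<T}) (\<lambda>t. \<phi> t * L2_inner (lebesgue_on \<Omega>) (f t) v)"
      by (rule test_functions_mult_integrable[OF \<phi> Bochner_L2_inner_integrable[OF f H1_L2[OF v]]])
    have AE: "AE t in lebesgue_on {0<..<T}. f t \<in> L2 (lebesgue_on \<Omega>)" "AE t in lebesgue_on {0<..<T}. f' t \<in> L2 (lebesgue_on \<Omega>)"
      using f f' by (auto simp: Bochner_L2_def)
    show "AE t in lebesgue_on {0<..<T}. \<phi> t * L2_inner (lebesgue_on \<Omega>) (f t) v = \<phi> t * L2_inner (lebesgue_on \<Omega>) (f' t) v"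
      using eq AE
    proof eventually_elim
      case (elim t)
      have "L2_inner (lebesgue_on \<Omega>) (f t) v = L2_inner (lebesgue_on \<Omega>) (f' t) v"
        unfolding L2_inner_def
      proof (rule integral_cong_AE)
        show "AE x in lebesgue_on \<Omega>. f t x \<bullet> v x = f' t x \<bullet> v x"
          using elim(1) by eventually_elim simp
      qed (intro borel_measurable_integrable L2_inner_integrable elim H1_L2[OF v])+
      then show ?case by simp
    qed
  qed simp
  then show ?thesis using u unfolding weak_solution_def by simp
qed

lemma AE_lebesgue_on_imp_ex_in_ball:
  assumes "AE x in lebesgue_on S. P x" "r > 0" "ball c r \<subseteq> S" "S \<in> sets lebesgue"
  shows "\<exists>x\<in>ball c r. P x"
proof (rule ccontr)
  assume no: "\<not> ?thesis"
  have "AE x in lebesgue. x \<in> S \<longrightarrow> P x" using assms(1,4) by (simp add: AE_restrict_space_iff)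
  then have "AE x in lebesgue. x \<notin> ball c r"
    by eventually_elim (use no assms(3) in auto)
  then have "ball c r \<in> null_sets lebesgue" by (subst AE_iff_null_sets) auto
  then show False using content_ball_pos[OF assms(2), of c] by (auto simp: measure_def null_sets_def)
qed

theorem corollary3p7:
  fixes T :: real
    and \<Omega> :: "(real^3) set"
    and C :: "real^3 \<Rightarrow> real^3^3^3^3"
    and \<rho> :: "real^3 \<Rightarrow> real"
    and \<rho>_min \<rho>_max \<alpha> :: real
    and u0 u1 :: "real^3 \<Rightarrow> real^3"
    and sensor :: "'J::finite \<Rightarrow> real^3 \<Rightarrow> real^3"
    and X :: "(real \<Rightarrow> real^3 \<Rightarrow> real^3) set"
    and Y :: "(real \<Rightarrow> real^'J) set"
  defines "X \<equiv> Bochner_L2 T (L2 (lebesgue_on \<Omega>)) (L2_norm (lebesgue_on \<Omega>))"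
    and "Y \<equiv> L2 (lebesgue_on {0<..<T})"
  assumes T: "T > 0"
    and domain: "bounded_Lipschitz_domain \<Omega>"
    and C_H1: "C \<in> H1 \<Omega>"
    and \<alpha>: "\<alpha> > 0"
    and C_elliptic: "AE x in lebesgue_on \<Omega>. \<forall>A :: real^3^3. A \<bullet> ddot (C x) A \<ge> \<alpha> * (norm A)\<^sup>2"
    and \<rho>_measurable: "\<rho> \<in> borel_measurable (lebesgue_on \<Omega>)"
    and \<rho>_min: "\<rho>_min > 0"
    and \<rho>_bounds: "AE x in lebesgue_on \<Omega>. \<rho>_min < \<rho> x \<and> \<rho> x < \<rho>_max"
    and u0: "u0 \<in> H1 \<Omega>"
    and u1: "u1 \<in> L2 (lebesgue_on \<Omega>)"
    and sensors: "\<And>j. sensor j \<in> H_half_boundary \<Omega>"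
    and existence: "\<And>f. f \<in> X \<Longrightarrow> \<exists>u. weak_solution T \<Omega> C \<rho> u0 u1 f u"
    and uniqueness: "\<And>f u v. f \<in> X \<Longrightarrow> weak_solution T \<Omega> C \<rho> u0 u1 f u \<Longrightarrow>
      weak_solution T \<Omega> C \<rho> u0 u1 f v \<Longrightarrow>
      AE t in lebesgue_on {0<..<T}. AE x in lebesgue_on \<Omega>. u t x = v t x"
  shows "\<forall>f\<in>X. uniformly_ill_posed_at
           X (Bochner_L2_norm T (L2_norm (lebesgue_on \<Omega>)))
           Y (L2_norm (lebesgue_on {0<..<T}))
           X (load_monitoring T \<Omega> C \<rho> u0 u1 sensor) f"
proof
  let ?M = "lebesgue_on \<Omega>" and ?I = "lebesgue_on {0<..<T}" and ?W = "weak_solution T \<Omega> C \<rho>"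
    and ?SO = "solution_operator T \<Omega> C \<rho> u0 u1" and ?F = "load_monitoring T \<Omega> C \<rho> u0 u1 sensor"
  let ?NX = "Bochner_L2_norm T (L2_norm ?M) :: (real \<Rightarrow> real^3 \<Rightarrow> real^3) \<Rightarrow> real"
  interpret L: seminormed_functions "L2 ?M :: (real^3 \<Rightarrow> real^3) set" "L2_norm ?M" by (rule seminormed_L2)
  have S: "open \<Omega>" "bounded \<Omega>" and ne: "\<Omega> \<noteq> {}"
    using domain by (auto simp: bounded_Lipschitz_domain_def)
  have Sb: "\<Omega> \<in> sets borel" and Sl: "\<Omega> \<in> sets lebesgue" using S by auto
  have \<rho>_abs: "AE x in ?M. \<bar>\<rho> x\<bar> \<le> \<rho>_max"
    using \<rho>_bounds by eventually_elim (use \<rho>_min in auto)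
  obtain x0 r where r: "r > 0" "cball x0 r \<subseteq> \<Omega>"
    using ne S(1) by (meson all_not_in_conv open_contains_cball)
  define \<psi> where "\<psi> = bump x0 r"
  define e :: "real^3" where "e = axis 1 1"
  define \<phi> where "\<phi> = bump (T / 2) (T / 3)"
  define W where "W x = \<psi> x *\<^sub>R e" for x
  have \<psi>: "\<psi> \<in> test_functions \<Omega>" unfolding \<psi>_def by (rule bump_test_function[OF r])
  have \<phi>: "\<phi> \<in> test_functions {0<..<T}"
    unfolding \<phi>_def using T by (intro bump_test_function) (auto simp: cball_eq_atLeastAtMost)
  have time_ball: "ball (T / 2) (T / 3) \<subseteq> {0<..<T}"
    using T by (auto simp: ball_eq_greaterThanLessThan)
  have WH: "W \<in> H1 \<Omega>" unfolding W_def[abs_def] by (rule test_function_H1[OF Sb \<psi>])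
  have Wsm: "smooth W"
    unfolding W_def[abs_def] by (intro smooth_scaleR smooth_const test_functions_smooth[OF \<psi>])
  obtain Q where Q: "Q \<in> L2 ?M" "\<And>v. v \<in> H1 \<Omega> \<Longrightarrow> integrable ?M (elastic_density \<Omega> C W v) \<and>
      elastic_form \<Omega> C W v = L2_inner ?M Q v"
    using elastic_force_exists[OF S C_H1 \<psi>, of e] unfolding W_def[abs_def] by metis
  define g where "g t x = deriv (deriv \<phi>) t *\<^sub>R (\<rho> x *\<^sub>R W x) + \<phi> t *\<^sub>R Q x" for t x
  have gX: "g \<in> X" and gsol: "?W (\<lambda>x. 0) (\<lambda>x. 0) g (\<lambda>t x. \<phi> t *\<^sub>R W x)"
    using weak_solution_separated[OF S \<rho>_measurable \<rho>_abs WH Q \<phi>] unfolding g_def[abs_def] X_def by auto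
  fix f assume f: "f \<in> X"
  have sol: "?W u0 u1 h (?SO h)" if "h \<in> X" for h
    unfolding solution_operator_def by (rule someI_ex[OF existence[OF that]])
  have fgX: "(\<lambda>t x. f t x + c *\<^sub>R g t x) \<in> X" for c
    using f gX unfolding X_def by (intro L.Bochner_L2_add L.Bochner_L2_scaleR)
  have shifted: "?W u0 u1 (\<lambda>t x. f t x + c *\<^sub>R g t x) (\<lambda>t x. ?SO f t x + c *\<^sub>R \<phi> t *\<^sub>R W x)" for c
    by (rule weak_solution_superposition[OF S \<rho>_measurable \<rho>_abs f[unfolded X_def] gX[unfolded X_def] sol[OF f] gsol])
  define G where "G = ?NX g"
  have gN: "integrable ?I (\<lambda>t. (L2_norm ?M (g t))\<^sup>2)" and gL: "AE t in ?I. g t \<in> L2 ?M"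
    using gX by (auto simp: X_def Bochner_L2_def)
  \<comment> \<open>a vanishing \<open>g\<close> would give the load \<open>f\<close> a second solution, shifted by the motion \<open>\<phi> W\<close>\<close>
  have "G \<noteq> 0"
  proof
    assume "G = 0"
    then have "(\<integral>t. (L2_norm ?M (g t))\<^sup>2 \<partial>?I) = 0" by (simp add: G_def Bochner_L2_norm_def)
    then have "AE t in ?I. (L2_norm ?M (g t))\<^sup>2 = 0"
      using integral_nonneg_eq_0_iff_AE[OF gN] by simp
    then have g0: "AE t in ?I. AE x in ?M. g t x = 0"
      using gL by eventually_elim (simp add: L2_norm_eq_0_iff)
    have "?W u0 u1 f (\<lambda>t x. ?SO f t x + 1 *\<^sub>R \<phi> t *\<^sub>R W x)"
    proof (rule weak_solution_rhs_cong_AE[OF _ _ _ shifted])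
      show "AE t in ?I. AE x in ?M. f t x + 1 *\<^sub>R g t x = f t x"
        using g0
      proof eventually_elim
        case (elim t)
        then show ?case by eventually_elim simp
      qed
    qed (use f fgX[of 1] in \<open>auto simp: X_def\<close>)
    from uniqueness[OF f sol[OF f] this]
    have "AE t in ?I. AE x in ?M. ?SO f t x = ?SO f t x + 1 *\<^sub>R \<phi> t *\<^sub>R W x" .
    from AE_lebesgue_on_imp_ex_in_ball[OF this, of "T / 3" "T / 2"] T time_ball
    obtain t where t: "t \<in> ball (T / 2) (T / 3)" "AE x in ?M. ?SO f t x = ?SO f t x + 1 *\<^sub>R \<phi> t *\<^sub>R W x"
      by auto
    from AE_lebesgue_on_imp_ex_in_ball[OF t(2) r(1) _ Sl] r(2)
    obtain x where x: "x \<in> ball x0 r" "\<phi> t *\<^sub>R W x = 0"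
      using ball_subset_cball by fastforce
    moreover have "\<phi> t > 0" unfolding \<phi>_def using t(1) T bump_pos_iff[of "T / 3" "T / 2" t] by simp
    moreover have "\<psi> x > 0" unfolding \<psi>_def using x(1) r(1) bump_pos_iff by blast
    ultimately show False by (simp add: W_def e_def)
  qed
  moreover have "G \<ge> 0" by (simp add: G_def Bochner_L2_norm_def)
  ultimately have G: "G > 0" by simp
  have image: "AE t in ?I. (?F (\<lambda>t x. f t x + c *\<^sub>R g t x) - ?F f) t = 0" for c
    using uniqueness[OF fgX[of c] sol[OF fgX] shifted]
  proof eventually_elim
    case (elim t)
    have "trace_on \<Omega> (?SO (\<lambda>t x. f t x + c *\<^sub>R g t x) t) = trace_on \<Omega> (?SO f t)"
    proof (rule trace_on_add_interior[OF Sl])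
      show "smooth (\<lambda>x. (c * \<phi> t) *\<^sub>R W x)" by (intro smooth_scaleR smooth_const Wsm)
      show "(\<lambda>x. (c * \<phi> t) *\<^sub>R W x) \<in> H1 \<Omega>" by (rule H1_scaleR[OF Sl WH])
      show "(c * \<phi> t) *\<^sub>R W x = 0" if "x \<in> frontier \<Omega>" for x
      proof -
        have "x \<notin> \<Omega>" using that S(1) by (simp add: frontier_def interior_open)
        then show ?thesis using test_functions_outside[OF \<psi>] by (simp add: W_def)
      qed
      show "AE x in ?M. ?SO (\<lambda>t x. f t x + c *\<^sub>R g t x) t x = ?SO f t x + (c * \<phi> t) *\<^sub>R W x"
        using elim by eventually_elim simp
    qed
    then show ?case by (simp add: load_monitoring_def)
  qed
  show "uniformly_ill_posed_at X ?NX Y (L2_norm ?I) X ?F f"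
    unfolding uniformly_ill_posed_at_def
  proof (intro allI impI)
    fix R :: real assume R: "R > 0"
    define c where "c = R / 2 / G"
    define \<theta> where "\<theta> t x = f t x + c *\<^sub>R g t x" for t x
    have \<theta>X: "\<theta> \<in> X" using fgX[of c] unfolding \<theta>_def[abs_def] .
    have c: "c > 0" using R G by (simp add: c_def)
    have N\<theta>: "?NX (\<theta> - f) = R / 2"
    proof -
      have "(\<theta> - f) t = (\<lambda>x. c *\<^sub>R g t x)" for t by (simp add: \<theta>_def fun_diff_def)
      then have "?NX (\<theta> - f) = sqrt (\<integral>t. c\<^sup>2 * (L2_norm ?M (g t))\<^sup>2 \<partial>?I)"
        by (simp add: Bochner_L2_norm_def L2_norm_scaleR power_mult_distrib)
      also have "\<dots> = c * G" using c by (simp add: G_def Bochner_L2_norm_def real_sqrt_mult)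
      finally show ?thesis using G by (simp add: c_def)
    qed
    have im: "AE t in ?I. 0 = (?F \<theta> - ?F f) t"
      using image[of c] unfolding \<theta>_def[abs_def] by eventually_elim simp
    have imL: "?F \<theta> - ?F f \<in> L2 ?I"
      by (rule L2_cong_AE[OF _ L2_zero im]) simp
    have "L2_norm ?I (?F \<theta> - ?F f) = 0"
      unfolding L2_norm_eq_0_iff[OF imL] using im by eventually_elim simp
    with imL have "(\<forall>k::nat. \<theta> \<in> X \<inter> X \<and> ?NX (\<theta> - f) < R) \<and> \<not> (\<lambda>k::nat. ?NX (\<theta> - f)) \<longlonglongrightarrow> 0 \<and>
        (\<forall>k::nat. ?F \<theta> - ?F f \<in> Y) \<and> (\<lambda>k::nat. L2_norm ?I (?F \<theta> - ?F f)) \<longlonglongrightarrow> 0"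
      using R \<theta>X unfolding N\<theta> Y_def by (simp add: LIMSEQ_const_iff)
    then show "\<exists>\<theta>s::nat \<Rightarrow> real \<Rightarrow> real^3 \<Rightarrow> real^3. (\<forall>k. \<theta>s k \<in> X \<inter> X \<and> ?NX (\<theta>s k - f) < R) \<and>
        \<not> (\<lambda>k. ?NX (\<theta>s k - f)) \<longlonglongrightarrow> 0 \<and> (\<forall>k. ?F (\<theta>s k) - ?F f \<in> Y) \<and>
        (\<lambda>k. L2_norm ?I (?F (\<theta>s k) - ?F f)) \<longlonglongrightarrow> 0"
      by (intro exI[of _ "\<lambda>_. \<theta>"])
  qed
qed

end
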